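(* Let $\phi$ be a palindromic monotone automorphism of $F=\langle x,y\rangle$, $n\ge1$, and $T$ a finite tree of valence at most $3$. Regard $V_T$ as a subgroup of $W_T$ via the injective homomorphism induced by the inclusions $F_i\hookrightarrow G_i$, and put $u_i=c_{\nu_i}s_i\in G_{T,n}$ for $1\le i\le m$. Then the inclusion $V_T\hookrightarrow W_T$ together with the assignment $r_i\mapsto u_i$ ($1\le i\le m$) induces an injective homomorphism $S_{T,n}\to G_{T,n}$.
   Context: A word $w(x,y)$ is palindromic if $w(x^{-1},y^{-1})=w(x,y)^{-1}$; an automorphism of $F=\langle x,y\rangle$ is palindromic if it takes palindromic words to palindromic words. A word is monotone if it contains no $x^{-1},y^{-1}$, or contains no $x,y$; an automorphism is monotone if it takes monotone words to monotone words. Let $G=F\rtimes_{\phi^n}\langle t\rangle=\langle x,y,t\mid txt^{-1}=\phi^n(x),\ tyt^{-1}=\phi^n(y)\rangle$. Let $T$ be a finite (nonempty) tree with every vertex of valence at most $3$, $|T|$ its number of vertices. Assign disjoint index triples $(0,1,2),(3,4,5),\dots$ to the vertices; within a triple, $i+1$ denotes the cyclic successor of $i$. For each index $i$ let $F_i=\langle x_i,y_i\rangle$ be a copy of $F$ and $G_i=F_i\rtimes_{\phi^n}\langle t_i\rangle$ a copy of $G$. Put $a_i=x_i^{-1}x_{i+1}$, $b_i=y_i^{-1}y_{i+1}$, $c_i=t_it_{i+1}$, $A_i=\langle a_i,b_i\rangle\le F_i\times F_{i+1}$, $B_i=\langle a_i,b_i,c_i\rangle\le G_i\times G_{i+1}$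 (so $A_i\cong F$ and $B_i\cong G$ on these generators). At each vertex with triple $(i,j,k)$ assign distinct indices of the triple to the incident edges of $T$. $V_T$ is the fundamental group of the tree of groups with vertex groups $F_i\times F_j\times F_k$ in which, for each edge of $T$ with assigned indices $i,j$ at its two ends, $A_i$ is amalgamated with $A_j$ by $a_i=a_j^{-1}$, $b_i=b_j^{-1}$. $W_T$ is the fundamental group of the tree of groups with vertex groups $G_i\times G_j\times G_k$ in which, for each such edge, $B_i$ is amalgamated with $B_j$ by $a_i=a_j^{-1}$, $b_i=b_j^{-1}$, $c_i=c_j$. Picture each vertex of $T$ as a triangle with corners labeled by its triple, the side from corner $i$ to corner $i+1$, oriented this way, corresponding to index $i$; gluing sides whose indices are assigned to the same edge of $T$ by orientation-reversing maps gives a triangulated $(|T|+2)$-gon with coherently oriented boundary sides. The unassigned indices (boundary sides), in order along the boundary from a chosen one, are $\nu_0,\dots,\nu_m$, $m=|T|+1$. With $\phi^n(a_{\nu_i}),\phi^n(b_{\nu_i})$ meaning the words $\phi^n(x),\phi^n(y)$ with $x,y$ replaced by $a_{\nu_i},b_{\nu_i}$, define the multiple HNN extensions $$S_{T,n}=\langle V_T,r_1,\dots,r_m\mid r_ia_{\nu_0}r_i^{-1}=\phi^n(a_{\nu_i}),\ r_ib_{\nu_0}r_i^{-1}=\phi^n(b_{\nu_i}),\ 1\le i\le m\rangle,$$ $$G_{T,n}=\langle W_T,s_1,\dots,s_m\mid s_ia_{\nu_0}s_i^{-1}=a_{\nu_i},\ s_ib_{\nu_0}s_i^{-1}=b_{\nu_i},\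 s_ic_{\nu_0}s_i^{-1}=c_{\nu_i},\ 1\le i\le m\rangle.$$ *)

theory Defs
  imports "HOL-Algebra.Product_Groups" "Graph_Theory.Digraph_Component"
begin

section \<open>Words and presentations\<close>

text \<open>The letter \<open>(True, x)\<close> stands for \<open>x\<close> and \<open>(False, x)\<close> for its formal inverse.\<close>

type_synonym 'a gword = "(bool \<times> 'a) list"

definition words :: "'a set \<Rightarrow> 'a gword set" where
  "words X = lists (UNIV \<times> X)"

abbreviation letter :: "'a \<Rightarrow> 'a gword" where
  "letter x \<equiv> [(True, x)]"

definition invert_letters :: "'a gword \<Rightarrow> 'a gword" where
  "invert_letters w = map (\<lambda>(b, x). (\<not> b, x)) w"

inductive pres_eq :: "'a set \<Rightarrow> ('a gword \<times> 'a gword) set \<Rightarrow> 'a gword \<Rightarrow> 'a gword \<Rightarrow> bool"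
  for X :: "'a set" and R :: "('a gword \<times> 'a gword) set"
where
  refl: "u \<in> words X \<Longrightarrow> pres_eq X R u u"
| sym: "pres_eq X R u v \<Longrightarrow> pres_eq X R v u"
| trans: "pres_eq X R u v \<Longrightarrow> pres_eq X R v w \<Longrightarrow> pres_eq X R u w"
| append: "pres_eq X R u u' \<Longrightarrow> pres_eq X R v v' \<Longrightarrow> pres_eq X R (u @ v) (u' @ v')"
| cancel: "x \<in> X \<Longrightarrow> pres_eq X R [(b, x), (\<not> b, x)] []"
| rel: "(u, v) \<in> R \<Longrightarrow> u \<in> words X \<Longrightarrow> v \<in> words X \<Longrightarrow> pres_eq X R u v"

definition word_class :: "'a set \<Rightarrow> ('a gword \<times> 'a gword) set \<Rightarrow> 'a gword \<Rightarrow> 'a gword set" where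
  "word_class X R w = {u. pres_eq X R w u}"

text \<open>The group \<open>\<langle>X | u = v for (u, v) \<in> R\<rangle>\<close>; its elements are classes of words.\<close>

definition presented_group ::
    "'a set \<Rightarrow> ('a gword \<times> 'a gword) set \<Rightarrow> 'a gword set monoid" where
  "presented_group X R =
     \<lparr>carrier = word_class X R ` words X,
      monoid.mult = (\<lambda>p q. \<Union>u\<in>p. \<Union>v\<in>q. word_class X R (u @ v)),
      monoid.one = word_class X R []\<rparr>"

text \<open>The group \<open>\<langle>H, S | R\<rangle>\<close>: the free product of the group \<open>H\<close> and the free group on \<open>S\<close>, modulo
  the relations \<open>R\<close>. Elements of \<open>H\<close> are letters \<open>Inl h\<close>, and \<open>H\<close> itself is presented by its
  multiplication table.\<close>

definition relative_rels ::
    "'h monoid \<Rightarrow> (('h + 's) gword \<times> ('h + 's) gword) set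
      \<Rightarrow> (('h + 's) gword \<times> ('h + 's) gword) set" where
  "relative_rels H R =
     {([(True, Inl g), (True, Inl h)], letter (Inl (g \<otimes>\<^bsub>H\<^esub> h))) | g h.
        g \<in> carrier H \<and> h \<in> carrier H} \<union> R"

definition relative_presentation ::
    "'h monoid \<Rightarrow> 's set \<Rightarrow> (('h + 's) gword \<times> ('h + 's) gword) set
      \<Rightarrow> ('h + 's) gword set monoid" where
  "relative_presentation H S R = presented_group (carrier H <+> S) (relative_rels H R)"

definition relative_class ::
    "'h monoid \<Rightarrow> 's set \<Rightarrow> (('h + 's) gword \<times> ('h + 's) gword) set \<Rightarrow> ('h + 's) gword
      \<Rightarrow> ('h + 's) gword set" where
  "relative_class H S R = word_class (carrier H <+> S) (relative_rels H R)"

definition word_eval :: "'h monoid \<Rightarrow> ('a \<Rightarrow> 'h) \<Rightarrow> 'a gword \<Rightarrow> 'h" where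
  "word_eval H f w =
     foldr (\<lambda>(b, x) p. (if b then f x else inv\<^bsub>H\<^esub> (f x)) \<otimes>\<^bsub>H\<^esub> p) w \<one>\<^bsub>H\<^esub>"

text \<open>The map that an assignment \<open>f\<close> on generators induces on a presented group with values in \<open>H\<close>;
  it is meaningful when all words in a class have the same value.\<close>

definition induced_map :: "'h monoid \<Rightarrow> ('a \<Rightarrow> 'h) \<Rightarrow> 'a gword set \<Rightarrow> 'h" where
  "induced_map H f p = the_elem (word_eval H f ` p)"

lemma pres_eq_words:
  assumes "pres_eq X R u v"
  shows "u \<in> words X" "v \<in> words X"
  using assms by (induction) (auto simp: words_def)

lemma word_class_eqI: "pres_eq X R u v \<Longrightarrow> word_class X R u = word_class X R v"
  unfolding word_class_def by (blast intro: pres_eq.trans pres_eq.sym)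

lemma mult_word_class:
  assumes "u \<in> words X" "v \<in> words X"
  shows "word_class X R u \<otimes>\<^bsub>presented_group X R\<^esub> word_class X R v = word_class X R (u @ v)"
proof -
  have *: "word_class X R (u' @ v') = word_class X R (u @ v)"
    if "u' \<in> word_class X R u" "v' \<in> word_class X R v" for u' v'
  proof (rule word_class_eqI)
    have "pres_eq X R u u'" "pres_eq X R v v'"
      using that by (simp_all add: word_class_def)
    then show "pres_eq X R (u' @ v') (u @ v)"
      by (rule pres_eq.sym[OF pres_eq.append])
  qed
  have "u \<in> word_class X R u" "v \<in> word_class X R v"
    using assms by (simp_all add: word_class_def pres_eq.refl)
  moreover have "(\<Union>u'\<in>word_class X R u. \<Union>v'\<in>word_class X R v. word_class X R (u' @ v'))
      = (\<Union>u'\<in>word_class X R u. \<Union>v'\<in>word_class X R v. word_class X R (u @ v))"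
    by (intro SUP_cong HOL.refl *)
  ultimately show ?thesis
    by (auto simp: presented_group_def)
qed

lemma pres_eq_inverse:
  "w \<in> words X \<Longrightarrow> pres_eq X R (rev (invert_letters w) @ w) []"
proof (induction w)
  case Nil
  then show ?case by (auto simp: invert_letters_def intro: pres_eq.refl)
next
  case (Cons l w)
  obtain b x where l: "l = (b, x)" by force
  have x: "x \<in> X" and w: "w \<in> words X" using Cons.prems by (auto simp: words_def l)
  have iw: "rev (invert_letters w) \<in> words X"
    using w by (force simp: words_def invert_letters_def in_lists_conv_set)
  have "pres_eq X R [(\<not> b, x), (b, x)] []"
    using pres_eq.cancel[OF x, of R "\<not> b"] by simp
  then have "pres_eq X R (rev (invert_letters w) @ [(\<not> b, x), (b, x)] @ w)
      (rev (invert_letters w) @ [] @ w)"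
    by (intro pres_eq.append pres_eq.refl iw w)
  then show ?case
    using pres_eq.trans[OF _ Cons.IH[OF w]] by (simp add: l invert_letters_def)
qed

lemma group_presented_group: "group (presented_group X R)"
proof (rule groupI)
  let ?P = "presented_group X R"
  have car: "carrier ?P = word_class X R ` words X" and one: "\<one>\<^bsub>?P\<^esub> = word_class X R []"
    by (simp_all add: presented_group_def)
  have app: "u @ v \<in> words X" if "u \<in> words X" "v \<in> words X" for u v :: "'a gword"
    using that by (auto simp: words_def)
  have nil: "([] :: 'a gword) \<in> words X" by (simp add: words_def)
  show "\<one>\<^bsub>?P\<^esub> \<in> carrier ?P" using nil by (simp add: car one)
  show "p \<otimes>\<^bsub>?P\<^esub> q \<in> carrier ?P" if "p \<in> carrier ?P" "q \<in> carrier ?P" for p q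
    using that app by (auto simp: car mult_word_class)
  show "p \<otimes>\<^bsub>?P\<^esub> q \<otimes>\<^bsub>?P\<^esub> r = p \<otimes>\<^bsub>?P\<^esub> (q \<otimes>\<^bsub>?P\<^esub> r)"
    if "p \<in> carrier ?P" "q \<in> carrier ?P" "r \<in> carrier ?P" for p q r
    using that app by (auto simp: car mult_word_class)
  show "\<one>\<^bsub>?P\<^esub> \<otimes>\<^bsub>?P\<^esub> p = p" if "p \<in> carrier ?P" for p
    using that nil by (auto simp: car one mult_word_class)
  show "\<exists>q\<in>carrier ?P. q \<otimes>\<^bsub>?P\<^esub> p = \<one>\<^bsub>?P\<^esub>" if p: "p \<in> carrier ?P" for p
  proof -
    obtain w where w: "p = word_class X R w" "w \<in> words X" using p by (auto simp: car)
    have iw: "rev (invert_letters w) \<in> words X"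
      using w(2) by (force simp: words_def invert_letters_def in_lists_conv_set)
    show ?thesis
      using w iw pres_eq_inverse[OF w(2), of R, THEN word_class_eqI]
      by (auto simp: car one mult_word_class intro!: bexI[of _ "word_class X R (rev (invert_letters w))"])
  qed
qed


section \<open>The groups \<open>F\<close> and \<open>G\<close>, palindromic and monotone automorphisms\<close>

datatype gen = gen_x | gen_y | gen_t

definition F_gens :: "gen set" where "F_gens = {gen_x, gen_y}"

definition F_rels :: "(gen gword \<times> gen gword) set" where "F_rels = {}"

definition F_grp :: "gen gword set monoid" where "F_grp = presented_group F_gens F_rels"

definition F_class :: "gen gword \<Rightarrow> gen gword set" where "F_class = word_class F_gens F_rels"

definition palindromic_elem :: "gen gword set \<Rightarrow> bool" where
  "palindromic_elem p \<longleftrightarrow>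
     (\<exists>w\<in>words F_gens. p = F_class w \<and> F_class (invert_letters w) = inv\<^bsub>F_grp\<^esub> p)"

text \<open>A word all of whose letters have the same sign is reduced, so this says that the reduced word
  of \<open>p\<close> is monotone.\<close>

definition monotone_elem :: "gen gword set \<Rightarrow> bool" where
  "monotone_elem p \<longleftrightarrow>
     (\<exists>w\<in>words F_gens. p = F_class w \<and> ((\<forall>l\<in>set w. fst l) \<or> (\<forall>l\<in>set w. \<not> fst l)))"

definition palindromic_aut :: "(gen gword set \<Rightarrow> gen gword set) \<Rightarrow> bool" where
  "palindromic_aut \<phi> \<longleftrightarrow> \<phi> \<in> iso F_grp F_grp \<and>
     (\<forall>p\<in>carrier F_grp. palindromic_elem p \<longrightarrow> palindromic_elem (\<phi> p))"

definition monotone_aut :: "(gen gword set \<Rightarrow> gen gword set) \<Rightarrow> bool" where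
  "monotone_aut \<phi> \<longleftrightarrow> \<phi> \<in> iso F_grp F_grp \<and>
     (\<forall>p\<in>carrier F_grp. monotone_elem p \<longrightarrow> monotone_elem (\<phi> p))"

definition G_gens :: "gen set" where "G_gens = {gen_x, gen_y, gen_t}"

text \<open>Elements of \<open>F\<close> are classes of words. On the right-hand side of a relation, \<open>\<phi>\<^sup>n(x)\<close> may be any
  word of its class: the resulting relations are all equivalent.\<close>

definition G_rels ::
    "(gen gword set \<Rightarrow> gen gword set) \<Rightarrow> nat \<Rightarrow> (gen gword \<times> gen gword) set" where
  "G_rels \<phi> n =
     {([(True, gen_t), (True, g), (False, gen_t)], w) | g w.
        g \<in> F_gens \<and> w \<in> (\<phi> ^^ n) (F_class (letter g))}"


section \<open>Vertex groups and their side subgroups\<close>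

definition triple :: "nat \<Rightarrow> nat set" where
  "triple k = {3 * k, 3 * k + 1, 3 * k + 2}"

definition csucc :: "nat \<Rightarrow> nat" where
  "csucc i = 3 * (i div 3) + (i + 1) mod 3"

text \<open>In this section \<open>(X, R)\<close> is the presentation of \<open>F\<close> or that of \<open>G\<close>. All copies of the group are
  the same group; \<open>copy_elem X R i p\<close> is the element \<open>p\<close> of the \<open>i\<close>-th factor of its vertex group.\<close>

definition vertex_group ::
    "gen set \<Rightarrow> (gen gword \<times> gen gword) set \<Rightarrow> nat \<Rightarrow> (nat \<Rightarrow> gen gword set) monoid" where
  "vertex_group X R k = product_group (triple k) (\<lambda>_. presented_group X R)"

definition copy_elem ::
    "gen set \<Rightarrow> (gen gword \<times> gen gword) set \<Rightarrow> nat \<Rightarrow> gen gword set \<Rightarrow> nat \<Rightarrow> gen gword set" where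
  "copy_elem X R i p =
     (\<lambda>j\<in>triple (i div 3). if j = i then p else \<one>\<^bsub>presented_group X R\<^esub>)"

text \<open>The elements \<open>a\<^sub>i = x\<^sub>i\<inverse>x\<^sub>i\<^sub>+\<^sub>1\<close>, \<open>b\<^sub>i = y\<^sub>i\<inverse>y\<^sub>i\<^sub>+\<^sub>1\<close>, \<open>c\<^sub>i = t\<^sub>it\<^sub>i\<^sub>+\<^sub>1\<close>.\<close>

fun side_elem ::
    "gen set \<Rightarrow> (gen gword \<times> gen gword) set \<Rightarrow> nat \<Rightarrow> gen \<Rightarrow> nat \<Rightarrow> gen gword set" where
  "side_elem X R i gen_t =
     copy_elem X R i (word_class X R (letter gen_t))
       \<otimes>\<^bsub>vertex_group X R (i div 3)\<^esub>
     copy_elem X R (csucc i) (word_class X R (letter gen_t))"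
| "side_elem X R i g =
     inv\<^bsub>vertex_group X R (i div 3)\<^esub> (copy_elem X R i (word_class X R (letter g)))
       \<otimes>\<^bsub>vertex_group X R (i div 3)\<^esub>
     copy_elem X R (csucc i) (word_class X R (letter g))"

text \<open>The elements \<open>a\<^sub>i\<inverse>\<close>, \<open>b\<^sub>i\<inverse>\<close>, \<open>c\<^sub>i\<close>.\<close>

fun opposite_side_elem ::
    "gen set \<Rightarrow> (gen gword \<times> gen gword) set \<Rightarrow> nat \<Rightarrow> gen \<Rightarrow> nat \<Rightarrow> gen gword set" where
  "opposite_side_elem X R i gen_t = side_elem X R i gen_t"
| "opposite_side_elem X R i g = inv\<^bsub>vertex_group X R (i div 3)\<^esub> (side_elem X R i g)"


section \<open>Trees, index assignments and the boundary polygon\<close>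

text \<open>A finite simple graph is a finite symmetric loop-free digraph, so every edge is also a directed
  cycle of length 2. The library's predicate \<open>tree\<close> forbids those (and allows undirected cycles
  without a consistent direction), whence the length condition here.\<close>

definition finite_tree :: "'v pair_pre_digraph \<Rightarrow> bool" where
  "finite_tree T \<longleftrightarrow> pair_graph T \<and> Digraph_Component.connected (with_proj T) \<and>
     \<not> (\<exists>p. pre_digraph.cycle (with_proj T) p \<and> 3 \<le> length p)"

text \<open>\<open>num\<close> enumerates the vertices, so that \<open>triple (num v)\<close> is the triple of \<open>v\<close>, and \<open>side u v\<close> is
  the index of the triple of \<open>u\<close> assigned to the edge \<open>{u, v}\<close>.\<close>

definition index_assignment ::
    "'v pair_pre_digraph \<Rightarrow> ('v \<Rightarrow> nat) \<Rightarrow> ('v \<Rightarrow> 'v \<Rightarrow> nat) \<Rightarrow> bool" where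
  "index_assignment T num side \<longleftrightarrow>
     bij_betw num (pverts T) {0..<card (pverts T)} \<and>
     (\<forall>(u, v)\<in>parcs T. side u v \<in> triple (num u)) \<and>
     (\<forall>u\<in>pverts T. inj_on (side u) {v. (u, v) \<in> parcs T})"

definition vertex_of :: "'v pair_pre_digraph \<Rightarrow> ('v \<Rightarrow> nat) \<Rightarrow> nat \<Rightarrow> 'v" where
  "vertex_of T num i = the_inv_into (pverts T) num (i div 3)"

text \<open>Side \<open>i\<close> runs from corner \<open>i\<close> to corner \<open>csucc i\<close>. Gluing side \<open>i\<close> to side \<open>j\<close> with reversed
  orientation identifies corner \<open>i\<close> with corner \<open>csucc j\<close> and corner \<open>csucc i\<close> with corner \<open>j\<close>; the
  second identification comes from the opposite arc. Two indices are related when the corners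
  become the same vertex of the polygon.\<close>

definition same_corner ::
    "'v pair_pre_digraph \<Rightarrow> ('v \<Rightarrow> 'v \<Rightarrow> nat) \<Rightarrow> nat \<Rightarrow> nat \<Rightarrow> bool" where
  "same_corner T side =
     equivclp (\<lambda>p q. \<exists>(u, v)\<in>parcs T. p = side u v \<and> q = csucc (side v u))"

definition boundary_enumeration ::
    "'v pair_pre_digraph \<Rightarrow> ('v \<Rightarrow> 'v \<Rightarrow> nat) \<Rightarrow> (nat \<Rightarrow> nat) \<Rightarrow> bool" where
  "boundary_enumeration T side \<nu> \<longleftrightarrow>
     (let m = card (pverts T) + 1 in
       bij_betw \<nu> {0..m}
         ({0..<3 * card (pverts T)} - {side u v | u v. (u, v) \<in> parcs T}) \<and>
       (\<forall>k\<le>m. same_corner T side (csucc (\<nu> k)) (\<nu> ((k + 1) mod (m + 1)))))"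


section \<open>Trees of groups\<close>

text \<open>The fundamental group of a tree of groups: the free product of the vertex groups \<open>H v\<close>, modulo
  \<open>\<alpha> e k = \<beta> e k\<close> for every element \<open>k\<close> of the edge group \<open>K e\<close>, where \<open>\<alpha> e\<close> and \<open>\<beta> e\<close> are the
  monomorphisms of \<open>K e\<close> into the groups at the two ends of the arc \<open>e\<close>. Every edge occurs as two
  opposite arcs, which are to carry the same identification.\<close>

definition tree_rels ::
    "'v pair_pre_digraph \<Rightarrow> ('v \<Rightarrow> 'h monoid) \<Rightarrow> ('v \<times> 'v \<Rightarrow> 'k monoid) \<Rightarrow>
      ('v \<times> 'v \<Rightarrow> 'k \<Rightarrow> 'h) \<Rightarrow> ('v \<times> 'v \<Rightarrow> 'k \<Rightarrow> 'h) \<Rightarrow>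
      (('v \<times> 'h) gword \<times> ('v \<times> 'h) gword) set" where
  "tree_rels T H K \<alpha> \<beta> =
     {([(True, (v, g)), (True, (v, h))], letter (v, g \<otimes>\<^bsub>H v\<^esub> h)) | v g h.
        v \<in> pverts T \<and> g \<in> carrier (H v) \<and> h \<in> carrier (H v)} \<union>
     {(letter (u, \<alpha> (u, v) k), letter (v, \<beta> (u, v) k)) | u v k.
        (u, v) \<in> parcs T \<and> k \<in> carrier (K (u, v))}"

definition tree_gens :: "'v pair_pre_digraph \<Rightarrow> ('v \<Rightarrow> 'h monoid) \<Rightarrow> ('v \<times> 'h) set" where
  "tree_gens T H = (SIGMA v:pverts T. carrier (H v))"

text \<open>For \<open>(X, R)\<close> the presentation of \<open>F\<close> this yields \<open>V\<^sub>T\<close>, for that of \<open>G\<close> it yields \<open>W\<^sub>T\<close>. The edge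
  groups \<open>A\<^sub>i \<cong> F\<close> and \<open>B\<^sub>i \<cong> G\<close> are represented by \<open>F\<close> and \<open>G\<close> themselves, sent to the standard
  generators of \<open>A\<^sub>i\<close>, \<open>B\<^sub>i\<close> at one end and to the amalgamated elements at the other.\<close>

definition polygon_gens ::
    "gen set \<Rightarrow> (gen gword \<times> gen gword) set \<Rightarrow> 'v pair_pre_digraph \<Rightarrow> ('v \<Rightarrow> nat)
      \<Rightarrow> ('v \<times> (nat \<Rightarrow> gen gword set)) set" where
  "polygon_gens X R T num = tree_gens T (\<lambda>v. vertex_group X R (num v))"

definition polygon_rels ::
    "gen set \<Rightarrow> (gen gword \<times> gen gword) set \<Rightarrow> 'v pair_pre_digraph \<Rightarrow> ('v \<Rightarrow> nat)
      \<Rightarrow> ('v \<Rightarrow> 'v \<Rightarrow> nat)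
      \<Rightarrow> (('v \<times> (nat \<Rightarrow> gen gword set)) gword \<times> ('v \<times> (nat \<Rightarrow> gen gword set)) gword) set" where
  "polygon_rels X R T num side =
     tree_rels T (\<lambda>v. vertex_group X R (num v)) (\<lambda>_. presented_group X R)
       (\<lambda>(u, v). induced_map (vertex_group X R (num u)) (side_elem X R (side u v)))
       (\<lambda>(u, v). induced_map (vertex_group X R (num v)) (opposite_side_elem X R (side v u)))"

definition polygon_group ::
    "gen set \<Rightarrow> (gen gword \<times> gen gword) set \<Rightarrow> 'v pair_pre_digraph \<Rightarrow> ('v \<Rightarrow> nat)
      \<Rightarrow> ('v \<Rightarrow> 'v \<Rightarrow> nat) \<Rightarrow> ('v \<times> (nat \<Rightarrow> gen gword set)) gword set monoid" where
  "polygon_group X R T num side =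
     presented_group (polygon_gens X R T num) (polygon_rels X R T num side)"

text \<open>The element of the polygon group given by an element \<open>h\<close> of the vertex group to whose triple the
  index \<open>i\<close> belongs.\<close>

definition polygon_elem ::
    "gen set \<Rightarrow> (gen gword \<times> gen gword) set \<Rightarrow> 'v pair_pre_digraph \<Rightarrow> ('v \<Rightarrow> nat)
      \<Rightarrow> ('v \<Rightarrow> 'v \<Rightarrow> nat) \<Rightarrow> nat \<Rightarrow> (nat \<Rightarrow> gen gword set)
      \<Rightarrow> ('v \<times> (nat \<Rightarrow> gen gword set)) gword set" where
  "polygon_elem X R T num side i h =
     word_class (polygon_gens X R T num) (polygon_rels X R T num side) (letter (vertex_of T num i, h))"

abbreviation polygon_side_elem ::
    "gen set \<Rightarrow> (gen gword \<times> gen gword) set \<Rightarrow> 'v pair_pre_digraph \<Rightarrow> ('v \<Rightarrow> nat)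
      \<Rightarrow> ('v \<Rightarrow> 'v \<Rightarrow> nat) \<Rightarrow> nat \<Rightarrow> gen \<Rightarrow> ('v \<times> (nat \<Rightarrow> gen gword set)) gword set" where
  "polygon_side_elem X R T num side i g \<equiv> polygon_elem X R T num side i (side_elem X R i g)"

abbreviation V_grp where
  "V_grp T num side \<equiv> polygon_group F_gens F_rels T num side"

abbreviation W_grp where
  "W_grp \<phi> n T num side \<equiv> polygon_group G_gens (G_rels \<phi> n) T num side"


section \<open>The multiple HNN extensions\<close>

text \<open>The stable letters \<open>r\<^sub>i\<close> and \<open>s\<^sub>i\<close> are the letters \<open>Inr i\<close> with \<open>1 \<le> i \<le> m\<close>.\<close>

definition stable_letters :: "'v pair_pre_digraph \<Rightarrow> nat set" where
  "stable_letters T = {1..card (pverts T) + 1}"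

text \<open>Replacing \<open>x\<close>, \<open>y\<close> in the word \<open>\<phi>\<^sup>n(x)\<close> by elements of \<open>V\<^sub>T\<close> gives a word in the letters \<open>Inl\<close>;
  again any word of the class may be used.\<close>

definition S_rels ::
    "(gen gword set \<Rightarrow> gen gword set) \<Rightarrow> nat \<Rightarrow> 'v pair_pre_digraph \<Rightarrow> ('v \<Rightarrow> nat)
      \<Rightarrow> ('v \<Rightarrow> 'v \<Rightarrow> nat) \<Rightarrow> (nat \<Rightarrow> nat)
      \<Rightarrow> ((('v \<times> (nat \<Rightarrow> gen gword set)) gword set + nat) gword
         \<times> (('v \<times> (nat \<Rightarrow> gen gword set)) gword set + nat) gword) set" where
  "S_rels \<phi> n T num side \<nu> =
     {([(True, Inr i), (True, Inl (polygon_side_elem F_gens F_rels T num side (\<nu> 0) g)),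
        (False, Inr i)],
       map (\<lambda>(b, g'). (b, Inl (polygon_side_elem F_gens F_rels T num side (\<nu> i) g'))) w) | i g w.
        i \<in> stable_letters T \<and> g \<in> F_gens \<and> w \<in> (\<phi> ^^ n) (F_class (letter g))}"

definition S_grp where
  "S_grp \<phi> n T num side \<nu> =
     relative_presentation (V_grp T num side) (stable_letters T) (S_rels \<phi> n T num side \<nu>)"

definition S_class where
  "S_class \<phi> n T num side \<nu> =
     relative_class (V_grp T num side) (stable_letters T) (S_rels \<phi> n T num side \<nu>)"

definition GT_rels ::
    "(gen gword set \<Rightarrow> gen gword set) \<Rightarrow> nat \<Rightarrow> 'v pair_pre_digraph \<Rightarrow> ('v \<Rightarrow> nat)
      \<Rightarrow> ('v \<Rightarrow> 'v \<Rightarrow> nat) \<Rightarrow> (nat \<Rightarrow> nat)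
      \<Rightarrow> ((('v \<times> (nat \<Rightarrow> gen gword set)) gword set + nat) gword
         \<times> (('v \<times> (nat \<Rightarrow> gen gword set)) gword set + nat) gword) set" where
  "GT_rels \<phi> n T num side \<nu> =
     {([(True, Inr i), (True, Inl (polygon_side_elem G_gens (G_rels \<phi> n) T num side (\<nu> 0) g)),
        (False, Inr i)],
       letter (Inl (polygon_side_elem G_gens (G_rels \<phi> n) T num side (\<nu> i) g))) | i g.
        i \<in> stable_letters T \<and> g \<in> G_gens}"

definition GT_grp where
  "GT_grp \<phi> n T num side \<nu> =
     relative_presentation (W_grp \<phi> n T num side) (stable_letters T) (GT_rels \<phi> n T num side \<nu>)"

definition GT_class where
  "GT_class \<phi> n T num side \<nu> =
     relative_class (W_grp \<phi> n T num side) (stable_letters T) (GT_rels \<phi> n T num side \<nu>)"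

end

theory Submission
  imports Defs "HOL-Algebra.Bij" "HOL-Library.Countable_Set" "HOL-Library.Infinite_Set"
begin

text \<open>Instead of normal forms for amalgams and HNN extensions we use permutation actions on the
  natural numbers. The group \<open>S\<^sub>T\<^sub>,\<^sub>n\<close> acts on itself by translations, and for each vertex this is a
  free partial action of \<open>G\<^sub>i \<times> G\<^sub>j \<times> G\<^sub>k\<close>, defined on \<open>F\<^sub>i \<times> F\<^sub>j \<times> F\<^sub>k\<close> only. Every countable free partial
  action extends to a free action on a countable set with infinitely many further orbits. Two such
  actions whose partial traces agree on a common subgroup can be matched by an equivariant bijection,
  because the remaining orbits are regular and equally many. Matching along the edges of \<open>T\<close>, one
  leaf at a time, yields an action of \<open>W\<^sub>T\<close>; matching once more for each \<open>u\<^sub>i\<close> yields an action of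
  \<open>G\<^sub>T\<^sub>,\<^sub>n\<close> that restricts to the translation action of \<open>S\<^sub>T\<^sub>,\<^sub>n\<close>, so the homomorphism is injective. The
  same construction with \<open>V\<^sub>T\<close> in place of \<open>S\<^sub>T\<^sub>,\<^sub>n\<close> shows that \<open>V\<^sub>T\<close> embeds in \<open>W\<^sub>T\<close>, and with the empty
  set it shows that the vertex groups embed in \<open>S\<^sub>T\<^sub>,\<^sub>n\<close>. Palindromicity makes \<open>x \<mapsto> x\<inverse>\<close>, \<open>y \<mapsto> y\<inverse>\<close>,
  \<open>t \<mapsto> t\<close> an automorphism \<open>J\<close> of \<open>G\<close>, so that \<open>p \<mapsto> (J p, p)\<close> is an isomorphism from \<open>G\<close> to \<open>B\<^sub>i\<close>.\<close>

section \<open>Extending free partial actions\<close>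

text \<open>Freeness is what makes the matching possible: orbits that miss the embedded copy of the
  given set are regular, so no stabilizers have to be compared, and with infinitely many of them on
  both sides counting is no obstruction either. All that has to be checked is that the partial
  traces agree. Along an edge this says that amalgamated elements are defined together and move
  points alike. For a stable letter it says that \<open>k\<close> lies in F exactly when t k t^-1
  does, which rests on \<phi>^n being onto. This also explains the factor c in u_i = c s_i: s_i
  carries the side \<open>\<nu> 0\<close> to the side \<open>\<nu> i\<close> untwisted, and
  conjugation by c then induces \<phi>^n on the subgroup A of that side. The permutation for u_i is
  constructed first, because it must extend the translation by r_i; the one for s_i is obtained from
  it by removing c. The empty set has to be treated before the translation actions, since F_i x F_j
  x F_k acts freely on \<open>S\<^sub>T\<^sub>,\<^sub>n\<close> by translations only if it embeds
  there.\<close>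

definition free_action :: "'h monoid \<Rightarrow> ('h \<Rightarrow> nat \<Rightarrow> nat) \<Rightarrow> bool" where
  "free_action H act \<longleftrightarrow>
     (\<forall>g\<in>carrier H. \<forall>h\<in>carrier H. \<forall>n. act (g \<otimes>\<^bsub>H\<^esub> h) n = act g (act h n)) \<and>
     (\<forall>n. act \<one>\<^bsub>H\<^esub> n = n) \<and> (\<forall>h\<in>carrier H. \<forall>n. act h n = n \<longrightarrow> h = \<one>\<^bsub>H\<^esub>)"

lemma free_action_mult:
  "free_action H act \<Longrightarrow> g \<in> carrier H \<Longrightarrow> h \<in> carrier H \<Longrightarrow>
    act (g \<otimes>\<^bsub>H\<^esub> h) n = act g (act h n)"
  unfolding free_action_def by blast

lemma free_action_one: "free_action H act \<Longrightarrow> act \<one>\<^bsub>H\<^esub> n = n"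
  unfolding free_action_def by blast

lemma free_action_free:
  "free_action H act \<Longrightarrow> h \<in> carrier H \<Longrightarrow> act h n = n \<Longrightarrow> h = \<one>\<^bsub>H\<^esub>"
  unfolding free_action_def by blast

lemma free_action_inv:
  assumes "group H" "free_action H act" "h \<in> carrier H"
  shows "act (inv\<^bsub>H\<^esub> h) (act h n) = n" "act h (act (inv\<^bsub>H\<^esub> h) n) = n"
proof -
  interpret group H by fact
  show "act (inv\<^bsub>H\<^esub> h) (act h n) = n"
    using free_action_mult[OF assms(2), of "inv\<^bsub>H\<^esub> h" h n] assms
    by (simp add: free_action_one)
  show "act h (act (inv\<^bsub>H\<^esub> h) n) = n"
    using free_action_mult[OF assms(2), of h "inv\<^bsub>H\<^esub> h" n] assms
    by (simp add: free_action_one)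
qed

text \<open>Comparing two translates reduces to one group element moving one point to another, the
  form in which traces are recorded.\<close>

lemma free_action_eq_iff:
  assumes "group H" "free_action H act" "g \<in> carrier H" "h \<in> carrier H"
  shows "act g m = act h n \<longleftrightarrow> act (inv\<^bsub>H\<^esub> h \<otimes>\<^bsub>H\<^esub> g) m = n"
proof -
  interpret group H by fact
  have "act (inv\<^bsub>H\<^esub> h \<otimes>\<^bsub>H\<^esub> g) m = act (inv\<^bsub>H\<^esub> h) (act g m)"
    using assms by (simp add: free_action_mult)
  then show ?thesis
    using free_action_inv[OF assms(1,2,4)] by metis
qed

text \<open>Stabilizers are trivial, so a single point already separates group elements; 0 is an
  arbitrary choice.\<close>

lemma free_action_inj:
  assumes "group H" "free_action H act" "g \<in> carrier H" "h \<in> carrier H" "act g = act h"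
  shows "g = h"
proof -
  interpret group H by fact
  have "act g 0 = act h 0" using assms(5) by simp
  then have "act (inv\<^bsub>H\<^esub> h \<otimes>\<^bsub>H\<^esub> g) 0 = 0"
    unfolding free_action_eq_iff[OF assms(1-4)] .
  then have "inv\<^bsub>H\<^esub> h \<otimes>\<^bsub>H\<^esub> g = \<one>\<^bsub>H\<^esub>"
    using assms(3,4) by (intro free_action_free[OF assms(2)]) simp_all
  moreover have "h \<otimes>\<^bsub>H\<^esub> (inv\<^bsub>H\<^esub> h \<otimes>\<^bsub>H\<^esub> g) = g"
    using assms(3,4) by (simp add: m_assoc[symmetric])
  ultimately show ?thesis using assms(4) by simp
qed

lemma free_action_hom:
  assumes "group H" "group K" "free_action H act" "f \<in> hom K H" "inj_on f (carrier K)"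
  shows "free_action K (\<lambda>k. act (f k))"
proof -
  have one: "f \<one>\<^bsub>K\<^esub> = \<one>\<^bsub>H\<^esub>"
    using assms hom_one by blast
  have "k = \<one>\<^bsub>K\<^esub>" if "k \<in> carrier K" "act (f k) n = n" for k n
  proof -
    have "f k = f \<one>\<^bsub>K\<^esub>"
      using that assms one by (metis free_action_free hom_in_carrier)
    then show ?thesis
      using that assms(2,5) by (metis group.is_monoid inj_onD monoid.one_closed)
  qed
  then show ?thesis
    using assms(3,4) one
    by (auto simp: free_action_def hom_mult hom_in_carrier)
qed

lemma free_action_conjugate:
  assumes "free_action H act" "bij f"
  shows "free_action H (\<lambda>h n. f (act h (inv_into UNIV f n)))"
proof -
  have i: "inv_into UNIV f (f n) = n" "f (inv_into UNIV f n) = n" for n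
    using assms(2) by (simp_all add: bij_is_inj bij_is_surj surj_f_inv_f)
  show ?thesis
    unfolding free_action_def
  proof (intro conjI ballI allI impI)
    fix h n assume "h \<in> carrier H" "f (act h (inv_into UNIV f n)) = n"
    then show "h = \<one>\<^bsub>H\<^esub>"
      using free_action_free[OF assms(1), of h "inv_into UNIV f n"] i by metis
  qed (auto simp: i free_action_mult[OF assms(1)] free_action_one[OF assms(1)])
qed

text \<open>\<open>Y\<close> labels points that together meet every orbit, possibly several times.
  Equivariance forces f(k j1 y) = k j2 y; the trace hypothesis read from left to right makes this
  well defined, read from right to left it makes it injective, and the second covering makes it
  onto.\<close>

lemma equivariant_bij_of_traces:
  assumes K: "group K" and a1: "free_action K a1" and a2: "free_action K a2"
    and trace: "\<And>k y z. k \<in> carrier K \<Longrightarrow> y \<in> Y \<Longrightarrow> z \<in> Y \<Longrightarrow>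
      a1 k (j1 y) = j1 z \<longleftrightarrow> a2 k (j2 y) = j2 z"
    and cover1: "\<And>n. \<exists>k\<in>carrier K. \<exists>y\<in>Y. a1 k (j1 y) = n"
    and cover2: "\<And>n. \<exists>k\<in>carrier K. \<exists>y\<in>Y. a2 k (j2 y) = n"
  obtains f where "bij f" "\<And>k n. k \<in> carrier K \<Longrightarrow> f (a1 k n) = a2 k (f n)"
    "\<And>y. y \<in> Y \<Longrightarrow> f (j1 y) = j2 y"
proof -
  interpret group K by fact
  \<comment> \<open>Both equations become statements about the same element l^-1 k, to which the
    trace hypothesis applies.\<close>
  have key: "a1 k (j1 y) = a1 l (j1 z) \<longleftrightarrow> a2 k (j2 y) = a2 l (j2 z)"
    if "k \<in> carrier K" "l \<in> carrier K" "y \<in> Y" "z \<in> Y" for k l y z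
    unfolding free_action_eq_iff[OF K a1 that(1,2)] free_action_eq_iff[OF K a2 that(1,2)]
    by (rule trace) (use that in auto)
  define f where "f n = (SOME m. \<exists>k\<in>carrier K. \<exists>y\<in>Y. a1 k (j1 y) = n \<and> a2 k (j2 y) = m)" for n
  have f: "f (a1 k (j1 y)) = a2 k (j2 y)" if "k \<in> carrier K" "y \<in> Y" for k y
  proof -
    have "\<exists>l\<in>carrier K. \<exists>z\<in>Y. a1 l (j1 z) = a1 k (j1 y) \<and> a2 l (j2 z) = f (a1 k (j1 y))"
      unfolding f_def by (rule someI_ex) (use that in blast)
    then obtain l z where "l \<in> carrier K" "z \<in> Y" "a1 l (j1 z) = a1 k (j1 y)"
      "a2 l (j2 z) = f (a1 k (j1 y))" by blast
    then show ?thesis using key[of l k z y] that by simp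
  qed
  show thesis
  proof (rule that)
    show "bij f"
    proof (rule bijI)
      show "inj f"
      proof (rule injI)
        fix m n assume "f m = f n"
        moreover obtain k y where m: "k \<in> carrier K" "y \<in> Y" "a1 k (j1 y) = m"
          using cover1 by blast
        moreover obtain l z where n: "l \<in> carrier K" "z \<in> Y" "a1 l (j1 z) = n"
          using cover1 by blast
        ultimately have "a2 k (j2 y) = a2 l (j2 z)" using f[OF m(1,2)] f[OF n(1,2)] by simp
        then show "m = n" using key[OF m(1) n(1) m(2) n(2)] m(3) n(3) by simp
      qed
      have "\<exists>n. f n = m" for m
      proof -
        obtain k y where ky: "k \<in> carrier K" "y \<in> Y" "a2 k (j2 y) = m" using cover2 by blast
        then show ?thesis using f[OF ky(1,2)] by auto
      qed
      then show "surj f" unfolding surj_def by metis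
    qed
    show "f (a1 k n) = a2 k (f n)" if "k \<in> carrier K" for k n
    proof -
      obtain l z where lz: "l \<in> carrier K" "z \<in> Y" "a1 l (j1 z) = n" using cover1 by blast
      have "f (a1 (k \<otimes>\<^bsub>K\<^esub> l) (j1 z)) = a2 (k \<otimes>\<^bsub>K\<^esub> l) (j2 z)"
        using that lz by (intro f) auto
      moreover have "f n = a2 l (j2 z)" using f[OF lz(1,2)] lz(3) by simp
      ultimately show ?thesis
        using that lz by (simp add: free_action_mult[OF a1] free_action_mult[OF a2])
    qed
    show "f (j1 y) = j2 y" if "y \<in> Y" for y
      using f[OF one_closed that] by (simp add: free_action_one[OF a1] free_action_one[OF a2])
  qed
qed

text \<open>Infinitely many orbits miss \<open>J\<close>; they supply the room for extending partial bijections.\<close>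

definition roomy :: "'h monoid \<Rightarrow> ('h \<Rightarrow> nat \<Rightarrow> nat) \<Rightarrow> nat set \<Rightarrow> bool" where
  "roomy H act J \<longleftrightarrow> (\<exists>Z. infinite Z \<and>
     (\<forall>h\<in>carrier H. \<forall>z\<in>Z. act h z \<notin> J \<and> (\<forall>z'\<in>Z. act h z = z' \<longrightarrow> z = z')))"

text \<open>\<open>K\<close> moves points only through elements of \<open>H\<close>, so witnesses in
  different orbits of \<open>H\<close> stay in different orbits of \<open>K\<close>.\<close>

lemma roomy_hom: "roomy H act J \<Longrightarrow> f \<in> hom K H \<Longrightarrow> roomy K (\<lambda>k. act (f k)) J"
  unfolding roomy_def by (metis hom_in_carrier)

lemma roomy_conjugate:
  assumes "roomy H act J" "bij f"
  shows "roomy H (\<lambda>h n. f (act h (inv_into UNIV f n))) (f ` J)"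
proof -
  have i: "inv_into UNIV f (f n) = n" "f m = f n \<longleftrightarrow> m = n" for m n
    using assms(2) by (simp_all add: bij_is_inj inj_eq)
  obtain Z where Z: "infinite Z"
    "\<forall>h\<in>carrier H. \<forall>z\<in>Z. act h z \<notin> J \<and> (\<forall>z'\<in>Z. act h z = z' \<longrightarrow> z = z')"
    using assms(1) unfolding roomy_def by blast
  have "infinite (f ` Z)"
    using Z(1) assms(2) by (metis bij_betw_def finite_imageD inj_on_subset subset_UNIV)
  then show ?thesis
    unfolding roomy_def using Z(2) by (intro exI[of _ "f ` Z"]) (auto simp: i)
qed

text \<open>The sequence \<open>e\<close> picks one point from every orbit that misses the embedded
  set. Since points are natural numbers, the least element of an orbit is a canonical
  representative. Room makes the set of representatives infinite, so every such action has the same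
  index set for its missing orbits.\<close>

lemma new_orbits:
  assumes K: "group K" and a: "free_action K a" and room: "roomy K a (j ` X)"
  shows "\<exists>e :: nat \<Rightarrow> nat.
    (\<forall>k\<in>carrier K. \<forall>m n. a k (e m) = e n \<longleftrightarrow> k = \<one>\<^bsub>K\<^esub> \<and> m = n) \<and>
    (\<forall>k\<in>carrier K. \<forall>m. \<forall>x\<in>X. a k (e m) \<noteq> j x) \<and>
    (\<forall>n. (\<exists>k\<in>carrier K. \<exists>x\<in>X. a k (j x) = n) \<or> (\<exists>k\<in>carrier K. \<exists>m. a k (e m) = n))"
proof -
  interpret group K by fact
  define least where "least n \<longleftrightarrow> (\<forall>k\<in>carrier K. n \<le> a k n)" for n
  have ex_least: "\<exists>k\<in>carrier K. least (a k n)" for n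
  proof -
    let ?P = "\<lambda>m. \<exists>k\<in>carrier K. a k n = m"
    have "?P n" using free_action_one[OF a] by blast
    then obtain k where k: "k \<in> carrier K" "a k n = (LEAST m. ?P m)"
      using LeastI[of ?P n] by blast
    have "a k n \<le> a l (a k n)" if "l \<in> carrier K" for l
      unfolding k(2)
      by (rule Least_le) (use k that free_action_mult[OF a, of l k n] in \<open>metis m_closed\<close>)
    then show ?thesis using k(1) unfolding least_def by blast
  qed
  have least_unique: "m = n" if "least m" "least n" "k \<in> carrier K" "a k m = n" for k m n
    using that free_action_inv(1)[OF K a that(3), of m] unfolding least_def
    by (metis antisym inv_closed)
  define R where "R = {n. least n \<and> (\<forall>k\<in>carrier K. a k n \<notin> j ` X)}"
  obtain Z where Z: "infinite Z"
    "\<And>k z. k \<in> carrier K \<Longrightarrow> z \<in> Z \<Longrightarrow> a k z \<notin> j ` X"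
    "\<And>k z z'. k \<in> carrier K \<Longrightarrow> z \<in> Z \<Longrightarrow> z' \<in> Z \<Longrightarrow> a k z = z' \<Longrightarrow> z = z'"
    using room unfolding roomy_def by metis
  have "\<exists>c. \<forall>z. c z \<in> carrier K \<and> least (a (c z) z)"
    using ex_least by metis
  then obtain c where c: "\<And>z. c z \<in> carrier K" "\<And>z. least (a (c z) z)" by blast
  \<comment> \<open>Points of \<open>Z\<close> lie in different orbits, hence their orbits have
    different least elements. This embeds \<open>Z\<close> in \<open>R\<close>.\<close>
  have "inj_on (\<lambda>z. a (c z) z) Z"
  proof (rule inj_onI)
    fix z z' assume z: "z \<in> Z" "z' \<in> Z" "a (c z) z = a (c z') z'"
    then show "z = z'"
      using Z(3)[of "inv\<^bsub>K\<^esub> c z' \<otimes>\<^bsub>K\<^esub> c z" z z'] c(1) free_action_eq_iff[OF K a c(1) c(1)] by simp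
  qed
  then have "infinite ((\<lambda>z. a (c z) z) ` Z)"
    using Z(1) finite_imageD by blast
  moreover have "(\<lambda>z. a (c z) z) ` Z \<subseteq> R"
  proof clarify
    fix z assume "z \<in> Z"
    then have "a k (a (c z) z) \<notin> j ` X" if "k \<in> carrier K" for k
      using Z(2)[of "k \<otimes>\<^bsub>K\<^esub> c z" z] c(1) that by (simp add: free_action_mult[OF a])
    then show "a (c z) z \<in> R" unfolding R_def using c(2) by blast
  qed
  ultimately have inf: "infinite R"
    using finite_subset by blast
  define e where "e = enumerate R"
  have e: "bij_betw e UNIV R"
    unfolding e_def by (rule bij_enumerate[OF inf])
  have eR: "e m \<in> R" for m using e by (auto simp: bij_betw_def)
  show ?thesis
  proof (intro exI[of _ e] conjI ballI allI)
    fix k m n assume k: "k \<in> carrier K"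
    show "a k (e m) = e n \<longleftrightarrow> k = \<one>\<^bsub>K\<^esub> \<and> m = n"
    proof
      assume h: "a k (e m) = e n"
      then have "e m = e n"
        using least_unique[OF _ _ k h] eR unfolding R_def by blast
      moreover from this have "m = n"
        using e by (metis UNIV_I bij_betw_def inj_onD)
      ultimately show "k = \<one>\<^bsub>K\<^esub> \<and> m = n"
        using h free_action_free[OF a k] by metis
    qed (simp add: free_action_one[OF a])
  next
    fix k m x assume "k \<in> carrier K" "x \<in> X"
    then show "a k (e m) \<noteq> j x" using eR[of m] unfolding R_def by blast
  next
    fix n
    obtain k where k: "k \<in> carrier K" "least (a k n)" using ex_least by blast
    show "(\<exists>k\<in>carrier K. \<exists>x\<in>X. a k (j x) = n) \<or> (\<exists>k\<in>carrier K. \<exists>m. a k (e m) = n)"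
    \<comment> \<open>The least point of an orbit fails to be in \<open>R\<close> only if the orbit
      meets the embedded copy of \<open>X\<close>.\<close>
    proof (cases "a k n \<in> R")
      case True
      then obtain m where "a k n = e m" using e by (metis bij_betw_def imageE)
      then show ?thesis using free_action_inv(1)[OF K a k(1)] k(1) by (metis inv_closed)
    next
      case False
      then obtain l x where "l \<in> carrier K" "x \<in> X" "a l (a k n) = j x"
        using k unfolding R_def by blast
      then have "a (inv\<^bsub>K\<^esub> (l \<otimes>\<^bsub>K\<^esub> k)) (j x) = n"
        using free_action_inv(1)[OF K a, of "l \<otimes>\<^bsub>K\<^esub> k" n] k free_action_mult[OF a] by simp
      then show ?thesis using \<open>l \<in> carrier K\<close> \<open>x \<in> X\<close> k(1) by blast
    qed
  qed
qed

text \<open>Adding the representatives of the missing orbits to \<open>X\<close> gives labels that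
  meet every orbit. On the new labels the trace condition is automatic: these orbits are regular,
  pairwise different and disjoint from the old ones, in both actions.\<close>

lemma equivariant_extension:
  fixes j1 j2 :: "'x \<Rightarrow> nat"
  assumes K: "group K" and a1: "free_action K a1" and a2: "free_action K a2"
    and trace: "\<And>k y z. k \<in> carrier K \<Longrightarrow> y \<in> X \<Longrightarrow> z \<in> X \<Longrightarrow>
      a1 k (j1 y) = j1 z \<longleftrightarrow> a2 k (j2 y) = j2 z"
    and room: "roomy K a1 (j1 ` X)" "roomy K a2 (j2 ` X)"
  shows "\<exists>f. bij f \<and> (\<forall>k\<in>carrier K. \<forall>n. f (a1 k n) = a2 k (f n)) \<and> (\<forall>x\<in>X. f (j1 x) = j2 x)"
proof -
  interpret group K by fact
  obtain e1 :: "nat \<Rightarrow> nat" where E1: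
    "(\<forall>k\<in>carrier K. \<forall>m n. a1 k (e1 m) = e1 n \<longleftrightarrow> k = \<one>\<^bsub>K\<^esub> \<and> m = n) \<and>
     (\<forall>k\<in>carrier K. \<forall>m. \<forall>x\<in>X. a1 k (e1 m) \<noteq> j1 x) \<and>
     (\<forall>n. (\<exists>k\<in>carrier K. \<exists>x\<in>X. a1 k (j1 x) = n) \<or> (\<exists>k\<in>carrier K. \<exists>m. a1 k (e1 m) = n))"
    using new_orbits[OF K a1 room(1)] by (elim exE)
  note e1 = E1[THEN conjunct1, rule_format] E1[THEN conjunct2, THEN conjunct1, rule_format]
    E1[THEN conjunct2, THEN conjunct2, rule_format]
  obtain e2 :: "nat \<Rightarrow> nat" where E2:
    "(\<forall>k\<in>carrier K. \<forall>m n. a2 k (e2 m) = e2 n \<longleftrightarrow> k = \<one>\<^bsub>K\<^esub> \<and> m = n) \<and>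
     (\<forall>k\<in>carrier K. \<forall>m. \<forall>x\<in>X. a2 k (e2 m) \<noteq> j2 x) \<and>
     (\<forall>n. (\<exists>k\<in>carrier K. \<exists>x\<in>X. a2 k (j2 x) = n) \<or> (\<exists>k\<in>carrier K. \<exists>m. a2 k (e2 m) = n))"
    using new_orbits[OF K a2 room(2)] by (elim exE)
  note e2 = E2[THEN conjunct1, rule_format] E2[THEN conjunct2, THEN conjunct1, rule_format]
    E2[THEN conjunct2, THEN conjunct2, rule_format]
  \<comment> \<open>The converse direction of the disjointness of orbits, obtained by applying the
    inverse of \<open>k\<close>.\<close>
  have e1': "a1 k (j1 x) \<noteq> e1 m" if "k \<in> carrier K" "x \<in> X" for k m x
    using e1(2)[of "inv\<^bsub>K\<^esub> k" x m] that free_action_inv[OF K a1] by (metis inv_closed)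
  have e2': "a2 k (j2 x) \<noteq> e2 m" if "k \<in> carrier K" "x \<in> X" for k m x
    using e2(2)[of "inv\<^bsub>K\<^esub> k" x m] that free_action_inv[OF K a2] by (metis inv_closed)
  define Y :: "('x + nat) set" where "Y = X <+> UNIV"
  obtain f where f: "bij f" "\<And>k n. k \<in> carrier K \<Longrightarrow> f (a1 k n) = a2 k (f n)"
    "\<And>y. y \<in> Y \<Longrightarrow> f (case_sum j1 e1 y) = case_sum j2 e2 y"
  proof (rule equivariant_bij_of_traces[OF K a1 a2, of Y "case_sum j1 e1" "case_sum j2 e2"])
    fix k y z assume "k \<in> carrier K" "y \<in> Y" "z \<in> Y"
    then show "a1 k (case_sum j1 e1 y) = case_sum j1 e1 z \<longleftrightarrow>
        a2 k (case_sum j2 e2 y) = case_sum j2 e2 z"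
      unfolding Y_def by (elim PlusE) (simp_all add: trace e1(1,2) e2(1,2) e1' e2')
  next
    fix n show "\<exists>k\<in>carrier K. \<exists>y\<in>Y. a1 k (case_sum j1 e1 y) = n"
      using e1(3)[of n]
    proof (elim disjE bexE exE)
      fix k x assume "k \<in> carrier K" "x \<in> X" "a1 k (j1 x) = n"
      then show ?thesis unfolding Y_def by (intro bexI[of _ k] bexI[of _ "Inl x"]) auto
    next
      fix k m assume "k \<in> carrier K" "a1 k (e1 m) = n"
      then show ?thesis unfolding Y_def by (intro bexI[of _ k] bexI[of _ "Inr m"]) auto
    qed
  next
    fix n show "\<exists>k\<in>carrier K. \<exists>y\<in>Y. a2 k (case_sum j2 e2 y) = n"
      using e2(3)[of n]
    proof (elim disjE bexE exE)
      fix k x assume "k \<in> carrier K" "x \<in> X" "a2 k (j2 x) = n"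
      then show ?thesis unfolding Y_def by (intro bexI[of _ k] bexI[of _ "Inl x"]) auto
    next
      fix k m assume "k \<in> carrier K" "a2 k (e2 m) = n"
      then show ?thesis unfolding Y_def by (intro bexI[of _ k] bexI[of _ "Inr m"]) auto
    qed
  next
    fix f assume "bij f" "\<And>k n. k \<in> carrier K \<Longrightarrow> f (a1 k n) = a2 k (f n)"
      "\<And>y. y \<in> Y \<Longrightarrow> f (case_sum j1 e1 y) = case_sum j2 e2 y"
    then show thesis by (rule that)
  qed
  have "f (j1 x) = j2 x" if "x \<in> X" for x
    using f(3)[of "Inl x"] that by (simp add: Y_def InlI)
  then show ?thesis using f(1,2) by (intro exI[of _ f]) simp
qed

text \<open>\<open>D h x y\<close> says that \<open>h\<close> is defined at \<open>x\<close> and moves it to \<open>y\<close>.\<close>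

definition free_partial_action :: "'h monoid \<Rightarrow> 'x set \<Rightarrow> ('h \<Rightarrow> 'x \<Rightarrow> 'x \<Rightarrow> bool) \<Rightarrow> bool" where
  "free_partial_action H X D \<longleftrightarrow>
     (\<forall>x\<in>X. D \<one>\<^bsub>H\<^esub> x x) \<and>
     (\<forall>g\<in>carrier H. \<forall>h\<in>carrier H. \<forall>x\<in>X. \<forall>y\<in>X. \<forall>z\<in>X.
        D h x y \<longrightarrow> D g y z \<longrightarrow> D (g \<otimes>\<^bsub>H\<^esub> h) x z) \<and>
     (\<forall>h\<in>carrier H. \<forall>x\<in>X. \<forall>y\<in>X. D h x y \<longrightarrow> D (inv\<^bsub>H\<^esub> h) y x) \<and>
     (\<forall>h\<in>carrier H. \<forall>x\<in>X. D h x x \<longrightarrow> h = \<one>\<^bsub>H\<^esub>) \<and>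
     (\<forall>x\<in>X. \<forall>y\<in>X. D \<one>\<^bsub>H\<^esub> x y \<longrightarrow> x = y)"

text \<open>An equivalence and not just an implication: the action may not link embedded points
  beyond \<open>D\<close>, since otherwise the traces of two actions on a common subgroup could not
  be compared. At the unit it makes \<open>j\<close> injective whenever \<open>D\<close> is
  free.\<close>

definition extends_partial_action ::
    "'h monoid \<Rightarrow> 'x set \<Rightarrow> ('h \<Rightarrow> 'x \<Rightarrow> 'x \<Rightarrow> bool) \<Rightarrow> ('h \<Rightarrow> nat \<Rightarrow> nat) \<Rightarrow> ('x \<Rightarrow> nat) \<Rightarrow> bool" where
  "extends_partial_action H X D act j \<longleftrightarrow> free_action H act \<and> roomy H act (j ` X) \<and>
     (\<forall>h\<in>carrier H. \<forall>x\<in>X. \<forall>y\<in>X. act h (j x) = j y \<longleftrightarrow> D h x y)"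

lemma extends_partial_action_conjugate:
  assumes "extends_partial_action H X D act j" "bij f"
  shows "extends_partial_action H X D (\<lambda>h n. f (act h (inv_into UNIV f n))) (f \<circ> j)"
proof -
  have i: "inv_into UNIV f (f n) = n" "f m = f n \<longleftrightarrow> m = n" for m n
    using assms(2) by (simp_all add: bij_is_inj inj_eq)
  have "roomy H (\<lambda>h n. f (act h (inv_into UNIV f n))) ((f \<circ> j) ` X)"
    using roomy_conjugate[OF _ assms(2)] assms(1)
    unfolding extends_partial_action_def by (metis image_comp)
  then show ?thesis
    using assms free_action_conjugate[OF _ assms(2), of H act]
    unfolding extends_partial_action_def by (simp add: i)
qed

lemma extends_partial_action_cong:
  assumes "\<And>x. x \<in> X \<Longrightarrow> j x = j' x"
  shows "extends_partial_action H X D act j = extends_partial_action H X D act j'"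
proof -
  have "j ` X = j' ` X" using assms by (rule image_cong[OF HOL.refl])
  then show ?thesis unfolding extends_partial_action_def using assms by simp
qed

text \<open>In each class of points linked by \<open>D\<close> choose a base point
  \<open>rep x\<close> and an element \<open>hh x\<close> carrying it to \<open>x\<close>. By
  freeness this element is unique, so x \<mapsto> \<open>hh x\<close> places the class inside one
  regular orbit. The product of \<open>H\<close> with the natural numbers, coded into the natural
  numbers by \<open>b\<close>, is a disjoint union of regular orbits that accommodates all classes
  at once.\<close>

lemma ex_extends_partial_action:
  assumes H: "group H" and cH: "countable (carrier H)" and cX: "countable X"
    and D: "free_partial_action H X D"
  obtains act j where "extends_partial_action H X D act j"
proof -
  interpret group H by fact
  have D1: "D \<one>\<^bsub>H\<^esub> x x" if "x \<in> X" for x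
    using that D unfolding free_partial_action_def by blast
  have Dm: "D (g \<otimes>\<^bsub>H\<^esub> h) x z"
    if "g \<in> carrier H" "h \<in> carrier H" "x \<in> X" "y \<in> X" "z \<in> X" "D h x y" "D g y z" for g h x y z
    using that D unfolding free_partial_action_def by blast
  have Di: "D (inv\<^bsub>H\<^esub> h) y x" if "h \<in> carrier H" "x \<in> X" "y \<in> X" "D h x y" for h x y
    using that D unfolding free_partial_action_def by blast
  have Df: "h = \<one>\<^bsub>H\<^esub>" if "h \<in> carrier H" "x \<in> X" "D h x x" for h x
    using that D unfolding free_partial_action_def by blast
  define rep where "rep x = (SOME y. y \<in> X \<and> (\<exists>h\<in>carrier H. D h y x))" for x
  define hh where "hh x = (SOME h. h \<in> carrier H \<and> D h (rep x) x)" for x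
  have rep: "rep x \<in> X \<and> (\<exists>h\<in>carrier H. D h (rep x) x)" if "x \<in> X" for x
    unfolding rep_def by (rule someI_ex) (use that D1 in blast)
  have hh: "hh x \<in> carrier H \<and> D (hh x) (rep x) x" if "x \<in> X" for x
    unfolding hh_def by (rule someI_ex) (use rep[OF that] in blast)
  have rep_eq: "rep x = rep y" if xy: "x \<in> X" "y \<in> X" "h \<in> carrier H" "D h x y" for x y h
  proof -
    have "(\<exists>h\<in>carrier H. D h z x) \<longleftrightarrow> (\<exists>h\<in>carrier H. D h z y)" if z: "z \<in> X" for z
    proof
      assume "\<exists>h\<in>carrier H. D h z x"
      then obtain g where "g \<in> carrier H" "D g z x" by blast
      then show "\<exists>h\<in>carrier H. D h z y"
        using Dm[of h g z x y] xy z by blast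
    next
      assume "\<exists>h\<in>carrier H. D h z y"
      then obtain g where "g \<in> carrier H" "D g z y" by blast
      then show "\<exists>h\<in>carrier H. D h z x"
        using Dm[of "inv\<^bsub>H\<^esub> h" g z y x] Di[of h x y] xy z by blast
    qed
    \<comment> \<open>Linked points give equivalent predicates, so the choice operator returns the
      same base point.\<close>
    then have "(z \<in> X \<and> (\<exists>h\<in>carrier H. D h z x)) = (z \<in> X \<and> (\<exists>h\<in>carrier H. D h z y))" for z
      by (intro conj_cong HOL.refl)
    then show ?thesis unfolding rep_def by simp
  qed
  define c where "c = to_nat_on X"
  have c: "c x = c y \<longleftrightarrow> x = y" if "x \<in> X" "y \<in> X" for x y
    unfolding c_def using that cX by simp
  define P where "P = carrier H \<times> (UNIV :: nat set)"
  have "countable P" unfolding P_def using cH by blast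
  moreover have "infinite P"
    unfolding P_def using one_closed infinite_UNIV_nat by (metis empty_iff finite_cartesian_productD2)
  ultimately obtain b where b: "bij_betw b P (UNIV :: nat set)"
    using countableE_infinite by blast
  define b' where "b' = the_inv_into P b"
  have b'b: "b' (b p) = p" if "p \<in> P" for p
    unfolding b'_def using b that by (simp add: bij_betw_def the_inv_into_f_f)
  have b': "b' n \<in> P" "b (b' n) = n" for n
    unfolding b'_def using b by (auto simp: bij_betw_def f_the_inv_into_f intro: the_inv_into_into)
  have binj: "b p = b q \<longleftrightarrow> p = q" if "p \<in> P" "q \<in> P" for p q
    using b that by (metis bij_betw_def inj_onD)
  define act where "act h n = b (h \<otimes>\<^bsub>H\<^esub> fst (b' n), snd (b' n))" for h n
  \<comment> \<open>Classes occupy the even levels only; the odd levels are the infinitely many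
    orbits demanded by \<open>roomy\<close>.\<close>
  define j where "j x = b (hh x, 2 * c (rep x))" for x
  have actb: "act h (b (g, m)) = b (h \<otimes>\<^bsub>H\<^esub> g, m)" if "g \<in> carrier H" for h g m
    unfolding act_def using that by (simp add: b'b P_def)
  have ex_b: "\<exists>g m. g \<in> carrier H \<and> n = b (g, m)" for n
    using b'[of n] by (metis P_def mem_Sigma_iff prod.collapse)
  have "free_action H act"
    unfolding free_action_def
  proof (intro conjI ballI allI impI)
    fix g h n assume "g \<in> carrier H" "h \<in> carrier H"
    moreover obtain g' m where "g' \<in> carrier H" "n = b (g', m)" using ex_b by blast
    ultimately show "act (g \<otimes>\<^bsub>H\<^esub> h) n = act g (act h n)" by (simp add: actb m_assoc)
  next
    fix n obtain g' m where "g' \<in> carrier H" "n = b (g', m)" using ex_b by blast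
    then show "act \<one>\<^bsub>H\<^esub> n = n" by (simp add: actb)
  next
    fix h n assume h: "h \<in> carrier H" and e: "act h n = n"
    obtain g' m where "g' \<in> carrier H" "n = b (g', m)" using ex_b by blast
    with h e show "h = \<one>\<^bsub>H\<^esub>" by (simp add: actb binj P_def)
  qed
  moreover have "roomy H act (j ` X)"
    unfolding roomy_def
  proof (intro exI conjI ballI impI)
    let ?z = "\<lambda>m. b (\<one>\<^bsub>H\<^esub>, 2 * m + 1)"
    have "inj ?z" by (rule injI) (simp add: binj P_def)
    then show "infinite (range ?z)" by (simp add: finite_image_iff)
    fix h z assume h: "h \<in> carrier H" and "z \<in> range ?z"
    then obtain m where z: "z = ?z m" by blast
    show "act h z \<notin> j ` X"
    proof
      assume "act h z \<in> j ` X"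
      then obtain x where "x \<in> X" "act h z = j x" by blast
      then have "2 * m + 1 = 2 * c (rep x)"
        using h hh by (simp add: z actb j_def binj P_def)
      then show False by presburger
    qed
    fix z' assume "z' \<in> range ?z" "act h z = z'"
    then show "z = z'" using h by (auto simp: z actb binj P_def)
  qed
  moreover have "act g (j x) = j y \<longleftrightarrow> D g x y"
    if g: "g \<in> carrier H" and x: "x \<in> X" and y: "y \<in> X" for g x y
  proof -
    have *: "act g (j x) = j y \<longleftrightarrow> g \<otimes>\<^bsub>H\<^esub> hh x = hh y \<and> rep x = rep y"
      using g hh[OF x] hh[OF y] rep[OF x] rep[OF y] by (simp add: j_def actb binj P_def c)
    show ?thesis
    proof
      assume "act g (j x) = j y"
      then have e: "g \<otimes>\<^bsub>H\<^esub> hh x = hh y" "rep x = rep y" using * by auto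
      then have "D (hh y \<otimes>\<^bsub>H\<^esub> inv\<^bsub>H\<^esub> (hh x)) x y"
        using Dm[of "hh y" "inv\<^bsub>H\<^esub> (hh x)" x "rep x" y] Di hh[OF x] hh[OF y] rep[OF x] x y by simp
      moreover have "hh y \<otimes>\<^bsub>H\<^esub> inv\<^bsub>H\<^esub> (hh x) = g"
        using e g hh[OF x] by (metis inv_closed m_assoc r_inv r_one)
      ultimately show "D g x y" by simp
    next
      assume d: "D g x y"
      then have r: "rep x = rep y" using rep_eq g x y by blast
      have "D (g \<otimes>\<^bsub>H\<^esub> hh x) (rep x) y"
        using Dm[of g "hh x" "rep x" x y] d g hh[OF x] rep[OF x] x y by simp
      \<comment> \<open>Going from the base point to \<open>x\<close>, then to \<open>y\<close> and
        back is a loop, which freeness forces to be the unit.\<close>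
      then have "D (inv\<^bsub>H\<^esub> (hh y) \<otimes>\<^bsub>H\<^esub> (g \<otimes>\<^bsub>H\<^esub> hh x)) (rep x) (rep x)"
        using Dm[of "inv\<^bsub>H\<^esub> (hh y)" "g \<otimes>\<^bsub>H\<^esub> hh x" "rep x" y "rep x"] Di[of "hh y" "rep y" y]
          g hh[OF x] hh[OF y] rep[OF x] rep[OF y] r x y by simp
      then have "inv\<^bsub>H\<^esub> (hh y) \<otimes>\<^bsub>H\<^esub> (g \<otimes>\<^bsub>H\<^esub> hh x) = \<one>\<^bsub>H\<^esub>"
        using Df[of _ "rep x"] g hh[OF x] hh[OF y] rep[OF x] by simp
      then have "g \<otimes>\<^bsub>H\<^esub> hh x = hh y"
        using g hh[OF x] hh[OF y] by (metis inv_closed inv_equality inv_inv inv_comm m_closed)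
      then show "act g (j x) = j y" using * r by simp
    qed
  qed
  ultimately show thesis
    using that unfolding extends_partial_action_def by blast
qed

lemma roomy_mono:
  assumes "roomy H act J" "J' \<subseteq> J" shows "roomy H act J'"
proof -
  obtain Z where "infinite Z"
    "\<forall>h\<in>carrier H. \<forall>z\<in>Z. act h z \<notin> J \<and> (\<forall>z'\<in>Z. act h z = z' \<longrightarrow> z = z')"
    using assms(1) unfolding roomy_def by (elim exE conjE)
  then show ?thesis
    unfolding roomy_def using assms(2) by (intro exI[of _ Z]) (simp, meson subsetD)
qed

text \<open>The permutation for a stable letter: it conjugates one associated subgroup to the other
  and extends a prescribed map \<open>r\<close> on the embedded set. Later \<open>r\<close> is left
  translation by r_i, and \<open>j\<close> is shared because both vertex groups belong to one action
  of the polygon group.\<close>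

lemma stable_letter_ex:
  fixes K :: "'k monoid" and H1 :: "'h monoid" and H2 :: "'h2 monoid"
  assumes groups: "group K" "group H1" "group H2"
    and ext1: "extends_partial_action H1 X D1 act1 j" and ext2: "extends_partial_action H2 X D2 act2 j"
    and \<alpha>: "\<alpha> \<in> hom K H1" "inj_on \<alpha> (carrier K)" and \<beta>: "\<beta> \<in> hom K H2" "inj_on \<beta> (carrier K)"
    and r: "\<And>x. x \<in> X \<Longrightarrow> r x \<in> X"
    and trace: "\<And>k x y. k \<in> carrier K \<Longrightarrow> x \<in> X \<Longrightarrow> y \<in> X \<Longrightarrow>
      D1 (\<alpha> k) x y \<longleftrightarrow> D2 (\<beta> k) (r x) (r y)"
  shows "\<exists>f. bij f \<and> (\<forall>k\<in>carrier K. \<forall>n. f (act1 (\<alpha> k) n) = act2 (\<beta> k) (f n)) \<and>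
    (\<forall>x\<in>X. f (j x) = j (r x))"
proof (rule equivariant_extension[where ?a1.0 = "\<lambda>k. act1 (\<alpha> k)" and ?a2.0 = "\<lambda>k. act2 (\<beta> k)"
      and ?j1.0 = j and ?j2.0 = "\<lambda>x. j (r x)", OF groups(1)])
  note e1 = ext1[unfolded extends_partial_action_def] and e2 = ext2[unfolded extends_partial_action_def]
  show "free_action K (\<lambda>k. act1 (\<alpha> k))"
    by (rule free_action_hom[OF groups(2,1) e1[THEN conjunct1] \<alpha>])
  show "free_action K (\<lambda>k. act2 (\<beta> k))"
    by (rule free_action_hom[OF groups(3,1) e2[THEN conjunct1] \<beta>])
  show "roomy K (\<lambda>k. act1 (\<alpha> k)) (j ` X)"
    by (rule roomy_hom[OF e1[THEN conjunct2, THEN conjunct1] \<alpha>(1)])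
  have "(\<lambda>x. j (r x)) ` X \<subseteq> j ` X" using r by (intro image_subsetI imageI)
  then show "roomy K (\<lambda>k. act2 (\<beta> k)) ((\<lambda>x. j (r x)) ` X)"
    by (rule roomy_mono[OF roomy_hom[OF e2[THEN conjunct2, THEN conjunct1] \<beta>(1)]])
  fix k x y assume k: "k \<in> carrier K" and x: "x \<in> X" and y: "y \<in> X"
  have "act1 (\<alpha> k) (j x) = j y \<longleftrightarrow> D1 (\<alpha> k) x y"
    by (rule e1[THEN conjunct2, THEN conjunct2, rule_format, OF hom_in_carrier[OF \<alpha>(1) k] x y])
  also have "\<dots> \<longleftrightarrow> D2 (\<beta> k) (r x) (r y)"
    by (rule trace[OF k x y])
  also have "\<dots> \<longleftrightarrow> act2 (\<beta> k) (j (r x)) = j (r y)"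
    by (rule e2[THEN conjunct2, THEN conjunct2, rule_format,
          OF hom_in_carrier[OF \<beta>(1) k] r[OF x] r[OF y], symmetric])
  finally show "act1 (\<alpha> k) (j x) = j y \<longleftrightarrow> act2 (\<beta> k) (j (r x)) = j (r y)" .
qed

section \<open>Actions along a tree\<close>

lemma pcas_snoc: "pcas a p u \<Longrightarrow> pcas a (p @ [(u, w)]) w"
  by (induction a p u rule: pcas.induct) auto

lemma pawalk_verts_snoc: "pcas a p u \<Longrightarrow> pawalk_verts a (p @ [(u, w)]) = pawalk_verts a p @ [w]"
  by (induction a p u rule: pcas.induct) auto

text \<open>A walk from a vertex of \<open>U\<close> to one outside has to leave \<open>U\<close>
  along some arc. The walk exists because a connected symmetric digraph is strongly
  connected.\<close>

lemma finite_tree_leaves_set: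
  assumes T: "finite_tree T" and U: "U \<subseteq> pverts T" "U \<noteq> {}" "U \<noteq> pverts T"
  shows "\<exists>u\<in>U. \<exists>w\<in>pverts T - U. (u, w) \<in> parcs T"
proof -
  interpret pair_graph T using T unfolding finite_tree_def by blast
  have "strongly_connected (with_proj T)"
    using T unfolding finite_tree_def
    by (intro symmetric_connected_imp_strongly_connected pair_sym_arcs) auto
  moreover obtain a b where ab: "a \<in> U" "b \<in> pverts T" "b \<notin> U"
    using U by blast
  ultimately have "a \<rightarrow>\<^sup>*\<^bsub>with_proj T\<^esub> b"
    using U(1) unfolding strongly_connected_def by auto
  then obtain p where "awalk a p b"
    using reachable_awalk by blast
  then show ?thesis
    using ab
  proof (induction p arbitrary: a)
    case Nil
    then show ?case by (simp add: awalk_def)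
  next
    case (Cons e p)
    then have e: "e \<in> parcs T" "fst e = a" "awalk (snd e) p b"
      by (auto simp: awalk_Cons_iff)
    show ?case
    proof (cases "snd e \<in> U")
      case True
      then show ?thesis using Cons.IH e(3) Cons.prems by blast
    next
      case False
      have "(a, snd e) \<in> parcs T" "snd e \<in> pverts T"
        using e arc_snd_in_verts by auto
      then show ?thesis using False Cons.prems(2) by blast
    qed
  qed
qed

text \<open>Paths are required to be simple because a cycle must not repeat vertices, and to stay in
  \<open>U\<close> so that a vertex outside \<open>U\<close> can be added to them.\<close>

definition path_connected_in :: "'v pair_pre_digraph \<Rightarrow> 'v set \<Rightarrow> bool" where
  "path_connected_in T U \<longleftrightarrow> (\<forall>a\<in>U. \<forall>b\<in>U. \<exists>p. pcas a p b \<and> set p \<subseteq> parcs T \<and>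
     distinct (pawalk_verts a p) \<and> set (pawalk_verts a p) \<subseteq> U)"

lemma path_connected_in_insert:
  assumes "path_connected_in T U" "u \<in> U" "w \<notin> U" "(u, w) \<in> parcs T" "(w, u) \<in> parcs T"
  shows "path_connected_in T (insert w U)"
  unfolding path_connected_in_def
proof (intro ballI)
  fix a b assume ab: "a \<in> insert w U" "b \<in> insert w U"
  let ?P = "\<lambda>p. pcas a p b \<and> set p \<subseteq> parcs T \<and>
     distinct (pawalk_verts a p) \<and> set (pawalk_verts a p) \<subseteq> insert w U"
  consider "a \<in> U" "b \<in> U" | "a = w" "b = w" | "a = w" "b \<in> U" | "a \<in> U" "b = w"
    using ab by blast
  then show "\<exists>p. ?P p"
  proof cases
    case 1
    then show ?thesis using assms(1) unfolding path_connected_in_def by blast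
  next
    case 2
    then show ?thesis by (intro exI[of _ "[]"]) simp
  next
    case 3
    then obtain p where "pcas u p b" "set p \<subseteq> parcs T"
      "distinct (pawalk_verts u p)" "set (pawalk_verts u p) \<subseteq> U"
      using assms(1,2) unfolding path_connected_in_def by blast
    then have "?P ((w, u) # p)" using 3 assms by auto
    then show ?thesis by blast
  next
    case 4
    then obtain p where "pcas a p u" "set p \<subseteq> parcs T"
      "distinct (pawalk_verts a p)" "set (pawalk_verts a p) \<subseteq> U"
      using assms(1,2) unfolding path_connected_in_def by blast
    then have "?P (p @ [(u, w)])"
      using 4 assms by (auto simp: pcas_snoc pawalk_verts_snoc)
    then show ?thesis by blast
  qed
qed

text \<open>Two different neighbours of \<open>w\<close> in \<open>U\<close>, joined by a simple
  path in \<open>U\<close>, would close up through \<open>w\<close> to a cycle. The path has at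
  least one arc, so the cycle has length at least 3 and is not one of the back-and-forth cycles
  along an edge.\<close>

lemma finite_tree_unique_attachment:
  assumes T: "finite_tree T" and U: "path_connected_in T U"
    and arcs: "u \<in> U" "u' \<in> U" "w \<notin> U" "(u, w) \<in> parcs T" "(w, u') \<in> parcs T"
  shows "u = u'"
proof (rule ccontr)
  interpret pair_graph T using T unfolding finite_tree_def by blast
  assume "u \<noteq> u'"
  obtain p where p: "pcas u' p u" "set p \<subseteq> parcs T"
    "distinct (pawalk_verts u' p)" "set (pawalk_verts u' p) \<subseteq> U"
    using U arcs(1,2) unfolding path_connected_in_def by blast
  have "p \<noteq> []" using p(1) \<open>u \<noteq> u'\<close> by auto
  then have "3 \<le> length ((w, u') # p @ [(u, w)])" by (cases p) auto
  moreover have "cycle ((w, u') # p @ [(u, w)])"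
    unfolding cycle_def
  proof (intro exI conjI)
    show "awalk w ((w, u') # p @ [(u, w)]) w"
      unfolding awalk_def using p(1,2) arcs(4,5) in_arcsD1 pcas_snoc[OF p(1), of w]
      by (auto simp del: pcas.simps simp add: pcas.simps(2)[of w "(w, u')"])
    show "distinct (tl (pawalk_verts w ((w, u') # p @ [(u, w)])))"
      using p arcs(3) by (auto simp: pawalk_verts_snoc)
  qed simp
  ultimately show False
    using T unfolding finite_tree_def by blast
qed

text \<open>The tree stays fixed while a set of its vertices grows, so that families indexed by
  vertices and arcs need no restriction. The last premise of \<open>attach\<close> guarantees that a
  new vertex has to be made compatible with one old vertex only.\<close>

lemma finite_tree_induct [consumes 1, case_names singleton attach]:
  assumes T: "finite_tree T"
    and singleton: "\<And>v. v \<in> pverts T \<Longrightarrow> P {v}"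
    and attach: "\<And>U u w. U \<subseteq> pverts T \<Longrightarrow> P U \<Longrightarrow> u \<in> U \<Longrightarrow> w \<in> pverts T - U \<Longrightarrow>
      (u, w) \<in> parcs T \<Longrightarrow> (\<And>v. v \<in> U \<Longrightarrow> (v, w) \<in> parcs T \<Longrightarrow> v = u) \<Longrightarrow> P (insert w U)"
  shows "P (pverts T)"
proof -
  interpret pair_graph T using T unfolding finite_tree_def by blast
  have sym: "(b, a) \<in> parcs T" if "(a, b) \<in> parcs T" for a b
    using that pair_sym_arcs unfolding symmetric_def by (auto dest: symD)
  let ?Q = "\<lambda>U. U \<subseteq> pverts T \<and> U \<noteq> {} \<and> path_connected_in T U \<and> P U"
  have "\<exists>U. ?Q U \<and> card U = Suc k" if "Suc k \<le> card (pverts T)" for k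
    using that
  proof (induction k)
    case 0
    then have "pverts T \<noteq> {}" by auto
    then obtain v where "v \<in> pverts T" by blast
    moreover have "path_connected_in T {v}"
      unfolding path_connected_in_def by (auto intro: exI[of _ "[]"])
    ultimately show ?case using singleton by (intro exI[of _ "{v}"]) auto
  next
    case (Suc k)
    then have "\<exists>U. ?Q U \<and> card U = Suc k" by simp
    then obtain U where U: "?Q U" "card U = Suc k" by blast
    then have "U \<noteq> pverts T" using Suc.prems by auto
    then obtain u w where uw: "u \<in> U" "w \<in> pverts T - U" "(u, w) \<in> parcs T"
      using finite_tree_leaves_set[OF T, of U] U(1) by blast
    have "P (insert w U)"
    proof (rule attach[OF _ _ uw])
      show "v = u" if "v \<in> U" "(v, w) \<in> parcs T" for v
        using finite_tree_unique_attachment[OF T, of U v u w] U(1) that uw sym by blast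
    qed (use U in auto)
    moreover have "path_connected_in T (insert w U)"
      using path_connected_in_insert[of T U u w] U(1) uw sym by blast
    moreover have "card (insert w U) = Suc (Suc k)"
      using U(2) uw(2) card_insert_disjoint[of U w] finite_subset[OF _ pair_finite_verts, of U] U(1)
      by simp
    moreover have "insert w U \<subseteq> pverts T" using U(1) uw(2) by blast
    ultimately show ?case by (intro exI[of _ "insert w U"]) simp
  qed
  moreover have "card (pverts T) \<noteq> 0"
    using T pair_finite_verts
    by (simp add: finite_tree_def connected_def strongly_connected_def)
  then obtain k where "card (pverts T) = Suc k" using not0_implies_Suc by blast
  ultimately have "\<exists>U. ?Q U \<and> card U = card (pverts T)" by simp
  then obtain U where "?Q U" "card U = card (pverts T)" by blast
  then show ?thesis
    using card_subset_eq[OF pair_finite_verts] by blast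
qed

text \<open>Along an arc \<open>(u, v)\<close> the element \<open>\<alpha> u v k\<close> is identified with \<open>\<alpha> v u (J k)\<close>. Attaching a leaf, its
  action on a fresh copy of the natural numbers is transported along a bijection that is
  equivariant for the edge group and fixes the embedded copy of \<open>X\<close>.\<close>

lemma tree_of_actions:
  fixes K :: "'k monoid"
  assumes T: "finite_tree T" and K: "group K"
    and H: "\<And>v. v \<in> pverts T \<Longrightarrow> group (H v)" "\<And>v. v \<in> pverts T \<Longrightarrow> countable (carrier (H v))"
    and X: "countable X" and D: "\<And>v. v \<in> pverts T \<Longrightarrow> free_partial_action (H v) X (D v)"
    and hom: "\<And>u v. (u, v) \<in> parcs T \<Longrightarrow> \<alpha> u v \<in> hom K (H u)"
    and inj: "\<And>u v. (u, v) \<in> parcs T \<Longrightarrow> inj_on (\<alpha> u v) (carrier K)"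
    and J: "J \<in> hom K K" "\<And>k. k \<in> carrier K \<Longrightarrow> J (J k) = k"
    and trace: "\<And>u v k x y. (u, v) \<in> parcs T \<Longrightarrow> k \<in> carrier K \<Longrightarrow> x \<in> X \<Longrightarrow> y \<in> X \<Longrightarrow>
      D u (\<alpha> u v k) x y \<longleftrightarrow> D v (\<alpha> v u (J k)) x y"
  shows "\<exists>act j. (\<forall>v\<in>pverts T. extends_partial_action (H v) X (D v) (act v) j) \<and>
    (\<forall>(u, v)\<in>parcs T. \<forall>k\<in>carrier K. \<forall>n. act u (\<alpha> u v k) n = act v (\<alpha> v u (J k)) n)"
proof -
  interpret pair_graph T using T unfolding finite_tree_def by blast
  have sym: "(b, a) \<in> parcs T" if "(a, b) \<in> parcs T" for a b
    using that pair_sym_arcs unfolding symmetric_def by (auto dest: symD)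
  have JK: "J k \<in> carrier K" if "k \<in> carrier K" for k
    by (rule hom_in_carrier[OF J(1) that])
  have J_inj: "inj_on J (carrier K)"
    by (rule inj_on_inverseI[of _ J]) (rule J(2))
  let ?P = "\<lambda>U. \<exists>act j. (\<forall>v\<in>U. extends_partial_action (H v) X (D v) (act v) j) \<and>
    (\<forall>(u, v)\<in>parcs T. u \<in> U \<longrightarrow> v \<in> U \<longrightarrow>
      (\<forall>k\<in>carrier K. \<forall>n. act u (\<alpha> u v k) n = act v (\<alpha> v u (J k)) n))"
  have "?P (pverts T)"
    using T
  proof (induction rule: finite_tree_induct)
    case (singleton v)
    obtain act j where "extends_partial_action (H v) X (D v) act j"
      using ex_extends_partial_action[OF H[OF singleton] X D[OF singleton]] .
    moreover have "(v, v) \<notin> parcs T" using pair_no_loops[of "(v, v)"] by auto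
    ultimately show ?case by (intro exI[of _ "\<lambda>_. act"] exI[of _ j]) auto
  next
    case (attach U u w)
    obtain act j where IH: "(\<forall>v\<in>U. extends_partial_action (H v) X (D v) (act v) j) \<and>
      (\<forall>(u, v)\<in>parcs T. u \<in> U \<longrightarrow> v \<in> U \<longrightarrow>
        (\<forall>k\<in>carrier K. \<forall>n. act u (\<alpha> u v k) n = act v (\<alpha> v u (J k)) n))"
      using attach.IH by (elim exE)
    have act: "extends_partial_action (H v) X (D v) (act v) j" if "v \<in> U" for v
      using bspec[OF IH[THEN conjunct1] that] .
    have compat: "act a (\<alpha> a b k) n = act b (\<alpha> b a (J k)) n"
      if "(a, b) \<in> parcs T" "a \<in> U" "b \<in> U" "k \<in> carrier K" for a b k n
      using bspec[OF IH[THEN conjunct2] that(1), unfolded prod.case, rule_format, OF that(2-4)] .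
    have w: "w \<in> pverts T" "w \<notin> U" and u: "u \<in> pverts T" and wu: "(w, u) \<in> parcs T"
      using attach.hyps(1-3) sym[OF attach.hyps(4)] by auto
    note uw = \<open>(u, w) \<in> parcs T\<close>
    obtain act' j' where act': "extends_partial_action (H w) X (D w) act' j'"
      using ex_extends_partial_action[OF H[OF w(1)] X D[OF w(1)]] .
    note au = act[OF attach.hyps(2), unfolded extends_partial_action_def]
    note aw = act'[unfolded extends_partial_action_def]
    have hJ: "(\<lambda>k. \<alpha> w u (J k)) \<in> hom K (H w)"
      using hom_compose[OF J(1) hom[OF wu]] by (simp add: comp_def)
    have iJ: "inj_on (\<lambda>k. \<alpha> w u (J k)) (carrier K)"
    proof (rule inj_onI)
      fix k l assume "k \<in> carrier K" "l \<in> carrier K" "\<alpha> w u (J k) = \<alpha> w u (J l)"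
      then have "J k = J l" using inj_onD[OF inj[OF wu]] JK by blast
      then show "k = l" using inj_onD[OF J_inj] \<open>k \<in> carrier K\<close> \<open>l \<in> carrier K\<close> by blast
    qed
    have "\<exists>f. bij f \<and> (\<forall>k\<in>carrier K. \<forall>n. f (act' (\<alpha> w u (J k)) n) = act u (\<alpha> u w k) (f n)) \<and>
      (\<forall>x\<in>X. f (j' x) = j x)"
    proof (rule equivariant_extension[OF K])
      show "free_action K (\<lambda>k. act' (\<alpha> w u (J k)))"
        using free_action_hom[OF H(1)[OF w(1)] K aw[THEN conjunct1] hJ iJ] .
      show "free_action K (\<lambda>k. act u (\<alpha> u w k))"
        using free_action_hom[OF H(1)[OF u] K au[THEN conjunct1] hom[OF uw] inj[OF uw]] .
      show "roomy K (\<lambda>k. act' (\<alpha> w u (J k))) (j' ` X)"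
        using roomy_hom[OF aw[THEN conjunct2, THEN conjunct1] hJ] .
      show "roomy K (\<lambda>k. act u (\<alpha> u w k)) (j ` X)"
        using roomy_hom[OF au[THEN conjunct2, THEN conjunct1] hom[OF uw]] .
      fix k x y assume kxy: "k \<in> carrier K" "x \<in> X" "y \<in> X"
      have "act' (\<alpha> w u (J k)) (j' x) = j' y \<longleftrightarrow> D w (\<alpha> w u (J k)) x y"
        by (rule aw[THEN conjunct2, THEN conjunct2, rule_format, OF hom_in_carrier[OF hJ kxy(1)] kxy(2,3)])
      also have "\<dots> \<longleftrightarrow> D u (\<alpha> u w k) x y"
        by (rule trace[OF uw kxy, symmetric])
      also have "\<dots> \<longleftrightarrow> act u (\<alpha> u w k) (j x) = j y"
        by (rule au[THEN conjunct2, THEN conjunct2, rule_format,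
              OF hom_in_carrier[OF hom[OF uw] kxy(1)] kxy(2,3), symmetric])
      finally show "act' (\<alpha> w u (J k)) (j' x) = j' y \<longleftrightarrow> act u (\<alpha> u w k) (j x) = j y" .
    qed
    then obtain f where F: "bij f \<and> (\<forall>k\<in>carrier K. \<forall>n. f (act' (\<alpha> w u (J k)) n) = act u (\<alpha> u w k) (f n)) \<and>
      (\<forall>x\<in>X. f (j' x) = j x)"
      ..
    note f = F[THEN conjunct1] F[THEN conjunct2, THEN conjunct1, rule_format]
      F[THEN conjunct2, THEN conjunct2, rule_format]
    define act'' where "act'' = act(w := \<lambda>h n. f (act' h (inv_into UNIV f n)))"
    have ff: "f (inv_into UNIV f n) = n" for n
      using f(1) by (simp add: bij_is_surj surj_f_inv_f)
    have new: "act'' u (\<alpha> u w k) n = act'' w (\<alpha> w u (J k)) n" if "k \<in> carrier K" for k n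
      using f(2)[OF that, of "inv_into UNIV f n"] w(2) \<open>u \<in> U\<close> by (auto simp: act''_def ff)
    have new_act: "extends_partial_action (H v) X (D v) (act'' v) j" if "v \<in> insert w U" for v
    proof (cases "v = w")
      case True
      have "extends_partial_action (H w) X (D w) (act'' w) (f \<circ> j')"
        using extends_partial_action_conjugate[OF act' f(1)] by (simp add: act''_def)
      moreover have "(f \<circ> j') x = j x" if "x \<in> X" for x
        using f(3)[OF that] by simp
      ultimately show ?thesis
        using True extends_partial_action_cong[of X "f \<circ> j'" j] by blast
    next
      case False
      then show ?thesis using act that by (simp add: act''_def)
    qed
    have new_compat: "act'' a (\<alpha> a b k) n = act'' b (\<alpha> b a (J k)) n"
      if ab: "(a, b) \<in> parcs T" "a \<in> insert w U" "b \<in> insert w U" and k: "k \<in> carrier K" for a b k n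
    proof -
      have "a \<noteq> b" using pair_no_loops[OF ab(1)] by simp
      then have aw: "b \<in> U" "b = u" if "a = w"
        using that ab(3) attach.hyps(5)[of b] sym[OF ab(1)] by simp_all
      have bw: "a \<in> U" "a = u" if "b = w"
        using that ab(1,2) attach.hyps(5)[of a] \<open>a \<noteq> b\<close> by simp_all
      consider "a = w" | "b = w" | "a \<in> U" "b \<in> U" "a \<noteq> w" "b \<noteq> w"
        using ab(2,3) by blast
      then show ?thesis
      proof cases
        \<comment> \<open>The arc runs from the new vertex back to the old one; the required
          identity is \<open>new\<close> at J k, because \<open>J\<close> is an involution.\<close>
        case 1
        then show ?thesis using new[OF JK[OF k], of n] J(2)[OF k] aw(2) by simp
      next
        case 2
        then show ?thesis using new[OF k] bw(2) by simp
      next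
        case 3
        then show ?thesis using compat[OF ab(1) 3(1,2) k, of n] unfolding act''_def by simp
      qed
    qed
    show ?case
    proof (intro exI[of _ act''] exI[of _ j] conjI ballI)
      show "extends_partial_action (H v) X (D v) (act'' v) j" if "v \<in> insert w U" for v
        using that by (rule new_act)
      show "case e of (a, b) \<Rightarrow> a \<in> insert w U \<longrightarrow> b \<in> insert w U \<longrightarrow>
          (\<forall>k\<in>carrier K. \<forall>n. act'' a (\<alpha> a b k) n = act'' b (\<alpha> b a (J k)) n)"
        if "e \<in> parcs T" for e
      proof (cases e)
        case (Pair a b)
        show ?thesis
          unfolding Pair prod.case by (intro impI ballI allI new_compat) (use that Pair in simp)
      qed
    qed
  qed
  then obtain act j where *: "(\<forall>v\<in>pverts T. extends_partial_action (H v) X (D v) (act v) j) \<and>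
    (\<forall>(u, v)\<in>parcs T. u \<in> pverts T \<longrightarrow> v \<in> pverts T \<longrightarrow>
      (\<forall>k\<in>carrier K. \<forall>n. act u (\<alpha> u v k) n = act v (\<alpha> v u (J k)) n))"
    by (elim exE)
  have compat: "act u (\<alpha> u v k) n = act v (\<alpha> v u (J k)) n"
    if "(u, v) \<in> parcs T" "k \<in> carrier K" for u v k n
    using bspec[OF *[THEN conjunct2] that(1), unfolded prod.case, rule_format,
        OF in_arcsD1[OF that(1)] in_arcsD2[OF that(1)] that(2)] .
  show ?thesis
  proof (intro exI[of _ act] exI[of _ j] conjI ballI)
    show "extends_partial_action (H v) X (D v) (act v) j" if "v \<in> pverts T" for v
      by (rule bspec[OF *[THEN conjunct1] that])
    show "case e of (u, v) \<Rightarrow> \<forall>k\<in>carrier K. \<forall>n. act u (\<alpha> u v k) n = act v (\<alpha> v u (J k)) n"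
      if "e \<in> parcs T" for e
    proof (cases e)
      case (Pair u v)
      show ?thesis
        unfolding Pair prod.case by (intro ballI allI compat) (use that Pair in simp)
    qed
  qed
qed

section \<open>Homomorphisms from presented groups\<close>

lemma words_Nil [simp]: "[] \<in> words X"
  by (simp add: words_def)

lemma words_Cons [simp]: "(b, x) # w \<in> words X \<longleftrightarrow> x \<in> X \<and> w \<in> words X"
  by (auto simp: words_def)

lemma words_append [simp]: "u @ v \<in> words X \<longleftrightarrow> u \<in> words X \<and> v \<in> words X"
  by (auto simp: words_def)

lemma countable_words: "countable X \<Longrightarrow> countable (words X)"
  unfolding words_def by (intro countable_lists countable_SIGMA) auto

lemma countable_presented_group: "countable X \<Longrightarrow> countable (carrier (presented_group X R))"
  by (simp add: presented_group_def countable_words)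

lemma word_class_closed [simp]: "w \<in> words X \<Longrightarrow> word_class X R w \<in> carrier (presented_group X R)"
  by (simp add: presented_group_def)

lemma carrier_presented_groupE:
  assumes "p \<in> carrier (presented_group X R)"
  obtains w where "w \<in> words X" "p = word_class X R w"
  using assms by (auto simp: presented_group_def)

lemma word_class_Nil: "word_class X R [] = \<one>\<^bsub>presented_group X R\<^esub>"
  by (simp add: presented_group_def)

lemma word_class_rel:
  "(u, v) \<in> R \<Longrightarrow> u \<in> words X \<Longrightarrow> v \<in> words X \<Longrightarrow> word_class X R u = word_class X R v"
  by (intro word_class_eqI pres_eq.rel)

lemma word_class_append:
  "u \<in> words X \<Longrightarrow> v \<in> words X \<Longrightarrow>
    word_class X R (u @ v) = word_class X R u \<otimes>\<^bsub>presented_group X R\<^esub> word_class X R v"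
  by (simp add: mult_word_class)

lemma word_class_inverse_letter:
  assumes "x \<in> X"
  shows "word_class X R [(False, x)] = inv\<^bsub>presented_group X R\<^esub> (word_class X R (letter x))"
proof -
  interpret group "presented_group X R" by (rule group_presented_group)
  have "word_class X R [(False, x), (True, x)] = word_class X R []"
    using assms by (intro word_class_eqI pres_eq.cancel[of x X R False, simplified])
  then have "word_class X R [(False, x)] \<otimes>\<^bsub>presented_group X R\<^esub> word_class X R (letter x) =
      \<one>\<^bsub>presented_group X R\<^esub>"
    using assms by (simp add: mult_word_class word_class_Nil)
  then show ?thesis using assms by (intro inv_equality[symmetric]) auto
qed

lemma word_eval_simps [simp]:
  "word_eval H f [] = \<one>\<^bsub>H\<^esub>"
  "word_eval H f ((b, x) # w) = (if b then f x else inv\<^bsub>H\<^esub> (f x)) \<otimes>\<^bsub>H\<^esub> word_eval H f w"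
  by (simp_all add: word_eval_def)

lemma word_eval_closed:
  assumes "group H" "f ` X \<subseteq> carrier H" "w \<in> words X"
  shows "word_eval H f w \<in> carrier H"
proof -
  interpret group H by fact
  show ?thesis using assms(3)
    by (induction w) (use assms(2) in \<open>auto simp: image_subset_iff\<close>)
qed

lemma word_eval_append:
  assumes "group H" "f ` X \<subseteq> carrier H" "u \<in> words X" "v \<in> words X"
  shows "word_eval H f (u @ v) = word_eval H f u \<otimes>\<^bsub>H\<^esub> word_eval H f v"
proof -
  interpret group H by fact
  note closed = word_eval_closed[OF assms(1,2)]
  show ?thesis using assms(3)
  proof (induction u)
    case Nil
    then show ?case using closed[OF assms(4)] by simp
  next
    case (Cons l u)
    obtain b x where "l = (b, x)" by force
    moreover from this have "f x \<in> carrier H" using Cons.prems assms(2) by auto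
    ultimately show ?case
      using Cons closed[of u] closed[OF assms(4)] by (simp add: m_assoc)
  qed
qed

lemma word_eval_map:
  "word_eval H f (map (\<lambda>(b, x). (b, g x)) w) = word_eval H (\<lambda>x. f (g x)) w"
  by (induction w) auto

lemma hom_word_eval:
  assumes "group H" "group K" "h \<in> hom H K" "f ` X \<subseteq> carrier H" "w \<in> words X"
  shows "h (word_eval H f w) = word_eval K (\<lambda>x. h (f x)) w"
proof -
  interpret group_hom H K h using assms by (simp add: group_hom_def group_hom_axioms_def)
  show ?thesis using assms(5)
  proof (induction w)
    case (Cons l w)
    obtain b x where l: "l = (b, x)" by force
    then have "f x \<in> carrier H" "word_eval H f w \<in> carrier H"
      using Cons.prems assms(4) word_eval_closed[OF assms(1,4)] by auto
    then show ?case using Cons l by simp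
  qed simp
qed

lemma word_eval_cong:
  "w \<in> words X \<Longrightarrow> (\<And>x. x \<in> X \<Longrightarrow> f x = g x) \<Longrightarrow> word_eval H f w = word_eval H g w"
  by (induction w) auto

lemma word_class_eq_word_eval:
  assumes "w \<in> words X"
  shows "word_class X R w = word_eval (presented_group X R) (\<lambda>x. word_class X R (letter x)) w"
  using assms
proof (induction w)
  case Nil
  then show ?case by (simp add: word_class_Nil)
next
  case (Cons l w)
  obtain b x where l: "l = (b, x)" by force
  have "word_class X R ([l] @ w) = word_class X R [l] \<otimes>\<^bsub>presented_group X R\<^esub> word_class X R w"
    using Cons.prems by (intro word_class_append) (simp_all add: l)
  then show ?case
    using Cons by (cases b) (simp_all add: l word_class_inverse_letter)
qed

text \<open>Von Dyck's theorem. The map evaluates a chosen representative of each class; induction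
  over \<open>pres_eq\<close> shows that all representatives have the same value.\<close>

lemma presented_group_hom_ex:
  assumes "group H" "f ` X \<subseteq> carrier H"
    and rels: "\<And>u v. (u, v) \<in> R \<Longrightarrow> u \<in> words X \<Longrightarrow> v \<in> words X \<Longrightarrow> word_eval H f u = word_eval H f v"
  shows "\<exists>h \<in> hom (presented_group X R) H. \<forall>w\<in>words X. h (word_class X R w) = word_eval H f w"
proof -
  interpret group H by fact
  have eq: "word_eval H f u = word_eval H f v" if "pres_eq X R u v" for u v
    using that
  proof (induction rule: pres_eq.induct)
    case (append u u' v v')
    then show ?case
      using pres_eq_words by (metis word_eval_append[OF assms(1,2)])
  next
    case (cancel x b)
    then have "f x \<in> carrier H" using assms(2) by blast
    then show ?case by simp
  qed (use rels in auto)
  define h where "h p = word_eval H f (SOME w. w \<in> p)" for p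
  have h: "h (word_class X R w) = word_eval H f w" if "w \<in> words X" for w
  proof -
    have "w \<in> word_class X R w" using that by (simp add: word_class_def pres_eq.refl)
    then have "(SOME u. u \<in> word_class X R w) \<in> word_class X R w" by (rule someI)
    then show ?thesis unfolding h_def word_class_def by (auto dest: eq)
  qed
  have "h \<in> hom (presented_group X R) H"
  proof (rule homI)
    fix p assume "p \<in> carrier (presented_group X R)"
    then show "h p \<in> carrier H"
      using h word_eval_closed[OF assms(1,2)] by (elim carrier_presented_groupE) simp
  next
    fix p q assume "p \<in> carrier (presented_group X R)" "q \<in> carrier (presented_group X R)"
    then obtain u v where "u \<in> words X" "p = word_class X R u" "v \<in> words X" "q = word_class X R v"
      by (elim carrier_presented_groupE)
    then show "h (p \<otimes>\<^bsub>presented_group X R\<^esub> q) = h p \<otimes>\<^bsub>H\<^esub> h q"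
      using h word_eval_append[OF assms(1,2)] by (simp add: mult_word_class)
  qed
  then show ?thesis using h by blast
qed

lemma presented_group_hom_eval:
  assumes "group H" "h \<in> hom (presented_group X R) H" "w \<in> words X"
  shows "h (word_class X R w) = word_eval H (\<lambda>x. h (word_class X R (letter x))) w"
  unfolding word_class_eq_word_eval[OF assms(3)]
  using assms by (intro hom_word_eval[OF group_presented_group, where X = X]) auto

lemma presented_group_hom_eq:
  fixes H :: "'h monoid"
  assumes "group H" "h \<in> hom (presented_group X R) H" "k \<in> hom (presented_group X R) H"
    and gens: "\<And>x. x \<in> X \<Longrightarrow> h (word_class X R (letter x)) = k (word_class X R (letter x))"
    and p: "p \<in> carrier (presented_group X R)"
  shows "h p = k p"
proof -
  obtain w where w: "w \<in> words X" "p = word_class X R w"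
    using p by (rule carrier_presented_groupE)
  show ?thesis
    unfolding w(2) presented_group_hom_eval[OF assms(1,2) w(1)]
      presented_group_hom_eval[OF assms(1,3) w(1)]
    using w(1) gens by (rule word_eval_cong)
qed

text \<open>\<open>the_elem\<close> is meaningful only if all words of a class have equal values; a
  homomorphism with the same values on generators guarantees this. In this way the edge maps in the
  defining relations become explicit homomorphisms.\<close>

lemma induced_map_eq_hom:
  assumes "group H" "h \<in> hom (presented_group X R) H"
    and gens: "\<And>x. x \<in> X \<Longrightarrow> f x = h (word_class X R (letter x))"
    and p: "p \<in> carrier (presented_group X R)"
  shows "induced_map H f p = h p"
proof -
  obtain w where w: "w \<in> words X" "p = word_class X R w"
    using p by (rule carrier_presented_groupE)
  have "word_eval H f u = h p" if "u \<in> p" for u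
  proof -
    have u: "pres_eq X R w u" using that w(2) by (simp add: word_class_def)
    then have "p = word_class X R u" "u \<in> words X"
      using w(2) word_class_eqI pres_eq_words(2) by blast+
    then show ?thesis
      using presented_group_hom_eval[OF assms(1,2), of u] word_eval_cong[of u X f _ H, OF _ gens]
      by simp
  qed
  then have "word_eval H f ` p = (\<lambda>_. h p) ` p" by (rule image_cong[OF HOL.refl])
  moreover have "w \<in> p" using w by (simp add: word_class_def pres_eq.refl)
  ultimately have "word_eval H f ` p = {h p}" by auto
  then show ?thesis by (simp add: induced_map_def)
qed

lemma presented_group_induct [consumes 1, case_names one letter mult inv]:
  assumes "p \<in> carrier (presented_group X R)"
    and one: "P \<one>\<^bsub>presented_group X R\<^esub>"
    and letter: "\<And>x. x \<in> X \<Longrightarrow> P (word_class X R (letter x))"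
    and mult: "\<And>p q. p \<in> carrier (presented_group X R) \<Longrightarrow> q \<in> carrier (presented_group X R) \<Longrightarrow>
      P p \<Longrightarrow> P q \<Longrightarrow> P (p \<otimes>\<^bsub>presented_group X R\<^esub> q)"
    and inv: "\<And>p. p \<in> carrier (presented_group X R) \<Longrightarrow> P p \<Longrightarrow> P (inv\<^bsub>presented_group X R\<^esub> p)"
  shows "P p"
proof -
  obtain w where w: "w \<in> words X" "p = word_class X R w"
    using assms(1) by (rule carrier_presented_groupE)
  have "P (word_class X R w)" using w(1)
  proof (induction w)
    case Nil
    then show ?case using one by (simp add: word_class_Nil)
  next
    case (Cons l w)
    obtain b x where l: "l = (b, x)" by force
    have x: "x \<in> X" "w \<in> words X" using Cons.prems by (auto simp: l)
    have "P (word_class X R [l])"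
      using inv[OF _ letter[OF x(1)]] letter[OF x(1)] x(1)
      by (cases b) (simp_all add: l word_class_inverse_letter)
    then have "P (word_class X R [l] \<otimes>\<^bsub>presented_group X R\<^esub> word_class X R w)"
      using x Cons.IH by (intro mult) (simp_all add: l)
    then show ?case using x word_class_append[of "[l]" X w R] by (simp add: l)
  qed
  then show ?thesis using w(2) by simp
qed

text \<open>The elements that satisfy the equation are closed under products and inverses. This
  spreads relations imposed on generators, for t as well as for the stable letters, over a whole
  subgroup.\<close>

lemma intertwine_generators:
  fixes Q :: "'q monoid"
  assumes "group Q" and h: "h \<in> hom (presented_group X R) Q" "h' \<in> hom (presented_group X R) Q"
    and r: "r \<in> carrier Q" and p: "p \<in> carrier (presented_group X R)"
    and gens: "\<And>x. x \<in> X \<Longrightarrow>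
      r \<otimes>\<^bsub>Q\<^esub> h (word_class X R (letter x)) = h' (word_class X R (letter x)) \<otimes>\<^bsub>Q\<^esub> r"
  shows "r \<otimes>\<^bsub>Q\<^esub> h p = h' p \<otimes>\<^bsub>Q\<^esub> r"
proof -
  interpret P: group "presented_group X R" by (rule group_presented_group)
  interpret Q: group Q by fact
  interpret h: group_hom "presented_group X R" Q h
    using h by (simp add: group_hom_def group_hom_axioms_def P.is_group Q.is_group)
  interpret h': group_hom "presented_group X R" Q h'
    using h by (simp add: group_hom_def group_hom_axioms_def P.is_group Q.is_group)
  show ?thesis
    using p
  proof (induction p rule: presented_group_induct)
    case one
    show ?case using r by simp
  next
    case (letter x)
    then show ?case by (rule gens)
  next
    case (mult p q)
    have "r \<otimes>\<^bsub>Q\<^esub> h (p \<otimes>\<^bsub>presented_group X R\<^esub> q) = (r \<otimes>\<^bsub>Q\<^esub> h p) \<otimes>\<^bsub>Q\<^esub> h q"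
      using mult(1,2) r by (simp add: Q.m_assoc)
    also have "\<dots> = h' p \<otimes>\<^bsub>Q\<^esub> (r \<otimes>\<^bsub>Q\<^esub> h q)"
      unfolding mult(3) using mult(1,2) r by (simp add: Q.m_assoc)
    also have "\<dots> = h' (p \<otimes>\<^bsub>presented_group X R\<^esub> q) \<otimes>\<^bsub>Q\<^esub> r"
      unfolding mult(4) using mult(1,2) r by (simp add: Q.m_assoc)
    finally show ?case .
  next
    case (inv p)
    \<comment> \<open>Both sides of the equation for \<open>p\<close> are multiplied by h'(p)^-1 on
      the left and by h(p)^-1 on the right.\<close>
    have "inv\<^bsub>Q\<^esub> (h' p) \<otimes>\<^bsub>Q\<^esub> (r \<otimes>\<^bsub>Q\<^esub> h p) \<otimes>\<^bsub>Q\<^esub> inv\<^bsub>Q\<^esub> (h p) = inv\<^bsub>Q\<^esub> (h' p) \<otimes>\<^bsub>Q\<^esub> r"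
      using inv(1) r by (simp add: Q.m_assoc)
    moreover have "inv\<^bsub>Q\<^esub> (h' p) \<otimes>\<^bsub>Q\<^esub> (h' p \<otimes>\<^bsub>Q\<^esub> r) \<otimes>\<^bsub>Q\<^esub> inv\<^bsub>Q\<^esub> (h p) = r \<otimes>\<^bsub>Q\<^esub> inv\<^bsub>Q\<^esub> (h p)"
      using inv(1) r by (simp add: Q.m_assoc[symmetric])
    ultimately show ?case using inv by simp
  qed
qed

text \<open>The left-hand side, with its trailing unit, is what \<open>word_eval\<close> produces
  for the word r a r^-1.\<close>

lemma conj_eq_iff_intertwine:
  assumes "group Q" "r \<in> carrier Q" "a \<in> carrier Q" "b \<in> carrier Q"
  shows "r \<otimes>\<^bsub>Q\<^esub> (a \<otimes>\<^bsub>Q\<^esub> (inv\<^bsub>Q\<^esub> r \<otimes>\<^bsub>Q\<^esub> \<one>\<^bsub>Q\<^esub>)) = b \<longleftrightarrow> r \<otimes>\<^bsub>Q\<^esub> a = b \<otimes>\<^bsub>Q\<^esub> r"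
proof -
  interpret Q: group Q by fact
  have "r \<otimes>\<^bsub>Q\<^esub> (a \<otimes>\<^bsub>Q\<^esub> (inv\<^bsub>Q\<^esub> r \<otimes>\<^bsub>Q\<^esub> \<one>\<^bsub>Q\<^esub>)) = (r \<otimes>\<^bsub>Q\<^esub> a) \<otimes>\<^bsub>Q\<^esub> inv\<^bsub>Q\<^esub> r"
    using assms by (simp add: Q.m_assoc)
  then show ?thesis
    using assms Q.inv_solve_right'[of b "r \<otimes>\<^bsub>Q\<^esub> a" r] by auto
qed

section \<open>Relative presentations and their universal property\<close>

lemma group_relative_presentation: "group (relative_presentation H S R)"
  unfolding relative_presentation_def by (rule group_presented_group)

lemma relative_class_closed [simp]:
  "w \<in> words (carrier H <+> S) \<Longrightarrow> relative_class H S R w \<in> carrier (relative_presentation H S R)"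
  unfolding relative_presentation_def relative_class_def by simp

lemma relative_class_Inl_hom:
  assumes "group H"
  shows "(\<lambda>h. relative_class H S R (letter (Inl h))) \<in> hom H (relative_presentation H S R)"
proof -
  interpret group H by fact
  show ?thesis
  proof (rule homI)
    fix g h assume gh: "g \<in> carrier H" "h \<in> carrier H"
    have "word_class (carrier H <+> S) (relative_rels H R) ([(True, Inl g)] @ [(True, Inl h)]) =
        word_class (carrier H <+> S) (relative_rels H R) (letter (Inl (g \<otimes>\<^bsub>H\<^esub> h)))"
      using gh by (intro word_class_rel) (auto simp: relative_rels_def)
    then show "relative_class H S R (letter (Inl (g \<otimes>\<^bsub>H\<^esub> h))) =
        relative_class H S R (letter (Inl g)) \<otimes>\<^bsub>relative_presentation H S R\<^esub>
        relative_class H S R (letter (Inl h))"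
      using gh unfolding relative_class_def relative_presentation_def
      by (subst mult_word_class) (auto simp: InlI)
  qed (simp add: InlI)
qed

lemma relative_class_rel:
  "(u, v) \<in> R \<Longrightarrow> u \<in> words (carrier H <+> S) \<Longrightarrow> v \<in> words (carrier H <+> S) \<Longrightarrow>
    relative_class H S R u = relative_class H S R v"
  unfolding relative_class_def by (intro word_class_rel) (auto simp: relative_rels_def)

lemma relative_class_eq_word_eval:
  "w \<in> words (carrier H <+> S) \<Longrightarrow> relative_class H S R w =
    word_eval (relative_presentation H S R) (\<lambda>x. relative_class H S R (letter x)) w"
  unfolding relative_class_def relative_presentation_def by (rule word_class_eq_word_eval)

text \<open>The multiplication table of \<open>H\<close> is respected because \<open>h\<close> is a
  homomorphism, so only the relations in \<open>R\<close> remain to be verified.\<close>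

lemma relative_presentation_hom_ex:
  assumes "group H" "group Q" "h \<in> hom H Q" "f ` S \<subseteq> carrier Q"
    and rels: "\<And>u v. (u, v) \<in> R \<Longrightarrow> u \<in> words (carrier H <+> S) \<Longrightarrow> v \<in> words (carrier H <+> S) \<Longrightarrow>
      word_eval Q (case_sum h f) u = word_eval Q (case_sum h f) v"
  shows "\<exists>\<Psi> \<in> hom (relative_presentation H S R) Q.
    (\<forall>g\<in>carrier H. \<Psi> (relative_class H S R (letter (Inl g))) = h g) \<and>
    (\<forall>i\<in>S. \<Psi> (relative_class H S R (letter (Inr i))) = f i)"
proof -
  interpret group Q by fact
  have closed: "case_sum h f ` (carrier H <+> S) \<subseteq> carrier Q"
    using assms(4) hom_in_carrier[OF assms(3)] by auto
  have "\<exists>\<Psi> \<in> hom (presented_group (carrier H <+> S) (relative_rels H R)) Q.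
    \<forall>w\<in>words (carrier H <+> S).
      \<Psi> (word_class (carrier H <+> S) (relative_rels H R) w) = word_eval Q (case_sum h f) w"
  proof (rule presented_group_hom_ex[OF assms(2) closed])
    fix u v assume uv: "(u, v) \<in> relative_rels H R" "u \<in> words (carrier H <+> S)"
      "v \<in> words (carrier H <+> S)"
    then consider g g' where "g \<in> carrier H" "g' \<in> carrier H"
        "u = [(True, Inl g), (True, Inl g')]" "v = letter (Inl (g \<otimes>\<^bsub>H\<^esub> g'))"
      | "(u, v) \<in> R"
      unfolding relative_rels_def by blast
    then show "word_eval Q (case_sum h f) u = word_eval Q (case_sum h f) v"
    proof cases
      case 1
      then show ?thesis
        using hom_in_carrier[OF assms(3)] hom_mult[OF assms(3)] by simp
    next
      case 2
      then show ?thesis using rels uv(2,3) by blast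
    qed
  qed
  then obtain \<Psi> where \<Psi>: "\<Psi> \<in> hom (presented_group (carrier H <+> S) (relative_rels H R)) Q"
    "\<forall>w\<in>words (carrier H <+> S).
      \<Psi> (word_class (carrier H <+> S) (relative_rels H R) w) = word_eval Q (case_sum h f) w"
    by blast
  have "\<Psi> (relative_class H S R (letter (Inl g))) = h g" if "g \<in> carrier H" for g
    using \<Psi>(2) hom_in_carrier[OF assms(3)] that by (simp add: relative_class_def InlI)
  moreover have "\<Psi> (relative_class H S R (letter (Inr i))) = f i" if "i \<in> S" for i
    using \<Psi>(2) assms(4) that by (auto simp: relative_class_def InrI)
  ultimately show ?thesis using \<Psi>(1) unfolding relative_presentation_def by blast
qed

lemma relative_presentation_induct [consumes 1, case_names one Inl Inr mult inv]:
  assumes "p \<in> carrier (relative_presentation H S R)"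
    and "P \<one>\<^bsub>relative_presentation H S R\<^esub>"
    and "\<And>h. h \<in> carrier H \<Longrightarrow> P (relative_class H S R (letter (Inl h)))"
    and "\<And>i. i \<in> S \<Longrightarrow> P (relative_class H S R (letter (Inr i)))"
    and "\<And>p q. p \<in> carrier (relative_presentation H S R) \<Longrightarrow>
      q \<in> carrier (relative_presentation H S R) \<Longrightarrow> P p \<Longrightarrow> P q \<Longrightarrow>
      P (p \<otimes>\<^bsub>relative_presentation H S R\<^esub> q)"
    and "\<And>p. p \<in> carrier (relative_presentation H S R) \<Longrightarrow> P p \<Longrightarrow>
      P (inv\<^bsub>relative_presentation H S R\<^esub> p)"
  shows "P p"
  using assms(1)[unfolded relative_presentation_def]
proof (induction p rule: presented_group_induct)
  case (letter x)
  then show ?case using assms(3,4) unfolding relative_class_def by (elim PlusE) simp_all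
qed (use assms(2,5,6) in \<open>simp_all add: relative_presentation_def\<close>)

section \<open>Free actions as homomorphisms into the permutations of the natural numbers\<close>

abbreviation nat_perms :: "(nat \<Rightarrow> nat) monoid" where
  "nat_perms \<equiv> BijGroup UNIV"

lemma nat_perms_carrier: "f \<in> carrier nat_perms \<longleftrightarrow> bij f"
  by (auto simp: BijGroup_def Bij_def extensional_def)

lemma nat_perms_mult:
  "bij f \<Longrightarrow> bij g \<Longrightarrow> f \<otimes>\<^bsub>nat_perms\<^esub> g = (\<lambda>n. f (g n))"
  by (auto simp: BijGroup_def Bij_def extensional_def compose_def)

lemma nat_perms_one: "\<one>\<^bsub>nat_perms\<^esub> = (\<lambda>n. n)"
  by (auto simp: BijGroup_def)

lemma nat_perms_inv_apply:
  assumes "bij f" shows "(inv\<^bsub>nat_perms\<^esub> f) (f n) = n"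
proof -
  interpret group nat_perms by (rule group_BijGroup)
  have f: "f \<in> carrier nat_perms" using assms by (simp add: nat_perms_carrier)
  then have "bij (inv\<^bsub>nat_perms\<^esub> f)" using inv_closed[OF f] by (simp add: nat_perms_carrier)
  then show ?thesis
    using nat_perms_mult[of "inv\<^bsub>nat_perms\<^esub> f" f] l_inv[OF f] assms
    by (metis nat_perms_one)
qed

lemma free_action_bij:
  assumes "group H" "free_action H act" "h \<in> carrier H"
  shows "bij (act h)"
proof (rule bijI)
  show "inj (act h)" by (rule injI) (metis free_action_inv(1)[OF assms])
  show "surj (act h)" using free_action_inv(2)[OF assms] by (rule surjI)
qed

lemma free_action_hom_nat_perms:
  assumes "group H" "free_action H act"
  shows "act \<in> hom H nat_perms"
proof (rule homI)
  fix g h assume gh: "g \<in> carrier H" "h \<in> carrier H"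
  show "act (g \<otimes>\<^bsub>H\<^esub> h) = act g \<otimes>\<^bsub>nat_perms\<^esub> act h"
    using free_action_mult[OF assms(2) gh] nat_perms_mult free_action_bij[OF assms] gh by auto
qed (simp add: nat_perms_carrier free_action_bij[OF assms])

lemma nat_perms_intertwine:
  assumes "f \<in> carrier nat_perms" "a \<in> carrier nat_perms" "b \<in> carrier nat_perms"
    and "\<And>m. f (a m) = b (f m)"
  shows "f \<otimes>\<^bsub>nat_perms\<^esub> a = b \<otimes>\<^bsub>nat_perms\<^esub> f"
  using assms(4) unfolding nat_perms_mult[OF assms(1,2)[unfolded nat_perms_carrier]]
    nat_perms_mult[OF assms(3,1)[unfolded nat_perms_carrier]] by (rule HOL.ext)

section \<open>Side subgroups and polygon groups\<close>

lemma triple_iff: "i \<in> triple k \<longleftrightarrow> i div 3 = k"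
  by (auto simp: triple_def)

lemma csucc_div: "csucc i div 3 = i div 3"
  by (simp add: csucc_def)

lemma csucc_neq: "csucc i \<noteq> i"
  unfolding csucc_def by presburger

lemma group_vertex_group: "group (vertex_group X R k)"
  unfolding vertex_group_def by (simp add: group_presented_group)

lemma vertex_group_closed:
  "h \<in> carrier (vertex_group X R k) \<longleftrightarrow>
    h \<in> extensional (triple k) \<and> (\<forall>j\<in>triple k. h j \<in> carrier (presented_group X R))"
  by (auto simp: vertex_group_def PiE_iff)

lemma vertex_group_mult:
  "g \<otimes>\<^bsub>vertex_group X R k\<^esub> h = (\<lambda>j\<in>triple k. g j \<otimes>\<^bsub>presented_group X R\<^esub> h j)"
  by (simp add: vertex_group_def)

lemma countable_vertex_group:
  assumes "countable X" shows "countable (carrier (vertex_group X R k))"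
proof -
  let ?P = "carrier (presented_group X R)"
  let ?f = "\<lambda>h. (h (3 * k), h (3 * k + 1), h (3 * k + 2))"
  have "inj_on ?f (carrier (vertex_group X R k))"
  proof (rule inj_onI)
    fix g h assume gh: "g \<in> carrier (vertex_group X R k)" "h \<in> carrier (vertex_group X R k)"
      and eq: "?f g = ?f h"
    show "g = h"
    proof (rule extensionalityI[of _ "triple k"])
      show "g j = h j" if "j \<in> triple k" for j using that eq by (auto simp: triple_def)
    qed (use gh in \<open>simp_all add: vertex_group_closed\<close>)
  qed
  moreover have "?f ` carrier (vertex_group X R k) \<subseteq> ?P \<times> ?P \<times> ?P"
    by (auto simp: vertex_group_closed triple_def)
  moreover have "countable (?P \<times> ?P \<times> ?P)"
    using countable_presented_group[OF assms, of R] by (intro countable_SIGMA)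
  ultimately show ?thesis
    using countable_image_inj_on countable_subset by blast
qed

text \<open>\<open>J\<close> is the automorphism that inverts x and y and fixes t. It enters twice:
  as the twist in the embedding of a side subgroup, and as the identification of two glued sides.
  One locale serves F, where t is absent, and G.\<close>

locale side_presentation =
  fixes X :: "gen set" and R :: "(gen gword \<times> gen gword) set"
    and J :: "gen gword set \<Rightarrow> gen gword set"
  assumes J_hom: "J \<in> hom (presented_group X R) (presented_group X R)"
    and J_inv: "g \<in> X \<Longrightarrow> g \<noteq> gen_t \<Longrightarrow>
      J (word_class X R (letter g)) = inv\<^bsub>presented_group X R\<^esub> (word_class X R (letter g))"
    and J_t: "gen_t \<in> X \<Longrightarrow> J (word_class X R (letter gen_t)) = word_class X R (letter gen_t)"
begin

abbreviation "P \<equiv> presented_group X R"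

sublocale P: group P by (rule group_presented_group)

sublocale J: group_hom P P J
  using J_hom by (simp add: group_hom_def group_hom_axioms_def P.is_group)

lemma J_J:
  assumes "p \<in> carrier P" shows "J (J p) = p"
proof (rule presented_group_hom_eq[OF P.is_group _ _ _ assms])
  show "(\<lambda>p. J (J p)) \<in> hom P P"
    using hom_compose[OF J_hom J_hom] by (simp add: comp_def)
  show "(\<lambda>p. p) \<in> hom P P" by (simp add: hom_def)
  show "J (J (word_class X R (letter g))) = word_class X R (letter g)" if "g \<in> X" for g
    using that J_inv[OF that] J_t by (cases "g = gen_t") simp_all
qed

text \<open>The isomorphism p \<mapsto> (J p, p) from the abstract group onto A_i or B_i. It sends x
  to x_i^-1 x_{i+1} and t to t_i t_{i+1}, and its coordinate at \<open>csucc i\<close> returns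
  p.\<close>

definition side_hom :: "nat \<Rightarrow> gen gword set \<Rightarrow> nat \<Rightarrow> gen gword set" where
  "side_hom i p = (\<lambda>j\<in>triple (i div 3). if j = i then J p else if j = csucc i then p else \<one>\<^bsub>P\<^esub>)"

lemma side_hom_hom: "side_hom i \<in> hom P (vertex_group X R (i div 3))"
proof (rule homI)
  show "side_hom i p \<in> carrier (vertex_group X R (i div 3))" if "p \<in> carrier P" for p
    using that by (simp add: vertex_group_closed side_hom_def)
  show "side_hom i (p \<otimes>\<^bsub>P\<^esub> q) =
      side_hom i p \<otimes>\<^bsub>vertex_group X R (i div 3)\<^esub> side_hom i q"
    if "p \<in> carrier P" "q \<in> carrier P" for p q
    unfolding vertex_group_mult side_hom_def using that by (intro restrict_ext) simp
qed

lemma side_hom_csucc: "side_hom i p (csucc i) = p"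
  by (simp add: side_hom_def triple_iff csucc_div csucc_neq)

lemma side_hom_inj: "inj_on (side_hom i) A"
  by (rule inj_onI) (metis side_hom_csucc)

lemma side_elem_eq:
  assumes "g \<in> X"
  shows "side_elem X R i g = side_hom i (word_class X R (letter g))"
proof -
  let ?c = "word_class X R (letter g)"
  have c: "?c \<in> carrier P" using assms by simp
  have closed: "copy_elem X R i ?c \<in> carrier (vertex_group X R (i div 3))"
    using c by (auto simp: copy_elem_def vertex_group_closed)
  have inverse: "inv\<^bsub>vertex_group X R (i div 3)\<^esub> (copy_elem X R i ?c) =
      (\<lambda>j\<in>triple (i div 3). inv\<^bsub>P\<^esub> (copy_elem X R i ?c j))"
    using closed unfolding vertex_group_def
    by (subst inv_product_group) (simp_all add: group_presented_group)
  show ?thesis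
  proof (cases "g = gen_t")
    case True
    then show ?thesis
      using c J_t assms csucc_neq[of i]
      by (auto simp: vertex_group_mult side_hom_def copy_elem_def csucc_div intro!: restrict_ext)
  next
    case False
    then have "side_elem X R i g = inv\<^bsub>vertex_group X R (i div 3)\<^esub> (copy_elem X R i ?c)
        \<otimes>\<^bsub>vertex_group X R (i div 3)\<^esub> copy_elem X R (csucc i) ?c"
      by (cases g) simp_all
    then show ?thesis
      unfolding inverse using c J_inv[OF assms False] csucc_neq[of i]
      by (auto simp: vertex_group_mult side_hom_def copy_elem_def csucc_div intro!: restrict_ext)
  qed
qed

text \<open>Inverting a and b while keeping c is the effect of \<open>J\<close> on generators, so
  gluing with reversed orientation is precomposition with \<open>J\<close>.\<close>

lemma opposite_side_elem_eq:
  assumes "g \<in> X"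
  shows "opposite_side_elem X R i g = side_hom i (J (word_class X R (letter g)))"
proof (cases "g = gen_t")
  case True
  then show ?thesis using side_elem_eq[OF assms] J_t assms by simp
next
  case False
  interpret S: group_hom P "vertex_group X R (i div 3)" "side_hom i"
    by (simp add: group_hom_def group_hom_axioms_def group_vertex_group side_hom_hom P.is_group)
  have "opposite_side_elem X R i g = inv\<^bsub>vertex_group X R (i div 3)\<^esub> (side_elem X R i g)"
    using False by (cases g) simp_all
  then show ?thesis
    using assms J_inv[OF assms False] by (simp add: side_elem_eq)
qed

lemma induced_map_side_elem:
  assumes "i div 3 = k" "p \<in> carrier P"
  shows "induced_map (vertex_group X R k) (side_elem X R i) p = side_hom i p"
proof (rule induced_map_eq_hom)
  show "side_hom i \<in> hom P (vertex_group X R k)" using side_hom_hom[of i] assms(1) by simp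
qed (simp_all add: group_vertex_group side_elem_eq assms)

lemma induced_map_opposite_side_elem:
  assumes "i div 3 = k" "p \<in> carrier P"
  shows "induced_map (vertex_group X R k) (opposite_side_elem X R i) p = side_hom i (J p)"
proof (rule induced_map_eq_hom[where h = "\<lambda>p. side_hom i (J p)"])
  show "(\<lambda>p. side_hom i (J p)) \<in> hom P (vertex_group X R k)"
    using hom_compose[OF J_hom side_hom_hom[of i]] assms(1) by (simp add: comp_def)
qed (simp_all add: group_vertex_group opposite_side_elem_eq assms)

end

locale polygon = side_presentation +
  fixes T :: "'v pair_pre_digraph" and num :: "'v \<Rightarrow> nat" and side :: "'v \<Rightarrow> 'v \<Rightarrow> nat"
  assumes tree: "finite_tree T" and assignment: "index_assignment T num side"
begin

abbreviation "VG v \<equiv> vertex_group X R (num v)"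
abbreviation "PG \<equiv> polygon_group X R T num side"

definition elem :: "'v \<Rightarrow> (nat \<Rightarrow> gen gword set) \<Rightarrow> ('v \<times> (nat \<Rightarrow> gen gword set)) gword set" where
  "elem v h = word_class (polygon_gens X R T num) (polygon_rels X R T num side) (letter (v, h))"

sublocale PG: group PG unfolding polygon_group_def by (rule group_presented_group)

sublocale T: pair_graph T using tree unfolding finite_tree_def by blast

lemma side_div: "(u, v) \<in> parcs T \<Longrightarrow> side u v div 3 = num u"
  using assignment unfolding index_assignment_def by (auto simp: triple_iff)

lemma arc_reverse: "(u, v) \<in> parcs T \<Longrightarrow> (v, u) \<in> parcs T"
  using T.pair_sym_arcs unfolding symmetric_def by (auto dest: symD)

lemma polygon_gens_iff:
  "(v, h) \<in> polygon_gens X R T num \<longleftrightarrow> v \<in> pverts T \<and> h \<in> carrier (VG v)"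
  by (auto simp: polygon_gens_def tree_gens_def)

lemma side_hom_arc: "(u, v) \<in> parcs T \<Longrightarrow> side_hom (side u v) \<in> hom P (VG u)"
  using side_hom_hom[of "side u v"] by (simp add: side_div)

lemma elem_hom:
  assumes "v \<in> pverts T" shows "elem v \<in> hom (VG v) PG"
proof (rule homI)
  show "elem v h \<in> carrier PG" if "h \<in> carrier (VG v)" for h
    using that assms unfolding elem_def polygon_group_def by (simp add: polygon_gens_iff)
  show "elem v (g \<otimes>\<^bsub>VG v\<^esub> h) = elem v g \<otimes>\<^bsub>PG\<^esub> elem v h"
    if "g \<in> carrier (VG v)" "h \<in> carrier (VG v)" for g h
  proof -
    interpret VG: group "VG v" by (rule group_vertex_group)
    have "word_class (polygon_gens X R T num) (polygon_rels X R T num side)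
        ([(True, (v, g))] @ [(True, (v, h))]) = elem v (g \<otimes>\<^bsub>VG v\<^esub> h)"
      unfolding elem_def
      using that assms by (intro word_class_rel) (auto simp: polygon_rels_def tree_rels_def polygon_gens_iff)
    then show ?thesis
      using that assms unfolding elem_def polygon_group_def
      by (subst mult_word_class) (simp_all add: polygon_gens_iff)
  qed
qed

text \<open>The amalgamation as used from here on, with both induced edge maps replaced by
  \<open>side_hom\<close>.\<close>

lemma elem_edge:
  assumes "(u, v) \<in> parcs T" "k \<in> carrier P"
  shows "elem u (side_hom (side u v) k) = elem v (side_hom (side v u) (J k))"
proof -
  have "(letter (u, side_hom (side u v) k), letter (v, side_hom (side v u) (J k)))
      \<in> polygon_rels X R T num side"
    unfolding polygon_rels_def tree_rels_def
    using assms induced_map_side_elem[OF side_div[OF assms(1)] assms(2)]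
      induced_map_opposite_side_elem[OF side_div[OF arc_reverse[OF assms(1)]] assms(2)]
    by force
  then show ?thesis
    unfolding elem_def
    using assms T.wellformed'[of u v] hom_in_carrier[OF side_hom_arc] arc_reverse
    by (intro word_class_rel) (auto simp: polygon_gens_iff)
qed

text \<open>The universal property of the tree of groups. It is applied both to permutations and,
  for the map from \<open>V\<^sub>T\<close>, to \<open>W\<^sub>T\<close>.\<close>

lemma polygon_hom_ex:
  fixes Q :: "'q monoid"
  assumes "group Q" and hom: "\<And>v. v \<in> pverts T \<Longrightarrow> \<rho> v \<in> hom (VG v) Q"
    and edge: "\<And>u v k. (u, v) \<in> parcs T \<Longrightarrow> k \<in> carrier P \<Longrightarrow>
      \<rho> u (side_hom (side u v) k) = \<rho> v (side_hom (side v u) (J k))"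
  shows "\<exists>\<Psi>\<in>hom PG Q. \<forall>v\<in>pverts T. \<forall>h\<in>carrier (VG v). \<Psi> (elem v h) = \<rho> v h"
proof -
  interpret Q: group Q by fact
  let ?f = "\<lambda>(v, h). \<rho> v h"
  have closed: "\<rho> v h \<in> carrier Q" if "v \<in> pverts T" "h \<in> carrier (VG v)" for v h
    using hom_in_carrier[OF hom] that by blast
  have "\<exists>\<Psi>\<in>hom (presented_group (polygon_gens X R T num) (polygon_rels X R T num side)) Q.
    \<forall>w\<in>words (polygon_gens X R T num).
      \<Psi> (word_class (polygon_gens X R T num) (polygon_rels X R T num side) w) = word_eval Q ?f w"
  proof (rule presented_group_hom_ex[OF assms(1)])
    show "?f ` polygon_gens X R T num \<subseteq> carrier Q"
      using closed by (auto simp: polygon_gens_iff)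
  next
    fix a b assume "(a, b) \<in> polygon_rels X R T num side"
    then consider v g h where "v \<in> pverts T" "g \<in> carrier (VG v)" "h \<in> carrier (VG v)"
        "a = [(True, (v, g)), (True, (v, h))]" "b = letter (v, g \<otimes>\<^bsub>VG v\<^esub> h)"
      | u v k where "(u, v) \<in> parcs T" "k \<in> carrier P"
        "a = letter (u, induced_map (VG u) (side_elem X R (side u v)) k)"
        "b = letter (v, induced_map (VG v) (opposite_side_elem X R (side v u)) k)"
      unfolding polygon_rels_def tree_rels_def by auto
    then show "word_eval Q ?f a = word_eval Q ?f b"
    proof cases
      case 1
      then show ?thesis using closed hom_mult[OF hom] by simp
    next
      case 2
      have "a = letter (u, side_hom (side u v) k)" "b = letter (v, side_hom (side v u) (J k))"
        using 2 induced_map_side_elem[OF side_div[OF 2(1)]]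
          induced_map_opposite_side_elem[OF side_div[OF arc_reverse[OF 2(1)]]] by simp_all
      then show ?thesis using edge[OF 2(1,2)] by simp
    qed
  qed
  then obtain \<Psi> where \<Psi>: "\<Psi> \<in> hom PG Q" "\<forall>w\<in>words (polygon_gens X R T num).
      \<Psi> (word_class (polygon_gens X R T num) (polygon_rels X R T num side) w) = word_eval Q ?f w"
    unfolding polygon_group_def by blast
  have "\<Psi> (elem v h) = \<rho> v h" if "v \<in> pverts T" "h \<in> carrier (VG v)" for v h
    unfolding elem_def using bspec[OF \<Psi>(2), of "letter (v, h)"] that closed
    by (simp add: polygon_gens_iff)
  then show ?thesis using \<Psi>(1) by blast
qed

lemma polygon_induct [consumes 1, case_names one elem mult inv]:
  assumes "p \<in> carrier PG" and "Q \<one>\<^bsub>PG\<^esub>"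
    and "\<And>v g. v \<in> pverts T \<Longrightarrow> g \<in> carrier (VG v) \<Longrightarrow> Q (elem v g)"
    and "\<And>p q. p \<in> carrier PG \<Longrightarrow> q \<in> carrier PG \<Longrightarrow> Q p \<Longrightarrow> Q q \<Longrightarrow> Q (p \<otimes>\<^bsub>PG\<^esub> q)"
    and "\<And>p. p \<in> carrier PG \<Longrightarrow> Q p \<Longrightarrow> Q (inv\<^bsub>PG\<^esub> p)"
  shows "Q p"
  using assms(1)[unfolded polygon_group_def]
proof (induction p rule: presented_group_induct)
  case (letter x)
  then show ?case using assms(3)[unfolded elem_def] by (cases x) (simp add: polygon_gens_iff)
qed (use assms(2,4,5) in \<open>simp_all add: polygon_group_def\<close>)

lemma countable_PG:
  assumes "countable X" shows "countable (carrier PG)"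
proof -
  have "countable (polygon_gens X R T num)"
    unfolding polygon_gens_def tree_gens_def
    using T.pair_finite_verts countable_vertex_group[OF assms]
    by (intro countable_SIGMA) (auto intro: countable_finite)
  then show ?thesis unfolding polygon_group_def by (rule countable_presented_group)
qed

lemma vertex_of:
  assumes "i < 3 * card (pverts T)"
  shows "vertex_of T num i \<in> pverts T" "num (vertex_of T num i) = i div 3"
proof -
  have b: "bij_betw num (pverts T) {0..<card (pverts T)}"
    using assignment unfolding index_assignment_def by blast
  moreover have "i div 3 \<in> {0..<card (pverts T)}" using assms by auto
  ultimately show "vertex_of T num i \<in> pverts T" "num (vertex_of T num i) = i div 3"
    unfolding vertex_of_def bij_betw_def
    by (metis order.refl the_inv_into_into) (metis b bij_betw_def f_the_inv_into_f \<open>i div 3 \<in> _\<close>)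
qed

lemma polygon_elem_eq: "polygon_elem X R T num side i h = elem (vertex_of T num i) h"
  by (simp add: polygon_elem_def elem_def)

definition boundary :: "nat \<Rightarrow> gen gword set \<Rightarrow> ('v \<times> (nat \<Rightarrow> gen gword set)) gword set" where
  "boundary i p = elem (vertex_of T num i) (side_hom i p)"

lemma side_hom_vertex_of:
  "i < 3 * card (pverts T) \<Longrightarrow> side_hom i \<in> hom P (VG (vertex_of T num i))"
  using side_hom_hom[of i] by (simp add: vertex_of)

lemma boundary_hom:
  assumes "i < 3 * card (pverts T)" shows "boundary i \<in> hom P PG"
  using hom_compose[OF side_hom_vertex_of[OF assms] elem_hom[OF vertex_of(1)[OF assms]]]
  by (simp add: boundary_def[abs_def] comp_def)

lemma boundary_letter:
  "g \<in> X \<Longrightarrow> boundary i (word_class X R (letter g)) = polygon_side_elem X R T num side i g"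
  by (simp add: boundary_def polygon_elem_eq side_elem_eq)

text \<open>Vertex actions that agree on edge groups are the data that the universal property turns
  into an action of the polygon group. \<open>Y\<close> is empty for the embedding of the vertex
  groups, and the carrier of \<open>V\<^sub>T\<close> or \<open>S\<^sub>T\<^sub>,\<^sub>n\<close>
  for the action of \<open>W\<^sub>T\<close>.\<close>

lemma polygon_action:
  assumes "countable X" "countable Y"
    and D: "\<And>v. v \<in> pverts T \<Longrightarrow> free_partial_action (VG v) Y (D v)"
    and trace: "\<And>u v k x y. (u, v) \<in> parcs T \<Longrightarrow> k \<in> carrier P \<Longrightarrow> x \<in> Y \<Longrightarrow> y \<in> Y \<Longrightarrow>
      D u (side_hom (side u v) k) x y \<longleftrightarrow> D v (side_hom (side v u) (J k)) x y"
  shows "\<exists>act j A. (\<forall>v\<in>pverts T. extends_partial_action (VG v) Y (D v) (act v) j) \<and>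
    A \<in> hom PG nat_perms \<and> (\<forall>v\<in>pverts T. \<forall>h\<in>carrier (VG v). A (elem v h) = act v h)"
proof -
  have "\<exists>act j. (\<forall>v\<in>pverts T. extends_partial_action (VG v) Y (D v) (act v) j) \<and>
    (\<forall>(u, v)\<in>parcs T. \<forall>k\<in>carrier P. \<forall>n.
      act u (side_hom (side u v) k) n = act v (side_hom (side v u) (J k)) n)"
  proof (rule tree_of_actions[where H = VG and D = D and J = J and \<alpha> = "\<lambda>u v. side_hom (side u v)",
        OF tree P.is_group _ _ assms(2)])
    show "group (VG v)" "countable (carrier (VG v))" for v
      by (rule group_vertex_group, rule countable_vertex_group[OF assms(1)])
    show "free_partial_action (VG v) Y (D v)" if "v \<in> pverts T" for v using that by (rule D)
    show "side_hom (side u v) \<in> hom P (VG u)" if "(u, v) \<in> parcs T" for u v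
      using that by (rule side_hom_arc)
    show "inj_on (side_hom (side u v)) (carrier P)" for u v by (rule side_hom_inj)
    show "J \<in> hom P P" by (rule J_hom)
    show "J (J k) = k" if "k \<in> carrier P" for k using that by (rule J_J)
    show "D u (side_hom (side u v) k) x y \<longleftrightarrow> D v (side_hom (side v u) (J k)) x y"
      if "(u, v) \<in> parcs T" "k \<in> carrier P" "x \<in> Y" "y \<in> Y" for u v k x y
      using that by (rule trace)
  qed
  then obtain act j where act: "(\<forall>v\<in>pverts T. extends_partial_action (VG v) Y (D v) (act v) j) \<and>
    (\<forall>(u, v)\<in>parcs T. \<forall>k\<in>carrier P. \<forall>n.
      act u (side_hom (side u v) k) n = act v (side_hom (side v u) (J k)) n)"
    by (elim exE)
  have free: "free_action (VG v) (act v)" if "v \<in> pverts T" for v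
    using bspec[OF act[THEN conjunct1] that] unfolding extends_partial_action_def by (rule conjunct1)
  have "\<exists>A\<in>hom PG nat_perms. \<forall>v\<in>pverts T. \<forall>h\<in>carrier (VG v). A (elem v h) = act v h"
  proof (rule polygon_hom_ex[OF group_BijGroup])
    show "act v \<in> hom (VG v) nat_perms" if "v \<in> pverts T" for v
      using free_action_hom_nat_perms[OF group_vertex_group free[OF that]] .
    show "act u (side_hom (side u v) k) = act v (side_hom (side v u) (J k))"
      if "(u, v) \<in> parcs T" "k \<in> carrier P" for u v k
      by (rule ext, rule bspec[OF act[THEN conjunct2] that(1), unfolded prod.case, rule_format, OF that(2)])
  qed
  then show ?thesis using act[THEN conjunct1] by blast
qed

end

section \<open>The groups \<open>F\<close> and \<open>G\<close>\<close>

lemma group_F_grp: "group F_grp"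
  unfolding F_grp_def by (rule group_presented_group)

lemma F_class_closed: "w \<in> words F_gens \<Longrightarrow> F_class w \<in> carrier F_grp"
  unfolding F_grp_def F_class_def by simp

lemma F_classE:
  assumes "p \<in> carrier F_grp"
  obtains w where "w \<in> words F_gens" "p = F_class w"
  using assms unfolding F_grp_def F_class_def by (rule carrier_presented_groupE)

lemma ex_side_presentation_F: "\<exists>J. side_presentation F_gens F_rels J"
proof -
  let ?P = "presented_group F_gens F_rels" and ?c = "\<lambda>g. word_class F_gens F_rels (letter g)"
  interpret group ?P by (rule group_presented_group)
  have "\<exists>J\<in>hom ?P ?P. \<forall>w\<in>words F_gens.
      J (word_class F_gens F_rels w) = word_eval ?P (\<lambda>g. inv\<^bsub>?P\<^esub> (?c g)) w"
  proof (rule presented_group_hom_ex[OF is_group])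
    show "(\<lambda>g. inv\<^bsub>?P\<^esub> (?c g)) ` F_gens \<subseteq> carrier ?P" by auto
  qed (use F_rels_def in blast)
  then obtain J where J: "J \<in> hom ?P ?P" "\<forall>w\<in>words F_gens.
      J (word_class F_gens F_rels w) = word_eval ?P (\<lambda>g. inv\<^bsub>?P\<^esub> (?c g)) w"
    by blast
  have "side_presentation F_gens F_rels J"
  proof
    show "J \<in> hom ?P ?P" by (rule J(1))
    show "J (?c g) = inv\<^bsub>?P\<^esub> (?c g)" if "g \<in> F_gens" "g \<noteq> gen_t" for g
      using bspec[OF J(2), of "letter g"] that by simp
  qed (simp add: F_gens_def)
  then show ?thesis by blast
qed

lemma words_mono: "w \<in> words X \<Longrightarrow> X \<subseteq> Y \<Longrightarrow> w \<in> words Y"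
  by (auto simp: words_def)

lemma invert_letters_words: "w \<in> words X \<Longrightarrow> invert_letters w \<in> words X"
  by (induction w) (auto simp: invert_letters_def)

locale F_inversion = side_presentation F_gens F_rels J for J
begin

lemma J_F_class:
  assumes "w \<in> words F_gens" shows "J (F_class w) = F_class (invert_letters w)"
  using assms
proof (induction w)
  case Nil
  then show ?case
    using J.hom_one by (simp add: F_class_def invert_letters_def word_class_Nil)
next
  case (Cons l w)
  obtain b g where l: "l = (b, g)" by force
  have g: "g \<in> F_gens" "w \<in> words F_gens" using Cons.prems by (auto simp: l)
  then have gt: "g \<noteq> gen_t" by (auto simp: F_gens_def)
  have "J (word_class F_gens F_rels [(b, g)]) = word_class F_gens F_rels [(\<not> b, g)]"
    using g J_inv[OF g(1) gt] by (cases b) (simp_all add: word_class_inverse_letter)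
  moreover have "word_class F_gens F_rels ([(b, g)] @ w) =
      word_class F_gens F_rels [(b, g)] \<otimes>\<^bsub>P\<^esub> word_class F_gens F_rels w"
    using g by (intro word_class_append) auto
  moreover have "word_class F_gens F_rels ([(\<not> b, g)] @ invert_letters w) =
      word_class F_gens F_rels [(\<not> b, g)] \<otimes>\<^bsub>P\<^esub> word_class F_gens F_rels (invert_letters w)"
    using g invert_letters_words by (intro word_class_append) auto
  ultimately show ?case
    using Cons.IH[OF g(2)] g by (simp add: F_class_def l invert_letters_def)
qed

text \<open>\<open>J\<close> inverts the letters of every word that represents the element, so
  palindromicity does not depend on the word chosen.\<close>

lemma palindromic_elem_iff:
  assumes "p \<in> carrier F_grp"
  shows "palindromic_elem p \<longleftrightarrow> J p = inv\<^bsub>F_grp\<^esub> p"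
proof
  show "palindromic_elem p \<Longrightarrow> J p = inv\<^bsub>F_grp\<^esub> p"
    unfolding palindromic_elem_def using J_F_class by metis
  assume J: "J p = inv\<^bsub>F_grp\<^esub> p"
  obtain w where "w \<in> words F_gens" "p = F_class w" using assms by (rule F_classE)
  then show "palindromic_elem p"
    unfolding palindromic_elem_def using J J_F_class by metis
qed

text \<open>The generators are palindromic, hence so are their images, and on palindromic elements
  \<open>J\<close> is inversion. Thus \<phi>(J g) = \<phi>(g)^-1 = J(\<phi> g) for a generator g,
  and two homomorphisms that agree on generators are equal.\<close>

lemma aut_commutes_J:
  assumes "palindromic_aut \<phi>" "p \<in> carrier F_grp"
  shows "\<phi> (J p) = J (\<phi> p)"
proof (rule presented_group_hom_eq[OF P.is_group _ _ _ assms(2)[unfolded F_grp_def]])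
  have \<phi>: "\<phi> \<in> hom P P"
    using assms(1) unfolding palindromic_aut_def iso_def F_grp_def by blast
  show "(\<lambda>p. \<phi> (J p)) \<in> hom P P" "(\<lambda>p. J (\<phi> p)) \<in> hom P P"
    using hom_compose[OF J_hom \<phi>] hom_compose[OF \<phi> J_hom] by (simp_all add: comp_def)
  fix g assume g: "g \<in> F_gens"
  let ?c = "word_class F_gens F_rels (letter g)"
  have c: "?c \<in> carrier F_grp" using g by (simp add: F_grp_def)
  have J: "J ?c = inv\<^bsub>F_grp\<^esub> ?c"
    using J_inv[OF g] g unfolding F_grp_def by (auto simp: F_gens_def)
  interpret \<phi>: group_hom P P \<phi>
    using \<phi> by (simp add: group_hom_def group_hom_axioms_def P.is_group)
  have "palindromic_elem (\<phi> ?c)"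
    using palindromic_elem_iff[OF c] J c assms(1) unfolding palindromic_aut_def by blast
  moreover have "\<phi> ?c \<in> carrier F_grp" using c unfolding F_grp_def by simp
  ultimately have "J (\<phi> ?c) = inv\<^bsub>F_grp\<^esub> (\<phi> ?c)"
    using palindromic_elem_iff[of "\<phi> ?c"] by simp
  then show "\<phi> (J ?c) = J (\<phi> ?c)"
    unfolding J using \<phi>.hom_inv[OF c[unfolded F_grp_def]] unfolding F_grp_def by simp
qed

lemma aut_pow_commutes_J:
  assumes "palindromic_aut \<phi>" "p \<in> carrier F_grp"
  shows "(\<phi> ^^ n) (J p) = J ((\<phi> ^^ n) p) \<and> (\<phi> ^^ n) p \<in> carrier F_grp"
proof (induction n)
  case 0
  then show ?case using assms(2) by simp
next
  case (Suc n)
  have "\<phi> \<in> hom F_grp F_grp" using assms(1) unfolding palindromic_aut_def iso_def by blast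
  then have "\<phi> ((\<phi> ^^ n) p) \<in> carrier F_grp"
    using conjunct2[OF Suc] by (rule hom_in_carrier)
  moreover have "\<phi> (J ((\<phi> ^^ n) p)) = J (\<phi> ((\<phi> ^^ n) p))"
    by (rule aut_commutes_J[OF assms(1) conjunct2[OF Suc]])
  ultimately show ?case using Suc by simp
qed

end

section \<open>Powers of the automorphism and the group G containing F\<close>

lemma aut_pow:
  assumes "\<phi> \<in> iso F_grp F_grp"
  shows "\<phi> ^^ n \<in> hom F_grp F_grp" "bij_betw (\<phi> ^^ n) (carrier F_grp) (carrier F_grp)"
proof -
  have "\<phi> ^^ n \<in> iso F_grp F_grp"
  proof (induction n)
    case 0
    have "(\<lambda>x. x) \<in> iso F_grp F_grp" by (simp add: iso_def hom_def bij_betw_def)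
    then show ?case by (simp add: id_def)
  next
    case (Suc n)
    show ?case unfolding funpow.simps(2) by (rule iso_set_trans[OF Suc assms])
  qed
  then show "\<phi> ^^ n \<in> hom F_grp F_grp" "bij_betw (\<phi> ^^ n) (carrier F_grp) (carrier F_grp)"
    by (simp_all add: iso_def)
qed

abbreviation G_grp where "G_grp \<phi> n \<equiv> presented_group G_gens (G_rels \<phi> n)"
abbreviation G_class where "G_class \<phi> n \<equiv> word_class G_gens (G_rels \<phi> n)"
abbreviation G_t where "G_t \<phi> n \<equiv> G_class \<phi> n (letter gen_t)"

lemma F_gens_subset: "F_gens \<subseteq> G_gens" and gen_t_G_gens: "gen_t \<in> G_gens"
  by (auto simp: F_gens_def G_gens_def)

lemma aut_pow_wordE:
  assumes "\<phi> \<in> iso F_grp F_grp" "g \<in> F_gens" "w \<in> (\<phi> ^^ n) (F_class (letter g))"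
  shows "w \<in> words F_gens" "F_class w = (\<phi> ^^ n) (F_class (letter g))"
proof -
  have "(\<phi> ^^ n) (F_class (letter g)) \<in> carrier F_grp"
    using hom_in_carrier[OF aut_pow(1)[OF assms(1)]] F_class_closed assms(2) by simp
  then obtain u where u: "u \<in> words F_gens" "(\<phi> ^^ n) (F_class (letter g)) = F_class u"
    by (rule F_classE)
  then have "pres_eq F_gens F_rels u w"
    using assms(3) by (simp add: F_class_def word_class_def)
  then show "w \<in> words F_gens" "F_class w = (\<phi> ^^ n) (F_class (letter g))"
    using u pres_eq_words(2) word_class_eqI unfolding F_class_def by metis+
qed

lemma aut_pow_ex_word:
  assumes "\<phi> \<in> iso F_grp F_grp" "g \<in> F_gens"
  shows "\<exists>w. w \<in> (\<phi> ^^ n) (F_class (letter g))"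
proof -
  have "(\<phi> ^^ n) (F_class (letter g)) \<in> carrier F_grp"
    using hom_in_carrier[OF aut_pow(1)[OF assms(1)]] F_class_closed assms(2) by simp
  then obtain u where "u \<in> words F_gens" "(\<phi> ^^ n) (F_class (letter g)) = F_class u"
    by (rule F_classE)
  then show ?thesis by (auto simp: F_class_def word_class_def intro: pres_eq.refl)
qed

text \<open>The defining relations give t g = \<phi>^n(g) t for the two generators only;
  \<open>intertwine_generators\<close> extends this to all of F.\<close>

lemma F_to_G:
  assumes iso: "\<phi> \<in> iso F_grp F_grp"
  shows "\<exists>\<epsilon>\<in>hom F_grp (G_grp \<phi> n). (\<forall>w\<in>words F_gens. \<epsilon> (F_class w) = G_class \<phi> n w) \<and>
    (\<forall>p\<in>carrier F_grp. G_t \<phi> n \<otimes>\<^bsub>G_grp \<phi> n\<^esub> \<epsilon> p = \<epsilon> ((\<phi> ^^ n) p) \<otimes>\<^bsub>G_grp \<phi> n\<^esub> G_t \<phi> n)"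
proof -
  let ?G = "G_grp \<phi> n" and ?c = "\<lambda>g. G_class \<phi> n (letter g)"
  interpret G: group ?G by (rule group_presented_group)
  have t: "G_t \<phi> n \<in> carrier ?G" using gen_t_G_gens by simp
  have "\<exists>\<epsilon>\<in>hom (presented_group F_gens F_rels) ?G. \<forall>w\<in>words F_gens.
      \<epsilon> (word_class F_gens F_rels w) = word_eval ?G ?c w"
  proof (rule presented_group_hom_ex[OF G.is_group])
    show "?c ` F_gens \<subseteq> carrier ?G" using F_gens_subset by auto
  qed (use F_rels_def in blast)
  then obtain \<epsilon> where \<epsilon>: "\<epsilon> \<in> hom F_grp ?G"
    "\<forall>w\<in>words F_gens. \<epsilon> (F_class w) = word_eval ?G ?c w"
    unfolding F_grp_def F_class_def by blast
  have \<epsilon>_class: "\<epsilon> (F_class w) = G_class \<phi> n w" if "w \<in> words F_gens" for w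
    using \<epsilon>(2) that word_class_eq_word_eval[OF words_mono[OF that F_gens_subset]] by simp
  have \<epsilon>_closed: "\<epsilon> p \<in> carrier ?G" if "p \<in> carrier F_grp" for p
    using hom_in_carrier[OF \<epsilon>(1) that] .
  have "G_t \<phi> n \<otimes>\<^bsub>?G\<^esub> \<epsilon> p = \<epsilon> ((\<phi> ^^ n) p) \<otimes>\<^bsub>?G\<^esub> G_t \<phi> n" if p: "p \<in> carrier F_grp" for p
  proof (rule intertwine_generators[OF G.is_group \<epsilon>(1)[unfolded F_grp_def] _ t p[unfolded F_grp_def]])
    show "(\<lambda>p. \<epsilon> ((\<phi> ^^ n) p)) \<in> hom (presented_group F_gens F_rels) ?G"
      using hom_compose[OF aut_pow(1)[OF iso] \<epsilon>(1)] by (simp add: comp_def F_grp_def)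
    fix g assume g: "g \<in> F_gens"
    obtain w where w: "w \<in> (\<phi> ^^ n) (F_class (letter g))" using aut_pow_ex_word[OF iso g] by blast
    note w' = aut_pow_wordE[OF iso g w]
    have gG: "g \<in> G_gens" using g F_gens_subset by blast
    have c: "\<epsilon> (F_class (letter g)) = ?c g" using \<epsilon>_class[of "letter g"] g by simp
    have u: "[(True, gen_t), (True, g), (False, gen_t)] \<in> words G_gens"
      using gen_t_G_gens gG by simp
    have "G_class \<phi> n [(True, gen_t), (True, g), (False, gen_t)] = G_class \<phi> n w"
      using words_mono[OF w'(1) F_gens_subset] g w by (intro word_class_rel u) (auto simp: G_rels_def)
    then have "G_t \<phi> n \<otimes>\<^bsub>?G\<^esub> (?c g \<otimes>\<^bsub>?G\<^esub> (inv\<^bsub>?G\<^esub> (G_t \<phi> n) \<otimes>\<^bsub>?G\<^esub> \<one>\<^bsub>?G\<^esub>)) =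
        \<epsilon> ((\<phi> ^^ n) (F_class (letter g)))"
      unfolding word_class_eq_word_eval[OF u] \<epsilon>_class[OF w'(1), symmetric] w'(2) by simp
    then have "G_t \<phi> n \<otimes>\<^bsub>?G\<^esub> ?c g = \<epsilon> ((\<phi> ^^ n) (F_class (letter g))) \<otimes>\<^bsub>?G\<^esub> G_t \<phi> n"
      using conj_eq_iff_intertwine[OF G.is_group t, of "?c g"] gG
        \<epsilon>_closed[OF hom_in_carrier[OF aut_pow(1)[OF iso] F_class_closed]] g by simp
    then show "G_t \<phi> n \<otimes>\<^bsub>?G\<^esub> \<epsilon> (word_class F_gens F_rels (letter g)) =
        \<epsilon> ((\<phi> ^^ n) (word_class F_gens F_rels (letter g))) \<otimes>\<^bsub>?G\<^esub> G_t \<phi> n"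
      using c unfolding F_class_def by simp
  qed
  then show ?thesis using \<epsilon>(1) \<epsilon>_class by (intro bexI[of _ \<epsilon>]) auto
qed

text \<open>Let \<open>F\<close> act freely on the natural numbers. A bijection that is equivariant with respect to
  \<open>\<phi>\<^sup>n\<close> can serve as the action of \<open>t\<close>, so the action of \<open>F\<close> extends to \<open>G\<close>.\<close>

lemma F_to_G_inj:
  assumes iso: "\<phi> \<in> iso F_grp F_grp" and \<epsilon>: "\<epsilon> \<in> hom F_grp (G_grp \<phi> n)"
    "\<And>w. w \<in> words F_gens \<Longrightarrow> \<epsilon> (F_class w) = G_class \<phi> n w"
  shows "inj_on \<epsilon> (carrier F_grp)"
proof -
  have "free_partial_action F_grp {} (\<lambda>_ (_ :: nat) _. True)"
    by (simp add: free_partial_action_def)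
  moreover have "countable (carrier F_grp)"
    unfolding F_grp_def by (rule countable_presented_group) (simp add: F_gens_def)
  ultimately obtain act and j :: "nat \<Rightarrow> nat"
    where act: "extends_partial_action F_grp {} (\<lambda>_ _ _. True) act j"
    using ex_extends_partial_action[OF group_F_grp _ countable_empty] by blast
  have free: "free_action F_grp act" and room: "roomy F_grp act (j ` {})"
    using act unfolding extends_partial_action_def by auto
  have inj: "inj_on (\<phi> ^^ n) (carrier F_grp)"
    using aut_pow(2)[OF iso] by (rule bij_betw_imp_inj_on)
  have "\<exists>f. bij f \<and> (\<forall>k\<in>carrier F_grp. \<forall>m. f (act k m) = act ((\<phi> ^^ n) k) (f m)) \<and>
      (\<forall>x\<in>{}. f (j x) = j x)"
    using free_action_hom[OF group_F_grp group_F_grp free aut_pow(1)[OF iso] inj]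
      roomy_hom[OF room aut_pow(1)[OF iso]]
    by (intro equivariant_extension[OF group_F_grp free _ _ room]) simp_all
  then obtain f where f: "bij f \<and> (\<forall>k\<in>carrier F_grp. \<forall>m. f (act k m) = act ((\<phi> ^^ n) k) (f m)) \<and>
      (\<forall>x\<in>{}. f (j x) = j x)"
    by (elim exE)
  let ?f = "\<lambda>g. if g = gen_t then f else act (F_class (letter g))"
  interpret N: group nat_perms by (rule group_BijGroup)
  have act_hom: "act \<in> hom F_grp nat_perms"
    by (rule free_action_hom_nat_perms[OF group_F_grp free])
  have fN: "f \<in> carrier nat_perms" using f by (simp add: nat_perms_carrier)
  have eval: "word_eval nat_perms ?f w = act (F_class w)" if "w \<in> words F_gens" for w
  proof -
    have "word_eval nat_perms ?f w = word_eval nat_perms (\<lambda>g. act (F_class (letter g))) w"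
      by (rule word_eval_cong[OF that]) (auto simp: F_gens_def)
    also have "\<dots> = act (F_class w)"
      using presented_group_hom_eval[OF N.is_group act_hom[unfolded F_grp_def] that]
      by (simp add: F_class_def)
    finally show ?thesis .
  qed
  have "\<exists>h\<in>hom (G_grp \<phi> n) nat_perms. \<forall>w\<in>words G_gens. h (G_class \<phi> n w) = word_eval nat_perms ?f w"
  proof (rule presented_group_hom_ex[OF N.is_group])
    show "?f ` G_gens \<subseteq> carrier nat_perms"
      using fN hom_in_carrier[OF act_hom F_class_closed] by (auto simp: G_gens_def F_gens_def)
    fix u v assume "(u, v) \<in> G_rels \<phi> n"
    then obtain g where g: "g \<in> F_gens" "u = [(True, gen_t), (True, g), (False, gen_t)]"
      "v \<in> (\<phi> ^^ n) (F_class (letter g))"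
      unfolding G_rels_def by blast
    note v = aut_pow_wordE[OF iso g(1,3)]
    let ?p = "F_class (letter g)"
    have p: "?p \<in> carrier F_grp" "(\<phi> ^^ n) ?p \<in> carrier F_grp"
      using F_class_closed g(1) hom_in_carrier[OF aut_pow(1)[OF iso]] by simp_all
    note pN = hom_in_carrier[OF act_hom p(1)] hom_in_carrier[OF act_hom p(2)]
    have "f \<otimes>\<^bsub>nat_perms\<^esub> act ?p = act ((\<phi> ^^ n) ?p) \<otimes>\<^bsub>nat_perms\<^esub> f"
    proof -
      have "f (act ?p m) = act ((\<phi> ^^ n) ?p) (f m)" for m
        using f p(1) by blast
      then show ?thesis
        using fN pN by (simp only: nat_perms_mult nat_perms_carrier)
    qed
    then have "f \<otimes>\<^bsub>nat_perms\<^esub> (act ?p \<otimes>\<^bsub>nat_perms\<^esub> inv\<^bsub>nat_perms\<^esub> f) = act ((\<phi> ^^ n) ?p)"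
      using fN pN N.m_assoc[of f "act ?p" "inv\<^bsub>nat_perms\<^esub> f"]
        N.m_assoc[of "act ((\<phi> ^^ n) ?p)" f "inv\<^bsub>nat_perms\<^esub> f"] by simp
    then show "word_eval nat_perms ?f u = word_eval nat_perms ?f v"
      using eval[OF v(1)] v(2) g(1,2) fN by (auto simp: F_gens_def)
  qed
  then obtain h where h: "h \<in> hom (G_grp \<phi> n) nat_perms"
    "\<forall>w\<in>words G_gens. h (G_class \<phi> n w) = word_eval nat_perms ?f w" by blast
  \<comment> \<open>The action of G restricts along \<epsilon> to the free action of F at the start,
    so \<epsilon> loses no information.\<close>
  have h_act: "h (\<epsilon> p) = act p" if p: "p \<in> carrier F_grp" for p
  proof -
    obtain w where w: "w \<in> words F_gens" "p = F_class w" using p by (rule F_classE)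
    have "h (\<epsilon> p) = word_eval nat_perms ?f w"
      using w \<epsilon>(2) bspec[OF h(2) words_mono[OF w(1) F_gens_subset]] by simp
    then show ?thesis using eval[OF w(1)] w(2) by simp
  qed
  show ?thesis
  proof (rule inj_onI)
    fix p q assume pq: "p \<in> carrier F_grp" "q \<in> carrier F_grp" "\<epsilon> p = \<epsilon> q"
    then have "act p = act q" using h_act[OF pq(1)] h_act[OF pq(2)] by simp
    then show "p = q" by (rule free_action_inj[OF group_F_grp free pq(1,2)])
  qed
qed

text \<open>Applying the assignment to t g t^-1 = \<phi>^n(g) turns the left side into t J(g) t^-1 =
  \<phi>^n(J g) and the right side into J(\<phi>^n g). They are equal because \<phi>^n commutes with
  \<open>J\<close>; this is the use of palindromicity.\<close>

lemma ex_side_presentation_G: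
  assumes \<phi>: "palindromic_aut \<phi>" and J: "side_presentation F_gens F_rels J"
    and \<epsilon>: "\<epsilon> \<in> hom F_grp (G_grp \<phi> n)" "\<And>w. w \<in> words F_gens \<Longrightarrow> \<epsilon> (F_class w) = G_class \<phi> n w"
    and t: "\<And>p. p \<in> carrier F_grp \<Longrightarrow>
      G_t \<phi> n \<otimes>\<^bsub>G_grp \<phi> n\<^esub> \<epsilon> p = \<epsilon> ((\<phi> ^^ n) p) \<otimes>\<^bsub>G_grp \<phi> n\<^esub> G_t \<phi> n"
  shows "\<exists>J'. side_presentation G_gens (G_rels \<phi> n) J' \<and> (\<forall>p\<in>carrier F_grp. J' (\<epsilon> p) = \<epsilon> (J p))"
proof -
  interpret F_inversion J unfolding F_inversion_def by (rule J)
  have iso: "\<phi> \<in> iso F_grp F_grp" using \<phi> unfolding palindromic_aut_def by blast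
  let ?G = "G_grp \<phi> n" and ?c = "\<lambda>g. G_class \<phi> n (letter g)"
  interpret G: group ?G by (rule group_presented_group)
  interpret \<epsilon>: group_hom F_grp ?G \<epsilon>
    using \<epsilon>(1) by (simp add: group_hom_def group_hom_axioms_def group_F_grp G.is_group)
  let ?f = "\<lambda>g. if g = gen_t then ?c g else inv\<^bsub>?G\<^esub> (?c g)"
  have tG: "G_t \<phi> n \<in> carrier ?G" using gen_t_G_gens by simp
  have eval: "word_eval ?G ?f w = \<epsilon> (J (F_class w))" if w: "w \<in> words F_gens" for w
  proof -
    have "(\<lambda>p. \<epsilon> (J p)) \<in> hom (presented_group F_gens F_rels) ?G"
      using hom_compose[OF J_hom \<epsilon>(1)[unfolded F_grp_def]] by (simp add: comp_def)
    then have "\<epsilon> (J (F_class w)) = word_eval ?G (\<lambda>g. \<epsilon> (J (F_class (letter g)))) w"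
      unfolding F_class_def using w by (rule presented_group_hom_eval[OF G.is_group])
    also have "\<dots> = word_eval ?G ?f w"
    proof (rule word_eval_cong[OF w])
      fix g assume g: "g \<in> F_gens"
      then have "g \<noteq> gen_t" by (auto simp: F_gens_def)
      then have "J (F_class (letter g)) = inv\<^bsub>F_grp\<^esub> (F_class (letter g))"
        using J_inv[OF g] by (simp add: F_class_def F_grp_def)
      then show "\<epsilon> (J (F_class (letter g))) = ?f g"
        using g \<open>g \<noteq> gen_t\<close> \<epsilon>(2)[of "letter g"] F_class_closed[of "letter g"] by simp
    qed
    finally show ?thesis by simp
  qed
  have "\<exists>J'\<in>hom ?G ?G. \<forall>w\<in>words G_gens. J' (G_class \<phi> n w) = word_eval ?G ?f w"
  proof (rule presented_group_hom_ex[OF G.is_group])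
    show "?f ` G_gens \<subseteq> carrier ?G" by auto
    fix u v assume "(u, v) \<in> G_rels \<phi> n"
    then obtain g where g: "g \<in> F_gens" "u = [(True, gen_t), (True, g), (False, gen_t)]"
      "v \<in> (\<phi> ^^ n) (F_class (letter g))"
      unfolding G_rels_def by blast
    note v = aut_pow_wordE[OF iso g(1,3)]
    have gt: "g \<noteq> gen_t" using g(1) by (auto simp: F_gens_def)
    let ?p = "F_class (letter g)"
    have p: "?p \<in> carrier F_grp" using F_class_closed g(1) by simp
    have Jp: "J ?p \<in> carrier F_grp" using p unfolding F_grp_def by simp
    have \<phi>Jp: "(\<phi> ^^ n) (J ?p) \<in> carrier F_grp"
      by (rule hom_in_carrier[OF aut_pow(1)[OF iso] Jp])
    have c: "inv\<^bsub>?G\<^esub> (?c g) = \<epsilon> (J ?p)"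
      using eval[of "letter g"] g(1) gt F_gens_subset by auto
    have "word_eval ?G ?f v = \<epsilon> (J ((\<phi> ^^ n) ?p))" using eval[OF v(1)] v(2) by simp
    also have "\<dots> = \<epsilon> ((\<phi> ^^ n) (J ?p))" using aut_pow_commutes_J[OF \<phi> p] by simp
    also have "\<dots> = G_t \<phi> n \<otimes>\<^bsub>?G\<^esub> \<epsilon> (J ?p) \<otimes>\<^bsub>?G\<^esub> inv\<^bsub>?G\<^esub> (G_t \<phi> n)"
      unfolding t[OF Jp] using tG \<phi>Jp by (simp add: G.m_assoc)
    also have "\<dots> = word_eval ?G ?f u"
      using tG Jp gt by (simp add: g(2) c G.m_assoc)
    finally show "word_eval ?G ?f u = word_eval ?G ?f v" by simp
  qed
  then obtain J' where J': "J' \<in> hom ?G ?G"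
    "\<forall>w\<in>words G_gens. J' (G_class \<phi> n w) = word_eval ?G ?f w" by blast
  have "side_presentation G_gens (G_rels \<phi> n) J'"
  proof
    show "J' \<in> hom ?G ?G" by (rule J'(1))
    show "J' (?c g) = inv\<^bsub>?G\<^esub> (?c g)" if "g \<in> G_gens" "g \<noteq> gen_t" for g
      using bspec[OF J'(2), of "letter g"] that by simp
    show "J' (?c gen_t) = ?c gen_t" if "gen_t \<in> G_gens"
      using bspec[OF J'(2), of "letter gen_t"] that by simp
  qed
  moreover have "J' (\<epsilon> p) = \<epsilon> (J p)" if p: "p \<in> carrier F_grp" for p
  proof -
    obtain w where w: "w \<in> words F_gens" "p = F_class w" using p by (rule F_classE)
    then show ?thesis
      using \<epsilon>(2) eval bspec[OF J'(2) words_mono[OF w(1) F_gens_subset]] by simp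
  qed
  ultimately show ?thesis by blast
qed

section \<open>The embedding of the polygon groups\<close>

text \<open>On the embedded copy of \<open>Q\<close> the element \<open>p\<close> acts as left
  translation by \<theta> p. Stated for a single \<open>p\<close>, the property can be proved by
  induction from generators.\<close>

definition equivariant_at ::
    "'p monoid \<Rightarrow> 'q monoid \<Rightarrow> ('p \<Rightarrow> nat \<Rightarrow> nat) \<Rightarrow> ('p \<Rightarrow> 'q) \<Rightarrow> ('q \<Rightarrow> nat) \<Rightarrow> 'p \<Rightarrow> bool" where
  "equivariant_at P Q B \<theta> j p \<longleftrightarrow> (\<forall>x\<in>carrier Q. B p (j x) = j (\<theta> p \<otimes>\<^bsub>Q\<^esub> x))"

lemma equivariant_at_group:
  assumes "group P" "group Q" and B: "B \<in> hom P nat_perms" and \<theta>: "\<theta> \<in> hom P Q"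
  shows "equivariant_at P Q B \<theta> j \<one>\<^bsub>P\<^esub>"
    and "p \<in> carrier P \<Longrightarrow> q \<in> carrier P \<Longrightarrow> equivariant_at P Q B \<theta> j p \<Longrightarrow>
      equivariant_at P Q B \<theta> j q \<Longrightarrow> equivariant_at P Q B \<theta> j (p \<otimes>\<^bsub>P\<^esub> q)"
    and "p \<in> carrier P \<Longrightarrow> equivariant_at P Q B \<theta> j p \<Longrightarrow> equivariant_at P Q B \<theta> j (inv\<^bsub>P\<^esub> p)"
proof -
  interpret P: group P by fact
  interpret Q: group Q by fact
  interpret N: group nat_perms by (rule group_BijGroup)
  interpret B: group_hom P nat_perms B
    using B by (simp add: group_hom_def group_hom_axioms_def P.is_group N.is_group)
  interpret \<theta>: group_hom P Q \<theta>
    using \<theta> by (simp add: group_hom_def group_hom_axioms_def P.is_group Q.is_group)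
  have B_bij: "bij (B p)" if "p \<in> carrier P" for p
    using B.hom_closed[OF that] by (simp add: nat_perms_carrier)
  show "equivariant_at P Q B \<theta> j \<one>\<^bsub>P\<^esub>"
    by (simp add: equivariant_at_def nat_perms_one)
  show "equivariant_at P Q B \<theta> j (p \<otimes>\<^bsub>P\<^esub> q)"
    if pq: "p \<in> carrier P" "q \<in> carrier P" "equivariant_at P Q B \<theta> j p" "equivariant_at P Q B \<theta> j q"
    unfolding equivariant_at_def
  proof
    fix x assume x: "x \<in> carrier Q"
    have "B (p \<otimes>\<^bsub>P\<^esub> q) (j x) = B p (B q (j x))"
      using pq(1,2) B_bij by (simp add: nat_perms_mult)
    also have "B q (j x) = j (\<theta> q \<otimes>\<^bsub>Q\<^esub> x)"
      by (rule bspec[OF pq(4)[unfolded equivariant_at_def] x])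
    also have "B p \<dots> = j (\<theta> p \<otimes>\<^bsub>Q\<^esub> (\<theta> q \<otimes>\<^bsub>Q\<^esub> x))"
      using pq(2) x by (intro bspec[OF pq(3)[unfolded equivariant_at_def]]) simp
    finally show "B (p \<otimes>\<^bsub>P\<^esub> q) (j x) = j (\<theta> (p \<otimes>\<^bsub>P\<^esub> q) \<otimes>\<^bsub>Q\<^esub> x)"
      using pq(1,2) x by (simp add: Q.m_assoc)
  qed
  show "equivariant_at P Q B \<theta> j (inv\<^bsub>P\<^esub> p)"
    if p: "p \<in> carrier P" "equivariant_at P Q B \<theta> j p"
    unfolding equivariant_at_def
  proof
    fix x assume x: "x \<in> carrier Q"
    let ?y = "inv\<^bsub>Q\<^esub> (\<theta> p) \<otimes>\<^bsub>Q\<^esub> x"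
    have "B p (j ?y) = j (\<theta> p \<otimes>\<^bsub>Q\<^esub> ?y)"
      using p(1) x by (intro bspec[OF p(2)[unfolded equivariant_at_def]]) simp
    also have "\<theta> p \<otimes>\<^bsub>Q\<^esub> ?y = x" using p(1) x by (simp add: Q.m_assoc[symmetric])
    finally have "(inv\<^bsub>nat_perms\<^esub> (B p)) (j x) = j ?y"
      using nat_perms_inv_apply[OF B_bij[OF p(1)], of "j ?y"] by simp
    then show "B (inv\<^bsub>P\<^esub> p) (j x) = j (\<theta> (inv\<^bsub>P\<^esub> p) \<otimes>\<^bsub>Q\<^esub> x)"
      using p(1) by simp
  qed
qed

locale polygon_pair =
  F: polygon F_gens F_rels J T num side + G: polygon G_gens "G_rels \<phi> n" J' T num side
  for J J' and \<phi> :: "gen gword set \<Rightarrow> gen gword set" and n :: nat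
    and T :: "'v pair_pre_digraph" and num :: "'v \<Rightarrow> nat" and side :: "'v \<Rightarrow> 'v \<Rightarrow> nat" +
  fixes \<epsilon> :: "gen gword set \<Rightarrow> gen gword set" and \<nu> :: "nat \<Rightarrow> nat"
  assumes aut: "\<phi> \<in> iso F_grp F_grp"
    and \<epsilon>_hom: "\<epsilon> \<in> hom F.P G.P" and \<epsilon>_inj: "inj_on \<epsilon> (carrier F.P)"
    and \<epsilon>_class: "w \<in> words F_gens \<Longrightarrow> \<epsilon> (F_class w) = G_class \<phi> n w"
    and \<epsilon>_J: "p \<in> carrier F.P \<Longrightarrow> J' (\<epsilon> p) = \<epsilon> (J p)"
    and \<epsilon>_t: "p \<in> carrier F.P \<Longrightarrow>
      G_t \<phi> n \<otimes>\<^bsub>G.P\<^esub> \<epsilon> p = \<epsilon> ((\<phi> ^^ n) p) \<otimes>\<^bsub>G.P\<^esub> G_t \<phi> n"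
    and \<nu>: "k \<le> card (pverts T) + 1 \<Longrightarrow> \<nu> k < 3 * card (pverts T)"
begin

abbreviation "V \<equiv> V_grp T num side"
abbreviation "W \<equiv> W_grp \<phi> n T num side"
abbreviation "S \<equiv> S_grp \<phi> n T num side \<nu>"
abbreviation "GT \<equiv> GT_grp \<phi> n T num side \<nu>"
abbreviation "t \<equiv> G_t \<phi> n"

sublocale \<epsilon>: group_hom F.P G.P \<epsilon>
  using \<epsilon>_hom by (simp add: group_hom_def group_hom_axioms_def F.P.is_group G.P.is_group)

lemma t_closed: "t \<in> carrier G.P"
  using gen_t_G_gens by simp

lemma pow_closed: "p \<in> carrier F.P \<Longrightarrow> (\<phi> ^^ n) p \<in> carrier F.P"
  using hom_in_carrier[OF aut_pow(1)[OF aut]] unfolding F_grp_def by blast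

lemma conj_\<epsilon>: "p \<in> carrier F.P \<Longrightarrow> t \<otimes>\<^bsub>G.P\<^esub> \<epsilon> p \<otimes>\<^bsub>G.P\<^esub> inv\<^bsub>G.P\<^esub> t = \<epsilon> ((\<phi> ^^ n) p)"
  using t_closed pow_closed by (simp add: \<epsilon>_t G.P.m_assoc)

lemma conj_t_hom: "(\<lambda>k. t \<otimes>\<^bsub>G.P\<^esub> k \<otimes>\<^bsub>G.P\<^esub> inv\<^bsub>G.P\<^esub> t) \<in> hom G.P G.P"
proof (rule homI)
  fix k l assume kl: "k \<in> carrier G.P" "l \<in> carrier G.P"
  have "inv\<^bsub>G.P\<^esub> t \<otimes>\<^bsub>G.P\<^esub> (t \<otimes>\<^bsub>G.P\<^esub> y) = y" if "y \<in> carrier G.P" for y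
    using that t_closed by (simp add: G.P.m_assoc[symmetric])
  then show "t \<otimes>\<^bsub>G.P\<^esub> (k \<otimes>\<^bsub>G.P\<^esub> l) \<otimes>\<^bsub>G.P\<^esub> inv\<^bsub>G.P\<^esub> t =
      t \<otimes>\<^bsub>G.P\<^esub> k \<otimes>\<^bsub>G.P\<^esub> inv\<^bsub>G.P\<^esub> t \<otimes>\<^bsub>G.P\<^esub> (t \<otimes>\<^bsub>G.P\<^esub> l \<otimes>\<^bsub>G.P\<^esub> inv\<^bsub>G.P\<^esub> t)"
    using kl t_closed by (simp add: G.P.m_assoc)
qed (use t_closed in simp)

lemma conj_t_cancel:
  assumes "k \<in> carrier G.P" "l \<in> carrier G.P"
    "t \<otimes>\<^bsub>G.P\<^esub> k \<otimes>\<^bsub>G.P\<^esub> inv\<^bsub>G.P\<^esub> t = t \<otimes>\<^bsub>G.P\<^esub> l \<otimes>\<^bsub>G.P\<^esub> inv\<^bsub>G.P\<^esub> t"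
  shows "k = l"
  using assms t_closed by simp

section \<open>Vertex groups over F inside those over G, and the traces they leave\<close>

definition incl :: "'v \<Rightarrow> (nat \<Rightarrow> gen gword set) \<Rightarrow> nat \<Rightarrow> gen gword set" where
  "incl v h = (\<lambda>j\<in>triple (num v). \<epsilon> (h j))"

lemma incl_hom: "incl v \<in> hom (F.VG v) (G.VG v)"
proof (rule homI)
  show "incl v h \<in> carrier (G.VG v)" if "h \<in> carrier (F.VG v)" for h
    using that by (simp add: vertex_group_closed incl_def)
  show "incl v (g \<otimes>\<^bsub>F.VG v\<^esub> h) = incl v g \<otimes>\<^bsub>G.VG v\<^esub> incl v h"
    if "g \<in> carrier (F.VG v)" "h \<in> carrier (F.VG v)" for g h
    unfolding vertex_group_mult incl_def
    using that by (intro restrict_ext) (simp add: vertex_group_closed)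
qed

lemma incl_inj: "inj_on (incl v) (carrier (F.VG v))"
proof (rule inj_onI)
  fix g h assume gh: "g \<in> carrier (F.VG v)" "h \<in> carrier (F.VG v)" "incl v g = incl v h"
  show "g = h"
  proof (rule extensionalityI[of _ "triple (num v)"])
    show "g j = h j" if "j \<in> triple (num v)" for j
      using gh(1,2) that fun_cong[OF gh(3), of j] inj_onD[OF \<epsilon>_inj]
      by (simp add: incl_def vertex_group_closed)
  qed (use gh in \<open>simp_all add: vertex_group_closed\<close>)
qed

lemma incl_side_hom:
  assumes "p \<in> carrier F.P" "i div 3 = num v"
  shows "incl v (F.side_hom i p) = G.side_hom i (\<epsilon> p)"
  unfolding incl_def F.side_hom_def G.side_hom_def assms(2)
  using assms(1) by (intro restrict_ext) (simp add: \<epsilon>_J)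

text \<open>The coordinate of \<open>G.side_hom i k\<close> at \<open>csucc i\<close> is k itself.
  If the whole tuple comes from F, then so does k, and injectivity of \<open>incl\<close> determines
  the remaining coordinates.\<close>

lemma incl_eq_side_hom:
  assumes "i div 3 = num v" "h \<in> carrier (F.VG v)" "incl v h = G.side_hom i k"
  obtains p where "p \<in> carrier F.P" "k = \<epsilon> p" "h = F.side_hom i p"
proof
  have i: "csucc i \<in> triple (num v)" using assms(1) by (simp add: triple_iff csucc_div)
  show p: "h (csucc i) \<in> carrier F.P" using assms(2) i by (simp add: vertex_group_closed)
  show k: "k = \<epsilon> (h (csucc i))"
    using fun_cong[OF assms(3), of "csucc i"] i by (simp add: G.side_hom_csucc incl_def)
  have "F.side_hom i (h (csucc i)) \<in> carrier (F.VG v)"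
    using hom_in_carrier[OF F.side_hom_hom[of i] p] assms(1) by simp
  then show "h = F.side_hom i (h (csucc i))"
    using inj_onD[OF incl_inj _ assms(2)] assms(3) incl_side_hom[OF p assms(1)] k by simp
qed

text \<open>The partial action of \<open>G\<^sub>i \<times> G\<^sub>j \<times> G\<^sub>k\<close> on a group \<open>Q\<close> under \<open>V\<^sub>T\<close> that is defined only on \<open>F\<^sub>i \<times> F\<^sub>j \<times> F\<^sub>k\<close>.
  The only property of the side subgroups that matters is \<open>B\<^sub>i \<inter> (F\<^sub>i \<times> F\<^sub>j \<times> F\<^sub>k) = A\<^sub>i\<close>
  (lemma \<open>incl_eq_side_hom\<close>): it makes the partial actions agree along edges and stable letters.\<close>

definition trace :: "'q monoid \<Rightarrow> (('v \<times> (nat \<Rightarrow> gen gword set)) gword set \<Rightarrow> 'q) \<Rightarrow>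
    'v \<Rightarrow> (nat \<Rightarrow> gen gword set) \<Rightarrow> 'q \<Rightarrow> 'q \<Rightarrow> bool" where
  "trace Q \<theta> v h x y \<longleftrightarrow>
     (\<exists>g\<in>carrier (F.VG v). h = incl v g \<and> y = \<theta> (F.elem v g) \<otimes>\<^bsub>Q\<^esub> x)"

text \<open>Translations of a group have no fixed points except for the unit, so triviality of
  stabilizers comes down to the vertex group embedding in \<open>Q\<close>. For the last axiom
  injectivity of \<open>incl\<close> is needed as well: only the unit lies over the unit.\<close>

lemma trace_free:
  assumes "group Q" "\<theta> \<in> hom V Q" "v \<in> pverts T"
    and inj: "inj_on (\<lambda>h. \<theta> (F.elem v h)) (carrier (F.VG v))"
  shows "free_partial_action (G.VG v) (carrier Q) (trace Q \<theta> v)"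
proof -
  interpret Q: group Q by fact
  interpret e: group_hom "F.VG v" Q "\<lambda>h. \<theta> (F.elem v h)"
    using hom_compose[OF F.elem_hom[OF assms(3)] assms(2)]
    by (simp add: group_hom_def group_hom_axioms_def group_vertex_group Q.is_group comp_def)
  interpret i: group_hom "F.VG v" "G.VG v" "incl v"
    by (simp add: group_hom_def group_hom_axioms_def group_vertex_group incl_hom)
  have unit: "g = \<one>\<^bsub>F.VG v\<^esub>" if "g \<in> carrier (F.VG v)" "x \<in> carrier Q"
    "x = \<theta> (F.elem v g) \<otimes>\<^bsub>Q\<^esub> x" for g x
  proof -
    have "\<theta> (F.elem v g) = \<one>\<^bsub>Q\<^esub>"
      using that(3)[symmetric] Q.r_cancel_one[OF that(2) e.hom_closed[OF that(1)]] by blast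
    then show ?thesis
      using inj_onD[OF inj _ that(1) e.G.one_closed] e.hom_one by simp
  qed
  show ?thesis
    unfolding free_partial_action_def
  proof (intro conjI ballI impI)
    fix x assume "x \<in> carrier Q"
    then show "trace Q \<theta> v \<one>\<^bsub>G.VG v\<^esub> x x"
      unfolding trace_def using e.hom_one i.hom_one
      by (intro bexI[of _ "\<one>\<^bsub>F.VG v\<^esub>"]) simp_all
  next
    fix g h x y z assume xyz: "x \<in> carrier Q" "trace Q \<theta> v h x y" "trace Q \<theta> v g y z"
    then obtain g0 h0 where 0: "g0 \<in> carrier (F.VG v)" "g = incl v g0" "z = \<theta> (F.elem v g0) \<otimes>\<^bsub>Q\<^esub> y"
      "h0 \<in> carrier (F.VG v)" "h = incl v h0" "y = \<theta> (F.elem v h0) \<otimes>\<^bsub>Q\<^esub> x"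
      unfolding trace_def by blast
    then show "trace Q \<theta> v (g \<otimes>\<^bsub>G.VG v\<^esub> h) x z"
      unfolding trace_def using xyz(1) e.hom_closed[OF 0(1)] e.hom_closed[OF 0(4)]
      by (intro bexI[of _ "g0 \<otimes>\<^bsub>F.VG v\<^esub> h0"]) (simp_all add: Q.m_assoc)
  next
    fix h x y assume xy: "x \<in> carrier Q" "trace Q \<theta> v h x y"
    then obtain h0 where 0: "h0 \<in> carrier (F.VG v)" "h = incl v h0" "y = \<theta> (F.elem v h0) \<otimes>\<^bsub>Q\<^esub> x"
      unfolding trace_def by blast
    then show "trace Q \<theta> v (inv\<^bsub>G.VG v\<^esub> h) y x"
      unfolding trace_def using xy(1) e.hom_closed[OF 0(1)]
      by (intro bexI[of _ "inv\<^bsub>F.VG v\<^esub> h0"]) (simp_all add: Q.m_assoc[symmetric])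
  next
    fix h x assume "x \<in> carrier Q" "trace Q \<theta> v h x x"
    then obtain h0 where 0: "h0 \<in> carrier (F.VG v)" "h = incl v h0" "x = \<theta> (F.elem v h0) \<otimes>\<^bsub>Q\<^esub> x"
      unfolding trace_def by blast
    then have "h0 = \<one>\<^bsub>F.VG v\<^esub>" using unit[OF 0(1) \<open>x \<in> carrier Q\<close>] by blast
    then show "h = \<one>\<^bsub>G.VG v\<^esub>" using 0(2) i.hom_one by simp
  next
    fix x y assume "x \<in> carrier Q" "trace Q \<theta> v \<one>\<^bsub>G.VG v\<^esub> x y"
    then obtain h0 where 0: "h0 \<in> carrier (F.VG v)" "\<one>\<^bsub>G.VG v\<^esub> = incl v h0"
      "y = \<theta> (F.elem v h0) \<otimes>\<^bsub>Q\<^esub> x"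
      unfolding trace_def by blast
    have "incl v h0 = incl v \<one>\<^bsub>F.VG v\<^esub>" unfolding i.hom_one by (rule 0(2)[symmetric])
    then have "h0 = \<one>\<^bsub>F.VG v\<^esub>" by (rule inj_onD[OF incl_inj _ 0(1) e.G.one_closed])
    then show "x = y" unfolding 0(3) using e.hom_one \<open>x \<in> carrier Q\<close> by simp
  qed
qed

text \<open>An amalgamated element that is defined at \<open>u\<close> comes from A_i, and there the
  amalgamation already holds in \<open>V\<^sub>T\<close>. Hence the element is defined at
  \<open>v\<close> too and translates by the same element of \<open>Q\<close>.\<close>

lemma trace_edge:
  assumes "(u, v) \<in> parcs T" "k \<in> carrier G.P" "trace Q \<theta> u (G.side_hom (side u v) k) x y"
  shows "trace Q \<theta> v (G.side_hom (side v u) (J' k)) x y"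
proof -
  obtain g where g: "g \<in> carrier (F.VG u)" "G.side_hom (side u v) k = incl u g"
    "y = \<theta> (F.elem u g) \<otimes>\<^bsub>Q\<^esub> x"
    using assms(3) unfolding trace_def by blast
  obtain p where p: "p \<in> carrier F.P" "k = \<epsilon> p" "g = F.side_hom (side u v) p"
    using incl_eq_side_hom[OF F.side_div[OF assms(1)] g(1) g(2)[symmetric]] .
  note vu = F.arc_reverse[OF assms(1)]
  have Jp: "J p \<in> carrier F.P" using p(1) by simp
  have "G.side_hom (side v u) (J' k) = incl v (F.side_hom (side v u) (J p))"
    using incl_side_hom[OF Jp F.side_div[OF vu]] \<epsilon>_J[OF p(1)] p(2) by simp
  moreover have "y = \<theta> (F.elem v (F.side_hom (side v u) (J p))) \<otimes>\<^bsub>Q\<^esub> x"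
    using g(3) p(3) F.elem_edge[OF assms(1) p(1)] by simp
  moreover have "F.side_hom (side v u) (J p) \<in> carrier (F.VG v)"
    using hom_in_carrier[OF F.side_hom_arc[OF vu] Jp] .
  ultimately show ?thesis unfolding trace_def by blast
qed

lemma trace_edge_iff:
  assumes "(u, v) \<in> parcs T" "k \<in> carrier G.P"
  shows "trace Q \<theta> u (G.side_hom (side u v) k) x y \<longleftrightarrow> trace Q \<theta> v (G.side_hom (side v u) (J' k)) x y"
proof
  show "trace Q \<theta> v (G.side_hom (side v u) (J' k)) x y" if "trace Q \<theta> u (G.side_hom (side u v) k) x y"
    by (rule trace_edge[OF assms that])
  show "trace Q \<theta> u (G.side_hom (side u v) k) x y" if "trace Q \<theta> v (G.side_hom (side v u) (J' k)) x y"
    using trace_edge[OF F.arc_reverse[OF assms(1)] G.J.hom_closed[OF assms(2)] that]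
    unfolding G.J_J[OF assms(2)] .
qed

section \<open>The map from \<open>V\<^sub>T\<close> to \<open>W\<^sub>T\<close> and the actions of
  \<open>W\<^sub>T\<close>\<close>

lemma \<iota>_ex: "\<exists>\<iota>\<in>hom V W. \<forall>v\<in>pverts T. \<forall>h\<in>carrier (F.VG v). \<iota> (F.elem v h) = G.elem v (incl v h)"
proof (rule F.polygon_hom_ex[OF G.PG.is_group])
  show "(\<lambda>h. G.elem v (incl v h)) \<in> hom (F.VG v) W" if "v \<in> pverts T" for v
    using hom_compose[OF incl_hom G.elem_hom[OF that]] by (simp add: comp_def)
  fix u v k assume uv: "(u, v) \<in> parcs T" and k: "k \<in> carrier F.P"
  show "G.elem u (incl u (F.side_hom (side u v) k)) = G.elem v (incl v (F.side_hom (side v u) (J k)))"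
    using incl_side_hom[OF k F.side_div[OF uv]]
      incl_side_hom[OF F.J.hom_closed[OF k] F.side_div[OF F.arc_reverse[OF uv]]]
      G.elem_edge[OF uv \<epsilon>.hom_closed[OF k]] \<epsilon>_J[OF k] by simp
qed

definition \<iota> where
  "\<iota> = (SOME \<iota>. \<iota> \<in> hom V W \<and> (\<forall>v\<in>pverts T. \<forall>h\<in>carrier (F.VG v). \<iota> (F.elem v h) = G.elem v (incl v h)))"

lemma \<iota>_hom: "\<iota> \<in> hom V W"
  and \<iota>_elem: "v \<in> pverts T \<Longrightarrow> h \<in> carrier (F.VG v) \<Longrightarrow> \<iota> (F.elem v h) = G.elem v (incl v h)"
  using someI_ex[OF \<iota>_ex[unfolded Bex_def], folded \<iota>_def] by blast+

sublocale \<iota>: group_hom V W \<iota>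
  using \<iota>_hom by (simp add: group_hom_def group_hom_axioms_def F.PG.is_group G.PG.is_group)

lemma \<iota>_boundary:
  assumes "p \<in> carrier F.P" "i < 3 * card (pverts T)"
  shows "\<iota> (F.boundary i p) = G.boundary i (\<epsilon> p)"
  unfolding F.boundary_def G.boundary_def
  using \<iota>_elem[OF F.vertex_of(1)[OF assms(2)] hom_in_carrier[OF F.side_hom_vertex_of[OF assms(2)] assms(1)]]
    incl_side_hom[OF assms(1) F.vertex_of(2)[OF assms(2), symmetric]] by simp

lemma countable_V: "countable (carrier V)"
  by (rule F.countable_PG) (simp add: F_gens_def)

text \<open>Instances of \<open>Q\<close> are \<open>V\<^sub>T\<close> itself and
  \<open>S\<^sub>T\<^sub>,\<^sub>n\<close>. The last clause says that the action extends the
  translations by \<open>V\<^sub>T\<close>: for vertex elements this is the trace, and vertex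
  elements generate.\<close>

lemma ex_W_action:
  assumes Q: "group Q" "countable (carrier Q)" and \<theta>: "\<theta> \<in> hom V Q"
    and inj: "\<forall>v\<in>pverts T. inj_on (\<lambda>h. \<theta> (F.elem v h)) (carrier (F.VG v))"
  shows "\<exists>act j A. (\<forall>v\<in>pverts T. extends_partial_action (G.VG v) (carrier Q) (trace Q \<theta> v) (act v) j) \<and>
    A \<in> hom W nat_perms \<and> (\<forall>v\<in>pverts T. \<forall>h\<in>carrier (G.VG v). A (G.elem v h) = act v h) \<and>
    (\<forall>p\<in>carrier V. \<forall>x\<in>carrier Q. A (\<iota> p) (j x) = j (\<theta> p \<otimes>\<^bsub>Q\<^esub> x))"
proof -
  interpret Q: group Q by fact
  interpret \<theta>: group_hom V Q \<theta>
    using \<theta> by (simp add: group_hom_def group_hom_axioms_def F.PG.is_group Q.is_group)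
  have "\<exists>act j A. (\<forall>v\<in>pverts T. extends_partial_action (G.VG v) (carrier Q) (trace Q \<theta> v) (act v) j) \<and>
    A \<in> hom W nat_perms \<and> (\<forall>v\<in>pverts T. \<forall>h\<in>carrier (G.VG v). A (G.elem v h) = act v h)"
  proof (rule G.polygon_action[OF _ Q(2)])
    show "countable G_gens" by (simp add: G_gens_def)
    show "free_partial_action (G.VG v) (carrier Q) (trace Q \<theta> v)" if "v \<in> pverts T" for v
      by (rule trace_free[OF Q(1) \<theta> that bspec[OF inj that]])
    show "trace Q \<theta> u (G.side_hom (side u v) k) x y \<longleftrightarrow> trace Q \<theta> v (G.side_hom (side v u) (J' k)) x y"
      if "(u, v) \<in> parcs T" "k \<in> carrier G.P" for u v k x y
      by (rule trace_edge_iff[OF that])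
  qed
  then obtain act j A where act: "(\<forall>v\<in>pverts T.
      extends_partial_action (G.VG v) (carrier Q) (trace Q \<theta> v) (act v) j) \<and>
    A \<in> hom W nat_perms \<and> (\<forall>v\<in>pverts T. \<forall>h\<in>carrier (G.VG v). A (G.elem v h) = act v h)"
    by (elim exE)
  have A\<iota>: "(\<lambda>p. A (\<iota> p)) \<in> hom V nat_perms"
    using hom_compose[OF \<iota>_hom, of A nat_perms] act by (simp add: comp_def)
  note equivariant = equivariant_at_group[OF F.PG.is_group Q(1) A\<iota> \<theta>, where j = j]
  have "equivariant_at V Q (\<lambda>p. A (\<iota> p)) \<theta> j p" if "p \<in> carrier V" for p
    using that
  proof (induction p rule: F.polygon_induct)
    case one
    show ?case by (rule equivariant(1))
  next
    case (mult p q)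
    then show ?case by (rule equivariant(2))
  next
    case (inv p)
    then show ?case by (rule equivariant(3))
  next
    case (elem v g)
    show ?case
      unfolding equivariant_at_def
    proof
      fix x assume x: "x \<in> carrier Q"
      have g: "incl v g \<in> carrier (G.VG v)" using hom_in_carrier[OF incl_hom elem(2)] .
      have y: "\<theta> (F.elem v g) \<otimes>\<^bsub>Q\<^esub> x \<in> carrier Q"
        using \<theta>.hom_closed[OF hom_in_carrier[OF F.elem_hom[OF elem(1)] elem(2)]] x by simp
      have "trace Q \<theta> v (incl v g) x (\<theta> (F.elem v g) \<otimes>\<^bsub>Q\<^esub> x)"
        unfolding trace_def using elem(2) by blast
      then have "act v (incl v g) (j x) = j (\<theta> (F.elem v g) \<otimes>\<^bsub>Q\<^esub> x)"
        using bspec[OF act[THEN conjunct1] elem(1)] g x y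
        unfolding extends_partial_action_def by blast
      moreover have "A (\<iota> (F.elem v g)) = act v (incl v g)"
        using act[THEN conjunct2, THEN conjunct2] elem g by (simp add: \<iota>_elem)
      ultimately show "A (\<iota> (F.elem v g)) (j x) = j (\<theta> (F.elem v g) \<otimes>\<^bsub>Q\<^esub> x)" by simp
    qed
  qed
  then have "\<forall>p\<in>carrier V. \<forall>x\<in>carrier Q. A (\<iota> p) (j x) = j (\<theta> p \<otimes>\<^bsub>Q\<^esub> x)"
    unfolding equivariant_at_def by (rule ballI)
  then show ?thesis
    using act[THEN conjunct1] act[THEN conjunct2, THEN conjunct1]
      act[THEN conjunct2, THEN conjunct2]
    by (intro exI[of _ act] exI[of _ j] exI[of _ A] conjI)
qed

text \<open>The case of the unit in the extension property: equal images mean that the unit relates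
  \<open>x\<close> to \<open>y\<close>, which a free partial action permits only if they
  coincide.\<close>

lemma trace_point_inj:
  assumes "group Q" "\<theta> \<in> hom V Q" "v \<in> pverts T"
    "inj_on (\<lambda>h. \<theta> (F.elem v h)) (carrier (F.VG v))"
    and ext: "extends_partial_action (G.VG v) (carrier Q) (trace Q \<theta> v) act j"
    and x: "x \<in> carrier Q" "y \<in> carrier Q" "j x = j y"
  shows "x = y"
proof -
  interpret VG: group "G.VG v" by (rule group_vertex_group)
  note ext' = ext[unfolded extends_partial_action_def]
  have "act \<one>\<^bsub>G.VG v\<^esub> (j x) = j y"
    using free_action_one[OF ext'[THEN conjunct1], of "j x"] x(3) by (rule HOL.trans)
  then have "trace Q \<theta> v \<one>\<^bsub>G.VG v\<^esub> x y"
    using ext'[THEN conjunct2, THEN conjunct2, rule_format, OF VG.one_closed x(1,2)] by blast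
  moreover have "\<forall>x\<in>carrier Q. \<forall>y\<in>carrier Q. trace Q \<theta> v \<one>\<^bsub>G.VG v\<^esub> x y \<longrightarrow> x = y"
    using trace_free[OF assms(1-4)] unfolding free_partial_action_def by (elim conjE)
  ultimately show ?thesis using x(1,2) by blast
qed

end

section \<open>The multiple HNN extensions\<close>

context polygon_pair
begin

section \<open>Relations and universal properties of the two HNN extensions\<close>

abbreviation "letters \<equiv> stable_letters T"
abbreviation "S_V v \<equiv> S_class \<phi> n T num side \<nu> (letter (Inl v))"
abbreviation "S_r i \<equiv> S_class \<phi> n T num side \<nu> (letter (Inr i))"
abbreviation "GT_W w \<equiv> GT_class \<phi> n T num side \<nu> (letter (Inl w))"
abbreviation "GT_s i \<equiv> GT_class \<phi> n T num side \<nu> (letter (Inr i))"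

lemma \<nu>_0: "\<nu> 0 < 3 * card (pverts T)"
  by (rule \<nu>) simp

lemma \<nu>_stable: "i \<in> letters \<Longrightarrow> \<nu> i < 3 * card (pverts T)"
  by (rule \<nu>) (simp add: stable_letters_def)

lemma group_S: "group S" and group_GT: "group GT"
  unfolding S_grp_def GT_grp_def by (rule group_relative_presentation)+

lemma S_V_hom: "S_V \<in> hom V S"
  unfolding S_grp_def S_class_def by (rule relative_class_Inl_hom[OF F.PG.is_group])

lemma GT_W_hom: "GT_W \<in> hom W GT"
  unfolding GT_grp_def GT_class_def by (rule relative_class_Inl_hom[OF G.PG.is_group])

lemma S_r_closed: "i \<in> letters \<Longrightarrow> S_r i \<in> carrier S"
  unfolding S_grp_def S_class_def by (intro relative_class_closed) (simp add: InrI)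

lemma GT_s_closed: "i \<in> letters \<Longrightarrow> GT_s i \<in> carrier GT"
  unfolding GT_grp_def GT_class_def by (intro relative_class_closed) (simp add: InrI)

lemma S_rels_word_eval:
  fixes Q :: "'q monoid"
  assumes "group Q" "h \<in> hom V Q" "i \<in> letters" "w \<in> words F_gens"
  shows "word_eval Q (case_sum h f)
      (map (\<lambda>(b, g'). (b, Inl (polygon_side_elem F_gens F_rels T num side (\<nu> i) g'))) w)
    = h (F.boundary (\<nu> i) (F_class w))"
proof -
  have hb: "(\<lambda>p. h (F.boundary (\<nu> i) p)) \<in> hom F.P Q"
    using hom_compose[OF F.boundary_hom[OF \<nu>_stable[OF assms(3)]] assms(2)] by (simp add: comp_def)
  have "word_eval Q (case_sum h f)
      (map (\<lambda>(b, g'). (b, Inl (polygon_side_elem F_gens F_rels T num side (\<nu> i) g'))) w)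
    = word_eval Q (\<lambda>g. h (polygon_side_elem F_gens F_rels T num side (\<nu> i) g)) w"
    unfolding word_eval_map by simp
  also have "\<dots> = word_eval Q (\<lambda>g. h (F.boundary (\<nu> i) (word_class F_gens F_rels (letter g)))) w"
    by (rule word_eval_cong[OF assms(4)]) (simp add: F.boundary_letter)
  also have "\<dots> = h (F.boundary (\<nu> i) (F_class w))"
    unfolding F_class_def by (rule presented_group_hom_eval[OF assms(1) hb assms(4), symmetric])
  finally show ?thesis .
qed

text \<open>The relations of the presentation concern two generators; here they are extended to the
  whole associated subgroup, in a form without inverses.\<close>

lemma S_relation:
  assumes i: "i \<in> letters" and p: "p \<in> carrier F.P"
  shows "S_r i \<otimes>\<^bsub>S\<^esub> S_V (F.boundary (\<nu> 0) p) = S_V (F.boundary (\<nu> i) ((\<phi> ^^ n) p)) \<otimes>\<^bsub>S\<^esub> S_r i"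
proof (rule intertwine_generators[OF group_S _ _ S_r_closed[OF i] p])
  interpret S: group S by (rule group_S)
  show h0: "(\<lambda>p. S_V (F.boundary (\<nu> 0) p)) \<in> hom F.P S"
    using hom_compose[OF F.boundary_hom[OF \<nu>_0] S_V_hom] by (simp add: comp_def)
  have bi: "(\<lambda>p. S_V (F.boundary (\<nu> i) p)) \<in> hom F.P S"
    using hom_compose[OF F.boundary_hom[OF \<nu>_stable[OF i]] S_V_hom] by (simp add: comp_def)
  have pow: "\<phi> ^^ n \<in> hom F.P F.P" using aut_pow(1)[OF aut] unfolding F_grp_def .
  show hi: "(\<lambda>p. S_V (F.boundary (\<nu> i) ((\<phi> ^^ n) p))) \<in> hom F.P S"
    using hom_compose[OF pow bi] by (simp add: comp_def)
  fix g assume g: "g \<in> F_gens"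
  obtain w where w: "w \<in> (\<phi> ^^ n) (F_class (letter g))" using aut_pow_ex_word[OF aut g] by blast
  note w' = aut_pow_wordE[OF aut g w]
  let ?u = "[(True, Inr i), (True, Inl (polygon_side_elem F_gens F_rels T num side (\<nu> 0) g)), (False, Inr i)]"
  let ?v = "map (\<lambda>(b, g'). (b, Inl (polygon_side_elem F_gens F_rels T num side (\<nu> i) g'))) w"
  have closed: "polygon_side_elem F_gens F_rels T num side (\<nu> k) g' \<in> carrier V"
    if "\<nu> k < 3 * card (pverts T)" "g' \<in> F_gens" for k g'
    using hom_in_carrier[OF F.boundary_hom[OF that(1)], of "word_class F_gens F_rels (letter g')"]
      that(2) by (simp add: F.boundary_letter)
  have u: "?u \<in> words (carrier V <+> letters)"
    using closed[OF \<nu>_0 g] i by (simp add: InlI InrI)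
  have v: "?v \<in> words (carrier V <+> letters)"
    using w'(1) closed[OF \<nu>_stable[OF i]] by (induction w) (auto simp: InlI)
  have "S_class \<phi> n T num side \<nu> ?u = S_class \<phi> n T num side \<nu> ?v"
    unfolding S_class_def using i g w by (intro relative_class_rel u v) (auto simp: S_rels_def)
  moreover have "S_class \<phi> n T num side \<nu> ?u = S_r i \<otimes>\<^bsub>S\<^esub>
      (S_V (polygon_side_elem F_gens F_rels T num side (\<nu> 0) g) \<otimes>\<^bsub>S\<^esub> (inv\<^bsub>S\<^esub> (S_r i) \<otimes>\<^bsub>S\<^esub> \<one>\<^bsub>S\<^esub>))"
    unfolding S_class_def S_grp_def relative_class_eq_word_eval[OF u] by simp
  moreover have "S_class \<phi> n T num side \<nu> ?v = S_V (F.boundary (\<nu> i) (F_class w))"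
  proof -
    have "S_class \<phi> n T num side \<nu> ?v = word_eval S (case_sum S_V S_r) ?v"
      unfolding S_class_def S_grp_def relative_class_eq_word_eval[OF v]
      by (rule word_eval_cong[OF v]) (auto split: sum.split)
    then show ?thesis using S_rels_word_eval[OF group_S S_V_hom i w'(1)] by simp
  qed
  ultimately have "S_r i \<otimes>\<^bsub>S\<^esub> S_V (polygon_side_elem F_gens F_rels T num side (\<nu> 0) g) =
      S_V (F.boundary (\<nu> i) (F_class w)) \<otimes>\<^bsub>S\<^esub> S_r i"
    using conj_eq_iff_intertwine[OF group_S S_r_closed[OF i]
        hom_in_carrier[OF S_V_hom closed[OF \<nu>_0 g]]
        hom_in_carrier[OF bi F_class_closed[OF w'(1), unfolded F_grp_def]]] by simp
  then show "S_r i \<otimes>\<^bsub>S\<^esub> S_V (F.boundary (\<nu> 0) (word_class F_gens F_rels (letter g))) =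
      S_V (F.boundary (\<nu> i) ((\<phi> ^^ n) (word_class F_gens F_rels (letter g)))) \<otimes>\<^bsub>S\<^esub> S_r i"
    unfolding F.boundary_letter[OF g] w'(2) unfolding F_class_def .
qed

lemma S_hom_ex:
  fixes Q :: "'q monoid"
  assumes Q: "group Q" and h: "h \<in> hom V Q" and f: "\<And>i. i \<in> letters \<Longrightarrow> f i \<in> carrier Q"
    and rel: "\<And>i p. i \<in> letters \<Longrightarrow> p \<in> carrier F.P \<Longrightarrow>
      f i \<otimes>\<^bsub>Q\<^esub> h (F.boundary (\<nu> 0) p) = h (F.boundary (\<nu> i) ((\<phi> ^^ n) p)) \<otimes>\<^bsub>Q\<^esub> f i"
  shows "\<exists>\<Psi>\<in>hom S Q. (\<forall>v\<in>carrier V. \<Psi> (S_V v) = h v) \<and> (\<forall>i\<in>letters. \<Psi> (S_r i) = f i)"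
  unfolding S_grp_def S_class_def
proof (rule relative_presentation_hom_ex[OF F.PG.is_group Q h])
  show "f ` letters \<subseteq> carrier Q" using f by blast
  fix u v assume "(u, v) \<in> S_rels \<phi> n T num side \<nu>"
  then obtain i g w where i: "i \<in> letters" and g: "g \<in> F_gens"
    and w: "w \<in> (\<phi> ^^ n) (F_class (letter g))"
    and u: "u = [(True, Inr i), (True, Inl (polygon_side_elem F_gens F_rels T num side (\<nu> 0) g)), (False, Inr i)]"
    and v: "v = map (\<lambda>(b, g'). (b, Inl (polygon_side_elem F_gens F_rels T num side (\<nu> i) g'))) w"
    unfolding S_rels_def by blast
  note w' = aut_pow_wordE[OF aut g w]
  let ?p = "word_class F_gens F_rels (letter g)"
  have p: "?p \<in> carrier F.P" using g by simp
  have closed: "h (F.boundary (\<nu> 0) ?p) \<in> carrier Q" "h (F.boundary (\<nu> i) ((\<phi> ^^ n) ?p)) \<in> carrier Q"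
    using hom_in_carrier[OF h] hom_in_carrier[OF F.boundary_hom[OF \<nu>_0] p]
      hom_in_carrier[OF F.boundary_hom[OF \<nu>_stable[OF i]] pow_closed[OF p]] by simp_all
  have "word_eval Q (case_sum h f) u = h (F.boundary (\<nu> i) ((\<phi> ^^ n) ?p))"
    unfolding u F.boundary_letter[OF g, symmetric]
    using conj_eq_iff_intertwine[OF Q f[OF i] closed] rel[OF i p] by simp
  then show "word_eval Q (case_sum h f) u = word_eval Q (case_sum h f) v"
    unfolding v S_rels_word_eval[OF Q h i w'(1)] w'(2) by (simp add: F_class_def)
qed

lemma GT_relation:
  assumes i: "i \<in> letters" and k: "k \<in> carrier G.P"
  shows "GT_s i \<otimes>\<^bsub>GT\<^esub> GT_W (G.boundary (\<nu> 0) k) = GT_W (G.boundary (\<nu> i) k) \<otimes>\<^bsub>GT\<^esub> GT_s i"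
proof (rule intertwine_generators[OF group_GT _ _ GT_s_closed[OF i] k])
  show "(\<lambda>p. GT_W (G.boundary (\<nu> 0) p)) \<in> hom G.P GT"
    using hom_compose[OF G.boundary_hom[OF \<nu>_0] GT_W_hom] by (simp add: comp_def)
  show hi: "(\<lambda>p. GT_W (G.boundary (\<nu> i) p)) \<in> hom G.P GT"
    using hom_compose[OF G.boundary_hom[OF \<nu>_stable[OF i]] GT_W_hom] by (simp add: comp_def)
  fix g assume g: "g \<in> G_gens"
  let ?e = "\<lambda>k. polygon_side_elem G_gens (G_rels \<phi> n) T num side (\<nu> k) g"
  let ?u = "[(True, Inr i), (True, Inl (?e 0)), (False, Inr i)]"
  have closed: "?e k \<in> carrier W" if "\<nu> k < 3 * card (pverts T)" for k
    using hom_in_carrier[OF G.boundary_hom[OF that], of "G_class \<phi> n (letter g)"] g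
    by (simp add: G.boundary_letter)
  have u: "?u \<in> words (carrier W <+> letters)" "letter (Inl (?e i)) \<in> words (carrier W <+> letters)"
    using closed[OF \<nu>_0] closed[OF \<nu>_stable[OF i]] i by (simp_all add: InlI InrI)
  have "GT_class \<phi> n T num side \<nu> ?u = GT_W (?e i)"
    unfolding GT_class_def using i g by (intro relative_class_rel u) (auto simp: GT_rels_def)
  moreover have "GT_class \<phi> n T num side \<nu> ?u =
      GT_s i \<otimes>\<^bsub>GT\<^esub> (GT_W (?e 0) \<otimes>\<^bsub>GT\<^esub> (inv\<^bsub>GT\<^esub> (GT_s i) \<otimes>\<^bsub>GT\<^esub> \<one>\<^bsub>GT\<^esub>))"
    unfolding GT_class_def GT_grp_def relative_class_eq_word_eval[OF u(1)] by simp
  ultimately have "GT_s i \<otimes>\<^bsub>GT\<^esub> GT_W (?e 0) = GT_W (?e i) \<otimes>\<^bsub>GT\<^esub> GT_s i"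
    using conj_eq_iff_intertwine[OF group_GT GT_s_closed[OF i] hom_in_carrier[OF GT_W_hom closed[OF \<nu>_0]]
        hom_in_carrier[OF GT_W_hom closed[OF \<nu>_stable[OF i]]]] by simp
  then show "GT_s i \<otimes>\<^bsub>GT\<^esub> GT_W (G.boundary (\<nu> 0) (G_class \<phi> n (letter g))) =
      GT_W (G.boundary (\<nu> i) (G_class \<phi> n (letter g))) \<otimes>\<^bsub>GT\<^esub> GT_s i"
    unfolding G.boundary_letter[OF g] .
qed

lemma GT_hom_ex:
  fixes Q :: "'q monoid"
  assumes Q: "group Q" and h: "h \<in> hom W Q" and f: "\<And>i. i \<in> letters \<Longrightarrow> f i \<in> carrier Q"
    and rel: "\<And>i k. i \<in> letters \<Longrightarrow> k \<in> carrier G.P \<Longrightarrow>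
      f i \<otimes>\<^bsub>Q\<^esub> h (G.boundary (\<nu> 0) k) = h (G.boundary (\<nu> i) k) \<otimes>\<^bsub>Q\<^esub> f i"
  shows "\<exists>\<Psi>\<in>hom GT Q. (\<forall>w\<in>carrier W. \<Psi> (GT_W w) = h w) \<and> (\<forall>i\<in>letters. \<Psi> (GT_s i) = f i)"
  unfolding GT_grp_def GT_class_def
proof (rule relative_presentation_hom_ex[OF G.PG.is_group Q h])
  show "f ` letters \<subseteq> carrier Q" using f by blast
  fix u v assume "(u, v) \<in> GT_rels \<phi> n T num side \<nu>"
  then obtain i g where i: "i \<in> letters" and g: "g \<in> G_gens"
    and u: "u = [(True, Inr i), (True, Inl (polygon_side_elem G_gens (G_rels \<phi> n) T num side (\<nu> 0) g)), (False, Inr i)]"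
    and v: "v = letter (Inl (polygon_side_elem G_gens (G_rels \<phi> n) T num side (\<nu> i) g))"
    unfolding GT_rels_def by blast
  let ?p = "G_class \<phi> n (letter g)"
  have p: "?p \<in> carrier G.P" using g by simp
  have closed: "h (G.boundary (\<nu> 0) ?p) \<in> carrier Q" "h (G.boundary (\<nu> i) ?p) \<in> carrier Q"
    using hom_in_carrier[OF h] hom_in_carrier[OF G.boundary_hom[OF \<nu>_0] p]
      hom_in_carrier[OF G.boundary_hom[OF \<nu>_stable[OF i]] p] by simp_all
  interpret Q: group Q by (rule Q)
  show "word_eval Q (case_sum h f) u = word_eval Q (case_sum h f) v"
    unfolding u v G.boundary_letter[OF g, symmetric]
    using conj_eq_iff_intertwine[OF Q f[OF i] closed] rel[OF i p] closed by simp
qed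

text \<open>With an empty embedded set all trace conditions are vacuous. Free actions of the vertex
  groups therefore glue to an action of \<open>V\<^sub>T\<close>, and permutations for all r_i
  exist. Each vertex group still acts freely, so the action of
  \<open>S\<^sub>T\<^sub>,\<^sub>n\<close> detects its elements.\<close>

lemma vertex_embeds_in_S:
  assumes v: "v \<in> pverts T"
  shows "inj_on (\<lambda>h. S_V (F.elem v h)) (carrier (F.VG v))"
proof -
  interpret N: group nat_perms by (rule group_BijGroup)
  have "\<exists>act (j :: nat \<Rightarrow> nat) A.
    (\<forall>v\<in>pverts T. extends_partial_action (F.VG v) {} (\<lambda>_ _ _. True) (act v) j) \<and>
    A \<in> hom V nat_perms \<and> (\<forall>v\<in>pverts T. \<forall>h\<in>carrier (F.VG v). A (F.elem v h) = act v h)"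
    by (rule F.polygon_action[where D = "\<lambda>_ _ _ _. True"])
      (simp_all add: F_gens_def free_partial_action_def)
  then obtain act A and j :: "nat \<Rightarrow> nat" where act: "(\<forall>v\<in>pverts T. extends_partial_action (F.VG v) {} (\<lambda>_ _ _. True) (act v) j) \<and>
    A \<in> hom V nat_perms \<and> (\<forall>v\<in>pverts T. \<forall>h\<in>carrier (F.VG v). A (F.elem v h) = act v h)"
    by (elim exE)
  note ext = bspec[OF act[THEN conjunct1]]
  have A: "A \<in> hom V nat_perms" using act by (elim conjE)
  have A_elem: "A (F.elem v h) = act v h" if "v \<in> pverts T" "h \<in> carrier (F.VG v)" for v h
    using bspec[OF bspec[OF act[THEN conjunct2, THEN conjunct2] that(1)] that(2)] .
  let ?v0 = "vertex_of T num (\<nu> 0)"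
  have A_boundary: "A (F.boundary i p) = act (vertex_of T num i) (F.side_hom i p)"
    if "i < 3 * card (pverts T)" "p \<in> carrier F.P" for i p
    unfolding F.boundary_def
    by (rule A_elem[OF F.vertex_of(1)[OF that(1)] hom_in_carrier[OF F.side_hom_vertex_of[OF that(1)] that(2)]])
  have "\<forall>i\<in>letters. \<exists>f. bij f \<and> (\<forall>p\<in>carrier F.P. \<forall>m.
      f (act ?v0 (F.side_hom (\<nu> 0) p) m) =
      act (vertex_of T num (\<nu> i)) (F.side_hom (\<nu> i) ((\<phi> ^^ n) p)) (f m))"
  proof
    fix i assume i: "i \<in> letters"
    \<comment> \<open>Injectivity of \<phi>^n keeps the twisted action of F on the side
      \<open>\<nu> i\<close> free.\<close>
    have pow: "\<phi> ^^ n \<in> hom F.P F.P" "inj_on (\<phi> ^^ n) (carrier F.P)"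
      using aut_pow[OF aut, of n] unfolding F_grp_def bij_betw_def by blast+
    have \<beta>: "(\<lambda>p. F.side_hom (\<nu> i) ((\<phi> ^^ n) p)) \<in> hom F.P (F.VG (vertex_of T num (\<nu> i)))"
      using hom_compose[OF pow(1) F.side_hom_vertex_of[OF \<nu>_stable[OF i]]] by (simp add: comp_def)
    have \<beta>_inj: "inj_on (\<lambda>p. F.side_hom (\<nu> i) ((\<phi> ^^ n) p)) (carrier F.P)"
      using comp_inj_on[OF pow(2) F.side_hom_inj] by (simp add: comp_def)
    have "\<exists>f. bij f \<and> (\<forall>p\<in>carrier F.P. \<forall>m.
        f (act ?v0 (F.side_hom (\<nu> 0) p) m) =
        act (vertex_of T num (\<nu> i)) (F.side_hom (\<nu> i) ((\<phi> ^^ n) p)) (f m)) \<and>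
        (\<forall>x\<in>{}. f (j x) = j x)"
      by (rule stable_letter_ex[OF F.P.is_group group_vertex_group group_vertex_group
            ext[OF F.vertex_of(1)[OF \<nu>_0]] ext[OF F.vertex_of(1)[OF \<nu>_stable[OF i]]]
            F.side_hom_vertex_of[OF \<nu>_0] F.side_hom_inj \<beta> \<beta>_inj, where r = "\<lambda>x. x"]) simp_all
    then show "\<exists>f. bij f \<and> (\<forall>p\<in>carrier F.P. \<forall>m.
        f (act ?v0 (F.side_hom (\<nu> 0) p) m) =
        act (vertex_of T num (\<nu> i)) (F.side_hom (\<nu> i) ((\<phi> ^^ n) p)) (f m))"
      by (elim exE conjE) (intro exI conjI)
  qed
  from bchoice[OF this] obtain f where f: "\<forall>i\<in>letters. bij (f i) \<and> (\<forall>p\<in>carrier F.P. \<forall>m.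
      f i (act ?v0 (F.side_hom (\<nu> 0) p) m) =
      act (vertex_of T num (\<nu> i)) (F.side_hom (\<nu> i) ((\<phi> ^^ n) p)) (f i m))"
    by (elim exE)
  have "\<exists>\<Psi>\<in>hom S nat_perms. (\<forall>v\<in>carrier V. \<Psi> (S_V v) = A v) \<and> (\<forall>i\<in>letters. \<Psi> (S_r i) = f i)"
  proof (rule S_hom_ex[OF N.is_group A])
    show f_closed: "f i \<in> carrier nat_perms" if "i \<in> letters" for i
      using bspec[OF f that] by (simp add: nat_perms_carrier)
    fix i p assume i: "i \<in> letters" and p: "p \<in> carrier F.P"
    show "f i \<otimes>\<^bsub>nat_perms\<^esub> A (F.boundary (\<nu> 0) p) =
        A (F.boundary (\<nu> i) ((\<phi> ^^ n) p)) \<otimes>\<^bsub>nat_perms\<^esub> f i"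
    proof (rule nat_perms_intertwine[OF f_closed[OF i]])
      show "A (F.boundary (\<nu> 0) p) \<in> carrier nat_perms"
        by (rule hom_in_carrier[OF A hom_in_carrier[OF F.boundary_hom[OF \<nu>_0] p]])
      show "A (F.boundary (\<nu> i) ((\<phi> ^^ n) p)) \<in> carrier nat_perms"
        by (rule hom_in_carrier[OF A hom_in_carrier[OF F.boundary_hom[OF \<nu>_stable[OF i]] pow_closed[OF p]]])
      show "f i (A (F.boundary (\<nu> 0) p) m) = A (F.boundary (\<nu> i) ((\<phi> ^^ n) p)) (f i m)" for m
        unfolding A_boundary[OF \<nu>_0 p] A_boundary[OF \<nu>_stable[OF i] pow_closed[OF p]]
        by (rule bspec[OF conjunct2[OF bspec[OF f i]] p, rule_format])
    qed
  qed
  then obtain \<Psi> where \<Psi>: "\<forall>v\<in>carrier V. \<Psi> (S_V v) = A v" by (elim bexE conjE)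
  have \<Psi>_elem: "\<Psi> (S_V (F.elem v h)) = act v h" if "h \<in> carrier (F.VG v)" for h
    using bspec[OF \<Psi> hom_in_carrier[OF F.elem_hom[OF v] that]] A_elem[OF v that] by (rule HOL.trans)
  have free: "free_action (F.VG v) (act v)"
    using ext[OF v] unfolding extends_partial_action_def by (rule conjunct1)
  show ?thesis
  proof (rule inj_onI)
    fix g h assume gh: "g \<in> carrier (F.VG v)" "h \<in> carrier (F.VG v)"
      and eq: "S_V (F.elem v g) = S_V (F.elem v h)"
    have "act v g = act v h" using \<Psi>_elem[OF gh(1)] \<Psi>_elem[OF gh(2)] eq by simp
    then show "g = h" by (rule free_action_inj[OF group_vertex_group free gh])
  qed
qed

lemma vertex_embeds_in_V:
  "v \<in> pverts T \<Longrightarrow> inj_on (F.elem v) (carrier (F.VG v))"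
  using vertex_embeds_in_S by (auto simp: inj_on_def)

lemma ex_vertex: "\<exists>v. v \<in> pverts T"
  using F.vertex_of(1)[OF \<nu>_0] by blast

text \<open>For Q = \<open>V\<^sub>T\<close> the action of \<open>W\<^sub>T\<close> restricts along
  \<iota> to left translation. Applied to the point of the unit, \<iota> p yields
  \<open>j p\<close>, from which p is recovered.\<close>

lemma \<iota>_inj: "inj_on \<iota> (carrier V)"
proof -
  have id: "(\<lambda>p. p) \<in> hom V V" by (simp add: hom_def)
  have embeds: "\<forall>v\<in>pverts T. inj_on (\<lambda>h. F.elem v h) (carrier (F.VG v))"
    by (rule ballI) (rule vertex_embeds_in_V)
  obtain act j A where act: "(\<forall>v\<in>pverts T.
      extends_partial_action (G.VG v) (carrier V) (trace V (\<lambda>p. p) v) (act v) j) \<and>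
    A \<in> hom W nat_perms \<and> (\<forall>v\<in>pverts T. \<forall>h\<in>carrier (G.VG v). A (G.elem v h) = act v h) \<and>
    (\<forall>p\<in>carrier V. \<forall>x\<in>carrier V. A (\<iota> p) (j x) = j (p \<otimes>\<^bsub>V\<^esub> x))"
    using ex_W_action[OF F.PG.is_group countable_V id embeds] by (elim exE)
  obtain v where v: "v \<in> pverts T" using ex_vertex by blast
  show ?thesis
  proof (rule inj_onI)
    fix p q assume pq: "p \<in> carrier V" "q \<in> carrier V" and eq: "\<iota> p = \<iota> q"
    note A = act[THEN conjunct2, THEN conjunct2, THEN conjunct2, rule_format]
    have "j p = j q"
      using A[OF pq(1) F.PG.one_closed] A[OF pq(2) F.PG.one_closed] eq pq by simp
    then show "p = q"
      by (rule trace_point_inj[OF F.PG.is_group id v vertex_embeds_in_V[OF v]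
            bspec[OF act[THEN conjunct1] v] pq])
  qed
qed

section \<open>The homomorphism between the HNN extensions and its injectivity\<close>

lemma countable_S: "countable (carrier S)"
  unfolding S_grp_def relative_presentation_def
  by (rule countable_presented_group) (use countable_V in auto)

text \<open>The compatibility needed for u_i. An element k = \<epsilon> p satisfies t k t^-1 =
  \<epsilon>(\<phi>^n p), and the relation r_i a = \<phi>^n(a) r_i carries the translation on the
  side \<open>\<nu> 0\<close> to the one on the side \<open>\<nu> i\<close>.\<close>

lemma trace_stable:
  assumes i: "i \<in> letters" and k: "k \<in> carrier G.P" and xy: "x \<in> carrier S" "y \<in> carrier S"
  shows "trace S S_V (vertex_of T num (\<nu> 0)) (G.side_hom (\<nu> 0) k) x y \<longleftrightarrow>
    trace S S_V (vertex_of T num (\<nu> i)) (G.side_hom (\<nu> i) (t \<otimes>\<^bsub>G.P\<^esub> k \<otimes>\<^bsub>G.P\<^esub> inv\<^bsub>G.P\<^esub> t))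
      (S_r i \<otimes>\<^bsub>S\<^esub> x) (S_r i \<otimes>\<^bsub>S\<^esub> y)"
    (is "?L \<longleftrightarrow> ?R")
proof -
  interpret S: group S by (rule group_S)
  note r = S_r_closed[OF i]
  note v0 = F.vertex_of[OF \<nu>_0] and vi = F.vertex_of[OF \<nu>_stable[OF i]]
  have b0: "S_V (F.boundary (\<nu> 0) p) \<in> carrier S" if "p \<in> carrier F.P" for p
    by (rule hom_in_carrier[OF S_V_hom hom_in_carrier[OF F.boundary_hom[OF \<nu>_0] that]])
  have bi: "S_V (F.boundary (\<nu> i) p) \<in> carrier S" if "p \<in> carrier F.P" for p
    by (rule hom_in_carrier[OF S_V_hom hom_in_carrier[OF F.boundary_hom[OF \<nu>_stable[OF i]] that]])
  have move: "S_r i \<otimes>\<^bsub>S\<^esub> (S_V (F.boundary (\<nu> 0) p) \<otimes>\<^bsub>S\<^esub> x) =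
      S_V (F.boundary (\<nu> i) ((\<phi> ^^ n) p)) \<otimes>\<^bsub>S\<^esub> (S_r i \<otimes>\<^bsub>S\<^esub> x)" if p: "p \<in> carrier F.P" for p
    using S_relation[OF i p] r b0[OF p] bi[OF pow_closed[OF p]] xy(1)
    by (simp add: S.m_assoc[symmetric])
  show ?thesis
  proof
    assume ?L
    then obtain g where g: "g \<in> carrier (F.VG (vertex_of T num (\<nu> 0)))"
      "G.side_hom (\<nu> 0) k = incl (vertex_of T num (\<nu> 0)) g"
      "y = S_V (F.elem (vertex_of T num (\<nu> 0)) g) \<otimes>\<^bsub>S\<^esub> x"
      unfolding trace_def by blast
    obtain p where p: "p \<in> carrier F.P" "k = \<epsilon> p" "g = F.side_hom (\<nu> 0) p"
      using incl_eq_side_hom[OF v0(2)[symmetric] g(1) g(2)[symmetric]] .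
    have "G.side_hom (\<nu> i) (t \<otimes>\<^bsub>G.P\<^esub> k \<otimes>\<^bsub>G.P\<^esub> inv\<^bsub>G.P\<^esub> t) =
        incl (vertex_of T num (\<nu> i)) (F.side_hom (\<nu> i) ((\<phi> ^^ n) p))"
      unfolding p(2) conj_\<epsilon>[OF p(1)] incl_side_hom[OF pow_closed[OF p(1)] vi(2)[symmetric]] ..
    moreover have "S_r i \<otimes>\<^bsub>S\<^esub> y =
        S_V (F.elem (vertex_of T num (\<nu> i)) (F.side_hom (\<nu> i) ((\<phi> ^^ n) p))) \<otimes>\<^bsub>S\<^esub> (S_r i \<otimes>\<^bsub>S\<^esub> x)"
      using move[OF p(1)] unfolding g(3) p(3) F.boundary_def .
    moreover have "F.side_hom (\<nu> i) ((\<phi> ^^ n) p) \<in> carrier (F.VG (vertex_of T num (\<nu> i)))"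
      by (rule hom_in_carrier[OF F.side_hom_vertex_of[OF \<nu>_stable[OF i]] pow_closed[OF p(1)]])
    ultimately show ?R unfolding trace_def by blast
  next
    assume ?R
    then obtain g where g: "g \<in> carrier (F.VG (vertex_of T num (\<nu> i)))"
      "G.side_hom (\<nu> i) (t \<otimes>\<^bsub>G.P\<^esub> k \<otimes>\<^bsub>G.P\<^esub> inv\<^bsub>G.P\<^esub> t) = incl (vertex_of T num (\<nu> i)) g"
      "S_r i \<otimes>\<^bsub>S\<^esub> y = S_V (F.elem (vertex_of T num (\<nu> i)) g) \<otimes>\<^bsub>S\<^esub> (S_r i \<otimes>\<^bsub>S\<^esub> x)"
      unfolding trace_def by blast
    obtain q where q: "q \<in> carrier F.P" "t \<otimes>\<^bsub>G.P\<^esub> k \<otimes>\<^bsub>G.P\<^esub> inv\<^bsub>G.P\<^esub> t = \<epsilon> q"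
      "g = F.side_hom (\<nu> i) q"
      using incl_eq_side_hom[OF vi(2)[symmetric] g(1) g(2)[symmetric]] .
    \<comment> \<open>Here \<phi>^n has to be onto: if t k t^-1 lies in F, then so does k.\<close>
    obtain p where p: "p \<in> carrier F.P" "q = (\<phi> ^^ n) p"
      using q(1) aut_pow(2)[OF aut, of n] unfolding F_grp_def bij_betw_def by blast
    have "k = \<epsilon> p"
      by (rule conj_t_cancel[OF k \<epsilon>.hom_closed[OF p(1)]]) (simp add: q(2) conj_\<epsilon>[OF p(1)] p(2))
    then have "G.side_hom (\<nu> 0) k = incl (vertex_of T num (\<nu> 0)) (F.side_hom (\<nu> 0) p)"
      using incl_side_hom[OF p(1) v0(2)[symmetric]] by simp
    moreover have "S_r i \<otimes>\<^bsub>S\<^esub> y = S_r i \<otimes>\<^bsub>S\<^esub> (S_V (F.boundary (\<nu> 0) p) \<otimes>\<^bsub>S\<^esub> x)"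
      unfolding move[OF p(1)] using g(3) unfolding q(3) p(2) F.boundary_def .
    then have "y = S_V (F.boundary (\<nu> 0) p) \<otimes>\<^bsub>S\<^esub> x"
      using r xy b0[OF p(1)] by simp
    then have "y = S_V (F.elem (vertex_of T num (\<nu> 0)) (F.side_hom (\<nu> 0) p)) \<otimes>\<^bsub>S\<^esub> x"
      unfolding F.boundary_def .
    moreover have "F.side_hom (\<nu> 0) p \<in> carrier (F.VG (vertex_of T num (\<nu> 0)))"
      by (rule hom_in_carrier[OF F.side_hom_vertex_of[OF \<nu>_0] p(1)])
    ultimately show ?L unfolding trace_def by blast
  qed
qed

lemma twisted_letter_closed:
  assumes "i \<in> letters"
  shows "GT_W (G.boundary (\<nu> i) t) \<in> carrier GT" "G.boundary (\<nu> i) t \<in> carrier W"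
  using hom_in_carrier[OF G.boundary_hom[OF \<nu>_stable[OF assms]] t_closed]
    hom_in_carrier[OF GT_W_hom] by blast+

text \<open>The letter s_i moves the side \<open>\<nu> 0\<close> to the side \<open>\<nu> i\<close>,
  and c conjugates the result by t. On F this is \<phi>^n, so c s_i satisfies the relations of
  r_i.\<close>

lemma \<Phi>_ex:
  "\<exists>\<Phi>\<in>hom S GT. (\<forall>v\<in>carrier V. \<Phi> (S_V v) = GT_W (\<iota> v)) \<and>
    (\<forall>i\<in>letters. \<Phi> (S_r i) = GT_W (G.boundary (\<nu> i) t) \<otimes>\<^bsub>GT\<^esub> GT_s i)"
proof (rule S_hom_ex[OF group_GT])
  interpret GT: group GT by (rule group_GT)
  show "(\<lambda>v. GT_W (\<iota> v)) \<in> hom V GT"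
    using hom_compose[OF \<iota>_hom GT_W_hom] by (simp add: comp_def)
  show "GT_W (G.boundary (\<nu> i) t) \<otimes>\<^bsub>GT\<^esub> GT_s i \<in> carrier GT" if "i \<in> letters" for i
    using twisted_letter_closed(1)[OF that] GT_s_closed[OF that] by simp
  fix i p assume i: "i \<in> letters" and p: "p \<in> carrier F.P"
  have bhom: "(\<lambda>k. GT_W (G.boundary (\<nu> i) k)) \<in> hom G.P GT"
    using hom_compose[OF G.boundary_hom[OF \<nu>_stable[OF i]] GT_W_hom] by (simp add: comp_def)
  have b0: "GT_W (G.boundary (\<nu> 0) (\<epsilon> p)) \<in> carrier GT"
    by (rule hom_in_carrier[OF GT_W_hom hom_in_carrier[OF G.boundary_hom[OF \<nu>_0] \<epsilon>.hom_closed[OF p]]])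
  note closed = twisted_letter_closed(1)[OF i] GT_s_closed[OF i] b0
    hom_in_carrier[OF bhom \<epsilon>.hom_closed[OF p]] hom_in_carrier[OF bhom \<epsilon>.hom_closed[OF pow_closed[OF p]]]
  have "GT_W (G.boundary (\<nu> i) t) \<otimes>\<^bsub>GT\<^esub> GT_s i \<otimes>\<^bsub>GT\<^esub> GT_W (G.boundary (\<nu> 0) (\<epsilon> p)) =
      GT_W (G.boundary (\<nu> i) t) \<otimes>\<^bsub>GT\<^esub> (GT_W (G.boundary (\<nu> i) (\<epsilon> p)) \<otimes>\<^bsub>GT\<^esub> GT_s i)"
    using closed GT_relation[OF i \<epsilon>.hom_closed[OF p]] by (simp add: GT.m_assoc)
  also have "\<dots> = (GT_W (G.boundary (\<nu> i) t) \<otimes>\<^bsub>GT\<^esub> GT_W (G.boundary (\<nu> i) (\<epsilon> p))) \<otimes>\<^bsub>GT\<^esub> GT_s i"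
    using closed by (simp add: GT.m_assoc)
  also have "GT_W (G.boundary (\<nu> i) t) \<otimes>\<^bsub>GT\<^esub> GT_W (G.boundary (\<nu> i) (\<epsilon> p)) =
      GT_W (G.boundary (\<nu> i) (\<epsilon> ((\<phi> ^^ n) p))) \<otimes>\<^bsub>GT\<^esub> GT_W (G.boundary (\<nu> i) t)"
    unfolding hom_mult[OF bhom t_closed \<epsilon>.hom_closed[OF p], symmetric] \<epsilon>_t[OF p]
    by (rule hom_mult[OF bhom \<epsilon>.hom_closed[OF pow_closed[OF p]] t_closed])
  finally show "GT_W (G.boundary (\<nu> i) t) \<otimes>\<^bsub>GT\<^esub> GT_s i \<otimes>\<^bsub>GT\<^esub> GT_W (\<iota> (F.boundary (\<nu> 0) p)) =
      GT_W (\<iota> (F.boundary (\<nu> i) ((\<phi> ^^ n) p))) \<otimes>\<^bsub>GT\<^esub> (GT_W (G.boundary (\<nu> i) t) \<otimes>\<^bsub>GT\<^esub> GT_s i)"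
    unfolding \<iota>_boundary[OF p \<nu>_0] \<iota>_boundary[OF pow_closed[OF p] \<nu>_stable[OF i]]
    using closed by (simp add: GT.m_assoc)
qed

text \<open>An action of \<open>G\<^sub>T\<^sub>,\<^sub>n\<close> is constructed whose restriction
  along \<Phi> is left translation on an embedded copy of \<open>S\<^sub>T\<^sub>,\<^sub>n\<close>;
  a translation is determined by the image of the unit.\<close>

lemma \<Phi>_inj:
  assumes \<Phi>: "\<Phi> \<in> hom S GT" "\<And>v. v \<in> carrier V \<Longrightarrow> \<Phi> (S_V v) = GT_W (\<iota> v)"
    "\<And>i. i \<in> letters \<Longrightarrow> \<Phi> (S_r i) = GT_W (G.boundary (\<nu> i) t) \<otimes>\<^bsub>GT\<^esub> GT_s i"
  shows "inj_on \<Phi> (carrier S)"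
proof -
  interpret S: group S by (rule group_S)
  interpret N: group nat_perms by (rule group_BijGroup)
  have embeds: "\<forall>v\<in>pverts T. inj_on (\<lambda>h. S_V (F.elem v h)) (carrier (F.VG v))"
    by (rule ballI) (rule vertex_embeds_in_S)
  obtain act j A where act: "(\<forall>v\<in>pverts T.
      extends_partial_action (G.VG v) (carrier S) (trace S S_V v) (act v) j) \<and>
    A \<in> hom W nat_perms \<and> (\<forall>v\<in>pverts T. \<forall>h\<in>carrier (G.VG v). A (G.elem v h) = act v h) \<and>
    (\<forall>p\<in>carrier V. \<forall>x\<in>carrier S. A (\<iota> p) (j x) = j (S_V p \<otimes>\<^bsub>S\<^esub> x))"
    using ex_W_action[OF group_S countable_S S_V_hom embeds] by (elim exE)
  note ext = bspec[OF act[THEN conjunct1]]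
  have A: "A \<in> hom W nat_perms" using act by (elim conjE)
  interpret A: group_hom W nat_perms A
    using A by (simp add: group_hom_def group_hom_axioms_def G.PG.is_group N.is_group)
  have A_elem: "A (G.elem v h) = act v h" if "v \<in> pverts T" "h \<in> carrier (G.VG v)" for v h
    using bspec[OF bspec[OF act[THEN conjunct2, THEN conjunct2, THEN conjunct1] that(1)] that(2)] .
  have A_\<iota>: "A (\<iota> p) (j x) = j (S_V p \<otimes>\<^bsub>S\<^esub> x)" if "p \<in> carrier V" "x \<in> carrier S" for p x
    using bspec[OF bspec[OF act[THEN conjunct2, THEN conjunct2, THEN conjunct2] that(1)] that(2)] .
  let ?v0 = "vertex_of T num (\<nu> 0)"
  \<comment> \<open>Conjugation by u_i = c s_i composes the untwisted passage between the sides with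
    conjugation by t, so \<open>f i\<close> has to intertwine k with t k t^-1.\<close>
  let ?c = "\<lambda>k. t \<otimes>\<^bsub>G.P\<^esub> k \<otimes>\<^bsub>G.P\<^esub> inv\<^bsub>G.P\<^esub> t"
  have c_closed: "?c k \<in> carrier G.P" if "k \<in> carrier G.P" for k
    using that t_closed by simp
  have A_boundary: "A (G.boundary i k) = act (vertex_of T num i) (G.side_hom i k)"
    if "i < 3 * card (pverts T)" "k \<in> carrier G.P" for i k
    unfolding G.boundary_def
    by (rule A_elem[OF G.vertex_of(1)[OF that(1)] hom_in_carrier[OF G.side_hom_vertex_of[OF that(1)] that(2)]])
  have "\<forall>i\<in>letters. \<exists>f. bij f \<and> (\<forall>k\<in>carrier G.P. \<forall>m. f (act ?v0 (G.side_hom (\<nu> 0) k) m) =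
      act (vertex_of T num (\<nu> i)) (G.side_hom (\<nu> i) (?c k)) (f m)) \<and>
      (\<forall>x\<in>carrier S. f (j x) = j (S_r i \<otimes>\<^bsub>S\<^esub> x))"
  proof
    fix i assume i: "i \<in> letters"
    have \<beta>: "(\<lambda>k. G.side_hom (\<nu> i) (?c k)) \<in> hom G.P (G.VG (vertex_of T num (\<nu> i)))"
      using hom_compose[OF conj_t_hom G.side_hom_vertex_of[OF \<nu>_stable[OF i]]] by (simp add: comp_def)
    have c_inj: "inj_on ?c (carrier G.P)" by (rule inj_onI) (rule conj_t_cancel)
    have \<beta>_inj: "inj_on (\<lambda>k. G.side_hom (\<nu> i) (?c k)) (carrier G.P)"
      using comp_inj_on[OF c_inj G.side_hom_inj] by (simp add: comp_def)
    show "\<exists>f. bij f \<and> (\<forall>k\<in>carrier G.P. \<forall>m. f (act ?v0 (G.side_hom (\<nu> 0) k) m) =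
        act (vertex_of T num (\<nu> i)) (G.side_hom (\<nu> i) (?c k)) (f m)) \<and>
        (\<forall>x\<in>carrier S. f (j x) = j (S_r i \<otimes>\<^bsub>S\<^esub> x))"
    proof (rule stable_letter_ex[where \<alpha> = "G.side_hom (\<nu> 0)" and \<beta> = "\<lambda>k. G.side_hom (\<nu> i) (?c k)"
          and r = "\<lambda>x. S_r i \<otimes>\<^bsub>S\<^esub> x" and j = j,
          OF G.P.is_group group_vertex_group group_vertex_group
            ext[OF G.vertex_of(1)[OF \<nu>_0]] ext[OF G.vertex_of(1)[OF \<nu>_stable[OF i]]]
            G.side_hom_vertex_of[OF \<nu>_0] G.side_hom_inj \<beta> \<beta>_inj])
      show "S_r i \<otimes>\<^bsub>S\<^esub> x \<in> carrier S" if "x \<in> carrier S" for x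
        by (rule S.m_closed[OF S_r_closed[OF i] that])
      show "trace S S_V (vertex_of T num (\<nu> 0)) (G.side_hom (\<nu> 0) k) x y \<longleftrightarrow>
          trace S S_V (vertex_of T num (\<nu> i)) (G.side_hom (\<nu> i) (?c k)) (S_r i \<otimes>\<^bsub>S\<^esub> x) (S_r i \<otimes>\<^bsub>S\<^esub> y)"
        if "k \<in> carrier G.P" "x \<in> carrier S" "y \<in> carrier S" for k x y
        by (rule trace_stable[OF i that])
    qed
  qed
  from bchoice[OF this] obtain f where f: "\<forall>i\<in>letters. bij (f i) \<and> (\<forall>k\<in>carrier G.P. \<forall>m.
      f i (act ?v0 (G.side_hom (\<nu> 0) k) m) =
      act (vertex_of T num (\<nu> i)) (G.side_hom (\<nu> i) (?c k)) (f i m)) \<and>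
      (\<forall>x\<in>carrier S. f i (j x) = j (S_r i \<otimes>\<^bsub>S\<^esub> x))"
    by (elim exE)
  have f_closed: "f i \<in> carrier nat_perms" if "i \<in> letters" for i
    using bspec[OF f that] by (simp add: nat_perms_carrier)
  let ?d = "\<lambda>i. A (G.boundary (\<nu> i) t)"
  have d_closed: "?d i \<in> carrier nat_perms" if "i \<in> letters" for i
    using twisted_letter_closed(2)[OF that] by simp
  \<comment> \<open>Since s_i = c^-1 u_i, the permutation for s_i is \<open>f i\<close> followed by
    the inverse of the action of c.\<close>
  have "\<exists>\<Psi>\<in>hom GT nat_perms. (\<forall>w\<in>carrier W. \<Psi> (GT_W w) = A w) \<and>
      (\<forall>i\<in>letters. \<Psi> (GT_s i) = inv\<^bsub>nat_perms\<^esub> (?d i) \<otimes>\<^bsub>nat_perms\<^esub> f i)"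
  proof (rule GT_hom_ex[OF N.is_group A])
    show "inv\<^bsub>nat_perms\<^esub> (?d i) \<otimes>\<^bsub>nat_perms\<^esub> f i \<in> carrier nat_perms" if "i \<in> letters" for i
      using d_closed[OF that] f_closed[OF that] by simp
    fix i k assume i: "i \<in> letters" and k: "k \<in> carrier G.P"
    let ?a0 = "A (G.boundary (\<nu> 0) k)" and ?ai = "A (G.boundary (\<nu> i) k)"
    have bi: "G.boundary (\<nu> i) \<in> hom G.P W" by (rule G.boundary_hom[OF \<nu>_stable[OF i]])
    have Abi: "(\<lambda>k. A (G.boundary (\<nu> i) k)) \<in> hom G.P nat_perms"
      using hom_compose[OF bi A] by (simp add: comp_def)
    interpret Abi: group_hom G.P nat_perms "\<lambda>k. A (G.boundary (\<nu> i) k)"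
      using Abi by (simp add: group_hom_def group_hom_axioms_def G.P.is_group N.is_group)
    have a0: "?a0 \<in> carrier nat_perms"
      by (rule hom_in_carrier[OF A hom_in_carrier[OF G.boundary_hom[OF \<nu>_0] k]])
    have ai: "?ai \<in> carrier nat_perms" by (rule Abi.hom_closed[OF k])
    have ac: "A (G.boundary (\<nu> i) (?c k)) \<in> carrier nat_perms" by (rule Abi.hom_closed[OF c_closed[OF k]])
    have "f i \<otimes>\<^bsub>nat_perms\<^esub> ?a0 = A (G.boundary (\<nu> i) (?c k)) \<otimes>\<^bsub>nat_perms\<^esub> f i"
    proof (rule nat_perms_intertwine[OF f_closed[OF i] a0 ac])
      show "f i (?a0 m) = A (G.boundary (\<nu> i) (?c k)) (f i m)" for m
        unfolding A_boundary[OF \<nu>_0 k] A_boundary[OF \<nu>_stable[OF i] c_closed[OF k]]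
        by (rule bspec[OF conjunct1[OF conjunct2[OF bspec[OF f i]]] k, rule_format])
    qed
    \<comment> \<open>The twist by t appears as conjugation by the permutation of c, which the
      inverse factor in the action of s_i cancels.\<close>
    also have "A (G.boundary (\<nu> i) (?c k)) = ?d i \<otimes>\<^bsub>nat_perms\<^esub> ?ai \<otimes>\<^bsub>nat_perms\<^esub> inv\<^bsub>nat_perms\<^esub> (?d i)"
      using k t_closed Abi.hom_mult[of "t \<otimes>\<^bsub>G.P\<^esub> k" "inv\<^bsub>G.P\<^esub> t"] Abi.hom_mult[of t k]
        Abi.hom_inv[of t] by simp
    finally have "inv\<^bsub>nat_perms\<^esub> (?d i) \<otimes>\<^bsub>nat_perms\<^esub> (f i \<otimes>\<^bsub>nat_perms\<^esub> ?a0) =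
        inv\<^bsub>nat_perms\<^esub> (?d i) \<otimes>\<^bsub>nat_perms\<^esub>
        (?d i \<otimes>\<^bsub>nat_perms\<^esub> ?ai \<otimes>\<^bsub>nat_perms\<^esub> inv\<^bsub>nat_perms\<^esub> (?d i) \<otimes>\<^bsub>nat_perms\<^esub> f i)"
      by (rule arg_cong)
    also have "\<dots> = ?ai \<otimes>\<^bsub>nat_perms\<^esub> (inv\<^bsub>nat_perms\<^esub> (?d i) \<otimes>\<^bsub>nat_perms\<^esub> f i)"
    proof -
      have "inv\<^bsub>nat_perms\<^esub> (?d i) \<otimes>\<^bsub>nat_perms\<^esub> (?d i \<otimes>\<^bsub>nat_perms\<^esub> y) = y" if "y \<in> carrier nat_perms" for y
        using that d_closed[OF i] by (simp add: N.m_assoc[symmetric])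
      then show ?thesis using d_closed[OF i] f_closed[OF i] ai by (simp add: N.m_assoc)
    qed
    finally show "inv\<^bsub>nat_perms\<^esub> (?d i) \<otimes>\<^bsub>nat_perms\<^esub> f i \<otimes>\<^bsub>nat_perms\<^esub> ?a0 =
        ?ai \<otimes>\<^bsub>nat_perms\<^esub> (inv\<^bsub>nat_perms\<^esub> (?d i) \<otimes>\<^bsub>nat_perms\<^esub> f i)"
      using d_closed[OF i] f_closed[OF i] ai a0 by (simp add: N.m_assoc)
  qed
  then obtain \<Psi> where \<Psi>: "\<Psi> \<in> hom GT nat_perms" "\<forall>w\<in>carrier W. \<Psi> (GT_W w) = A w"
    "\<forall>i\<in>letters. \<Psi> (GT_s i) = inv\<^bsub>nat_perms\<^esub> (?d i) \<otimes>\<^bsub>nat_perms\<^esub> f i"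
    by (elim bexE conjE)
  have B: "(\<lambda>p. \<Psi> (\<Phi> p)) \<in> hom S nat_perms"
    using hom_compose[OF \<Phi>(1) \<Psi>(1)] by (simp add: comp_def)
  have id: "(\<lambda>p. p) \<in> hom S S" by (simp add: hom_def)
  note equivariant = equivariant_at_group[OF group_S group_S B id, where j = j]
  have eq: "equivariant_at S S (\<lambda>p. \<Psi> (\<Phi> p)) (\<lambda>p. p) j p" if "p \<in> carrier S" for p
    using that[unfolded S_grp_def]
  proof (induction p rule: relative_presentation_induct)
    case one
    show ?case unfolding S_grp_def[symmetric] by (rule equivariant(1))
  next
    case (mult p q)
    then show ?case unfolding S_grp_def[symmetric] by (rule equivariant(2))
  next
    case (inv p)
    then show ?case unfolding S_grp_def[symmetric] by (rule equivariant(3))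
  next
    case (Inl v)
    have "\<Psi> (\<Phi> (S_V v)) = A (\<iota> v)"
      unfolding \<Phi>(2)[OF Inl] by (rule bspec[OF \<Psi>(2) \<iota>.hom_closed[OF Inl]])
    then have "equivariant_at S S (\<lambda>p. \<Psi> (\<Phi> p)) (\<lambda>p. p) j (S_V v)"
      unfolding equivariant_at_def using A_\<iota>[OF Inl] by simp
    then show ?case unfolding S_grp_def S_class_def .
  next
    \<comment> \<open>\<Phi> sends r_i to c s_i, which acts as \<open>f i\<close> and hence on the
      embedded copy as translation by r_i.\<close>
    case (Inr i)
    have "\<Psi> (\<Phi> (S_r i)) = \<Psi> (GT_W (G.boundary (\<nu> i) t)) \<otimes>\<^bsub>nat_perms\<^esub> \<Psi> (GT_s i)"
      unfolding \<Phi>(3)[OF Inr]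
      by (rule hom_mult[OF \<Psi>(1) twisted_letter_closed(1)[OF Inr] GT_s_closed[OF Inr]])
    also have "\<dots> = ?d i \<otimes>\<^bsub>nat_perms\<^esub> (inv\<^bsub>nat_perms\<^esub> (?d i) \<otimes>\<^bsub>nat_perms\<^esub> f i)"
      unfolding bspec[OF \<Psi>(2) twisted_letter_closed(2)[OF Inr]] bspec[OF \<Psi>(3) Inr] ..
    also have "\<dots> = f i"
      using d_closed[OF Inr] f_closed[OF Inr] by (simp add: N.m_assoc[symmetric])
    finally have "equivariant_at S S (\<lambda>p. \<Psi> (\<Phi> p)) (\<lambda>p. p) j (S_r i)"
      unfolding equivariant_at_def using bspec[OF f Inr] by simp
    then show ?case unfolding S_grp_def S_class_def .
  qed
  obtain v where v: "v \<in> pverts T" using ex_vertex by blast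
  show ?thesis
  proof (rule inj_onI)
    fix p q assume pq: "p \<in> carrier S" "q \<in> carrier S" and \<Phi>_eq: "\<Phi> p = \<Phi> q"
    \<comment> \<open>Both elements are applied to the point of the unit.\<close>
    have "j p = j q"
      using bspec[OF eq[OF pq(1), unfolded equivariant_at_def] S.one_closed]
        bspec[OF eq[OF pq(2), unfolded equivariant_at_def] S.one_closed] \<Phi>_eq pq by simp
    then show "p = q"
      by (rule trace_point_inj[OF group_S S_V_hom v vertex_embeds_in_S[OF v] ext[OF v] pq])
  qed
qed

text \<open>The map \<iota> was introduced through whole vertex groups, whereas the inclusions F_i
  into G_i concern single factors. The two descriptions agree coordinate by coordinate, because
  \<epsilon> reads a word in x and y unchanged in G.\<close>

lemma \<iota>_copy_elem:
  assumes i: "i < 3 * card (pverts T)" and w: "w \<in> words F_gens"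
  shows "\<iota> (polygon_elem F_gens F_rels T num side i (copy_elem F_gens F_rels i (word_class F_gens F_rels w))) =
    polygon_elem G_gens (G_rels \<phi> n) T num side i (copy_elem G_gens (G_rels \<phi> n) i (G_class \<phi> n w))"
proof -
  note v = F.vertex_of[OF i]
  have c: "word_class F_gens F_rels w \<in> carrier F.P" using w by simp
  then have "copy_elem F_gens F_rels i (word_class F_gens F_rels w) \<in> carrier (F.VG (vertex_of T num i))"
    unfolding v(2) by (auto simp: copy_elem_def vertex_group_closed)
  moreover have "incl (vertex_of T num i) (copy_elem F_gens F_rels i (word_class F_gens F_rels w)) =
      copy_elem G_gens (G_rels \<phi> n) i (G_class \<phi> n w)"
    unfolding incl_def copy_elem_def v(2)
    using \<epsilon>_class[OF w] by (intro restrict_ext) (simp add: F_class_def)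
  ultimately show ?thesis
    unfolding F.polygon_elem_eq G.polygon_elem_eq using \<iota>_elem[OF v(1)] by simp
qed

lemma GT_class_twisted_letter:
  assumes "i \<in> letters"
  shows "GT_class \<phi> n T num side \<nu>
      [(True, Inl (polygon_side_elem G_gens (G_rels \<phi> n) T num side (\<nu> i) gen_t)), (True, Inr i)] =
    GT_W (G.boundary (\<nu> i) t) \<otimes>\<^bsub>GT\<^esub> GT_s i"
proof -
  interpret GT: group "relative_presentation W letters (GT_rels \<phi> n T num side \<nu>)"
    by (rule group_relative_presentation)
  have "[(True, Inl (G.boundary (\<nu> i) t)), (True, Inr i)] \<in> words (carrier W <+> letters)"
    using twisted_letter_closed(2)[OF assms] assms by (simp add: InlI InrI)
  note eval = relative_class_eq_word_eval[OF this]
  show ?thesis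
    unfolding G.boundary_letter[OF gen_t_G_gens, symmetric] GT_class_def eval
    using GT_s_closed[OF assms] unfolding GT_grp_def GT_class_def by simp
qed

lemma injective_homomorphisms:
  "\<exists>\<iota> \<in> hom (V_grp T num side) (W_grp \<phi> n T num side).
      (\<forall>i < 3 * card (pverts T). \<forall>w \<in> words F_gens.
         \<iota> (polygon_elem F_gens F_rels T num side i
              (copy_elem F_gens F_rels i (word_class F_gens F_rels w)))
           = polygon_elem G_gens (G_rels \<phi> n) T num side i
              (copy_elem G_gens (G_rels \<phi> n) i (word_class G_gens (G_rels \<phi> n) w))) \<and>
      inj_on \<iota> (carrier (V_grp T num side)) \<and>
      (\<exists>\<Phi> \<in> hom (S_grp \<phi> n T num side \<nu>) (GT_grp \<phi> n T num side \<nu>).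
         (\<forall>v \<in> carrier (V_grp T num side).
            \<Phi> (S_class \<phi> n T num side \<nu> (letter (Inl v)))
              = GT_class \<phi> n T num side \<nu> (letter (Inl (\<iota> v)))) \<and>
         (\<forall>i \<in> {1..card (pverts T) + 1}.
            \<Phi> (S_class \<phi> n T num side \<nu> (letter (Inr i)))
              = GT_class \<phi> n T num side \<nu>
                  [(True, Inl (polygon_side_elem G_gens (G_rels \<phi> n) T num side (\<nu> i) gen_t)),
                   (True, Inr i)]) \<and>
         inj_on \<Phi> (carrier (S_grp \<phi> n T num side \<nu>)))"
proof -
  obtain \<Phi> where \<Phi>: "\<Phi> \<in> hom S GT" "\<forall>v\<in>carrier V. \<Phi> (S_V v) = GT_W (\<iota> v)"
    "\<forall>i\<in>letters. \<Phi> (S_r i) = GT_W (G.boundary (\<nu> i) t) \<otimes>\<^bsub>GT\<^esub> GT_s i"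
    using \<Phi>_ex by (elim bexE conjE)
  have inj: "inj_on \<Phi> (carrier S)"
    by (rule \<Phi>_inj[OF \<Phi>(1) bspec[OF \<Phi>(2)] bspec[OF \<Phi>(3)]])
  show ?thesis
  proof (intro bexI[of _ \<iota>] bexI[of _ \<Phi>] conjI allI impI ballI)
    fix i assume "i \<in> {1..card (pverts T) + 1}"
    then have i: "i \<in> letters" unfolding stable_letters_def .
    show "\<Phi> (S_r i) = GT_class \<phi> n T num side \<nu>
        [(True, Inl (polygon_side_elem G_gens (G_rels \<phi> n) T num side (\<nu> i) gen_t)), (True, Inr i)]"
      unfolding GT_class_twisted_letter[OF i] by (rule bspec[OF \<Phi>(3) i])
  next
    fix v assume "v \<in> carrier V"
    then show "\<Phi> (S_V v) = GT_W (\<iota> v)" by (rule bspec[OF \<Phi>(2)])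
  qed (rule \<iota>_copy_elem \<iota>_inj inj \<Phi>(1) \<iota>_hom; assumption)+
qed

end

theorem theorem5p6:
  fixes \<phi> :: "gen gword set \<Rightarrow> gen gword set"
    and n :: nat
    and T :: "'v pair_pre_digraph"
    and num :: "'v \<Rightarrow> nat"
    and side :: "'v \<Rightarrow> 'v \<Rightarrow> nat"
    and \<nu> :: "nat \<Rightarrow> nat"
  assumes "palindromic_aut \<phi>" and "monotone_aut \<phi>" and "n \<ge> 1"
    and "finite_tree T" and "\<forall>v\<in>pverts T. out_degree (with_proj T) v \<le> 3"
    and "index_assignment T num side" and "boundary_enumeration T side \<nu>"
  shows "\<exists>\<iota> \<in> hom (V_grp T num side) (W_grp \<phi> n T num side).
      (\<forall>i < 3 * card (pverts T). \<forall>w \<in> words F_gens.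
         \<iota> (polygon_elem F_gens F_rels T num side i
              (copy_elem F_gens F_rels i (word_class F_gens F_rels w)))
           = polygon_elem G_gens (G_rels \<phi> n) T num side i
              (copy_elem G_gens (G_rels \<phi> n) i (word_class G_gens (G_rels \<phi> n) w))) \<and>
      inj_on \<iota> (carrier (V_grp T num side)) \<and>
      (\<exists>\<Phi> \<in> hom (S_grp \<phi> n T num side \<nu>) (GT_grp \<phi> n T num side \<nu>).
         (\<forall>v \<in> carrier (V_grp T num side).
            \<Phi> (S_class \<phi> n T num side \<nu> (letter (Inl v)))
              = GT_class \<phi> n T num side \<nu> (letter (Inl (\<iota> v)))) \<and>
         (\<forall>i \<in> {1..card (pverts T) + 1}.
            \<Phi> (S_class \<phi> n T num side \<nu> (letter (Inr i)))
              = GT_class \<phi> n T num side \<nu>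
                  [(True, Inl (polygon_side_elem G_gens (G_rels \<phi> n) T num side (\<nu> i) gen_t)),
                   (True, Inr i)]) \<and>
         inj_on \<Phi> (carrier (S_grp \<phi> n T num side \<nu>)))"
proof -
  have iso: "\<phi> \<in> iso F_grp F_grp"
    using assms(1) unfolding palindromic_aut_def by (rule conjunct1)
  obtain J where J: "side_presentation F_gens F_rels J"
    using ex_side_presentation_F by blast
  obtain \<epsilon> where \<epsilon>: "\<epsilon> \<in> hom F_grp (G_grp \<phi> n)" "\<forall>w\<in>words F_gens. \<epsilon> (F_class w) = G_class \<phi> n w"
    "\<forall>p\<in>carrier F_grp. G_t \<phi> n \<otimes>\<^bsub>G_grp \<phi> n\<^esub> \<epsilon> p = \<epsilon> ((\<phi> ^^ n) p) \<otimes>\<^bsub>G_grp \<phi> n\<^esub> G_t \<phi> n"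
    using F_to_G[OF iso, of n] by (elim bexE conjE)
  have \<epsilon>_inj: "inj_on \<epsilon> (carrier F_grp)"
    by (rule F_to_G_inj[OF iso \<epsilon>(1) bspec[OF \<epsilon>(2)]])
  have "\<exists>J'. side_presentation G_gens (G_rels \<phi> n) J' \<and> (\<forall>p\<in>carrier F_grp. J' (\<epsilon> p) = \<epsilon> (J p))"
    by (rule ex_side_presentation_G[OF assms(1) J \<epsilon>(1) bspec[OF \<epsilon>(2)] bspec[OF \<epsilon>(3)]])
  then obtain J' where J': "side_presentation G_gens (G_rels \<phi> n) J'" "\<forall>p\<in>carrier F_grp. J' (\<epsilon> p) = \<epsilon> (J p)"
    by (elim exE conjE)
  have \<nu>: "\<nu> k < 3 * card (pverts T)" if "k \<le> card (pverts T) + 1" for k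
  proof -
    have "bij_betw \<nu> {0..card (pverts T) + 1}
        ({0..<3 * card (pverts T)} - {side u v | u v. (u, v) \<in> parcs T})"
      using assms(7) unfolding boundary_enumeration_def Let_def by (rule conjunct1)
    then have "\<nu> k \<in> {0..<3 * card (pverts T)} - {side u v | u v. (u, v) \<in> parcs T}"
      by (rule bij_betw_apply) (use that in simp)
    then show ?thesis by simp
  qed
  interpret polygon_pair J J' \<phi> n T num side \<epsilon> \<nu>
  proof (intro polygon_pair.intro polygon.intro polygon_axioms.intro polygon_pair_axioms.intro)
  qed (use J J'(1) assms(4,6) iso \<nu> \<epsilon>_inj \<epsilon>(1) bspec[OF \<epsilon>(2)] bspec[OF \<epsilon>(3)] bspec[OF J'(2)]
      in \<open>simp_all only: F_grp_def\<close>)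
  show ?thesis by (rule injective_homomorphisms)
qed

end
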